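(* Let $H=\ell^2(\mathbb H)$ and let $N$ be a densely defined closed right linear operator in $H$ which is normal. Let $m\in\mathbb S$ and assume that $\sigma_S(N)=\Omega_K$, where $K$ is a subset of a rectifiable curve in $\mathbb C_m^{+}$. Then for every $\epsilon>0$ there exist a diagonal operator $D$ and a Hilbert–Schmidt operator $K'$ with $\|K'\|<\epsilon$ such that $N=D+K'$.
   Context: $\mathbb H$ denotes the real quaternions and $\ell^2(\mathbb H)$ the quaternionic Hilbert space of square-summable quaternion sequences (right $\mathbb H$-module, inner product $\langle x,y\rangle=\sum_n\overline{x_n}y_n$). $\mathbb S=\{q\in\mathbb H:\bar q=-q,|q|=1\}$; $\mathbb C_m=\{\alpha+m\beta:\alpha,\beta\in\mathbb R\}$; $\mathbb C_m^{+}=\{\alpha+m\beta:\alpha\ge0,\ \beta\in\mathbb R\}$. For densely defined $N$ the adjoint $N^*$ is given by $\langle y,Nx\rangle=\langle N^*y,x\rangle$ on its natural domain; $N$ normal means $NN^*=N^*N$. For a right linear $T$ and $q\in\mathbb H$, $\Delta_q(T)=T^2-T(q+\bar q)+I|q|^2$ on $D(T^2)$; the spherical resolvent $\rho_S(T)$ is the set of $q$ such that $\Delta_q(T)$ is injective, has dense range, and has bounded inverse on its range; $\sigma_S(T)=\mathbb H\setminus\rho_S(T)$. For $K\subseteq\mathbb C_m$, $\Omega_K=\{\alpha+j\beta:\alpha,\beta\in\mathbb R,\ \alpha+m\beta\in K,\ j\in\mathbb S\}$. With $\{\phi_r\}$ an orthonormal basis: a bounded $T$ is Hilbert–Schmidt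 if $\sum_r\|T\phi_r\|^2<\infty$; a densely defined closed $D$ is diagonal if there is an orthonormal basis $\{\phi_r\}\subseteq D(D)$ and $q_r\in\mathbb H$ with $D\phi_r=\phi_rq_r$. $\|\cdot\|$ is the operator norm; $D+K'$ is defined on $D(D)$. *)

theory Defs
  imports "HOL-Analysis.Analysis"
begin

text \<open>A quaternion a + b i + c j + d k is represented by the 4-tuple (a,b,c,d) of reals.
  Addition, real scaling, the norm (which is the quaternion modulus sqrt(a^2+b^2+c^2+d^2))
  and the topology are those of the product type; multiplication and conjugation are defined
  here (Hamilton product).\<close>

type_synonym quat = "real \<times> real \<times> real \<times> real"

definition qmul :: "quat \<Rightarrow> quat \<Rightarrow> quat" where
  "qmul p q = (case p of (a1, b1, c1, d1) \<Rightarrow> case q of (a2, b2, c2, d2) \<Rightarrow>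
     (a1*a2 - b1*b2 - c1*c2 - d1*d2,
      a1*b2 + b1*a2 + c1*d2 - d1*c2,
      a1*c2 - b1*d2 + c1*a2 + d1*b2,
      a1*d2 + b1*c2 - c1*b2 + d1*a2))"

definition qcnj :: "quat \<Rightarrow> quat" where
  "qcnj q = (case q of (a, b, c, d) \<Rightarrow> (a, -b, -c, -d))"

definition qof_real :: "real \<Rightarrow> quat" where
  "qof_real r = (r, 0, 0, 0)"

definition qone :: quat where "qone = qof_real 1"

definition sphS :: "quat set" where
  "sphS = {q. qcnj q = - q \<and> norm q = 1}"

definition Cm :: "quat \<Rightarrow> quat set" where
  "Cm m = {qof_real \<alpha> + \<beta> *\<^sub>R m | \<alpha> \<beta>. True}"

definition Cm_plus :: "quat \<Rightarrow> quat set" where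
  "Cm_plus m = {qof_real \<alpha> + \<beta> *\<^sub>R m | \<alpha> \<beta>. \<alpha> \<ge> 0}"

definition OmegaK :: "quat \<Rightarrow> quat set \<Rightarrow> quat set" where
  "OmegaK m K = {qof_real \<alpha> + \<beta> *\<^sub>R j | \<alpha> \<beta> j. qof_real \<alpha> + \<beta> *\<^sub>R m \<in> K \<and> j \<in> sphS}"

definition rectifiable_curve :: "(real \<Rightarrow> quat) \<Rightarrow> bool" where
  "rectifiable_curve \<gamma> \<longleftrightarrow> continuous_on {0..1} \<gamma> \<and>
     (\<exists>B. \<forall>ts :: real list. sorted ts \<and> set ts \<subseteq> {0..1} \<longrightarrow>
        (\<Sum>i < length ts - 1. norm (\<gamma> (ts ! Suc i) - \<gamma> (ts ! i))) \<le> B)"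

type_synonym qseq = "nat \<Rightarrow> quat"

definition l2H :: "qseq set" where
  "l2H = {x. summable (\<lambda>n. (norm (x n))\<^sup>2)}"

definition vadd :: "qseq \<Rightarrow> qseq \<Rightarrow> qseq" where
  "vadd x y = (\<lambda>n. x n + y n)"

definition vsub :: "qseq \<Rightarrow> qseq \<Rightarrow> qseq" where
  "vsub x y = (\<lambda>n. x n - y n)"

definition vrmul :: "qseq \<Rightarrow> quat \<Rightarrow> qseq" where
  "vrmul x q = (\<lambda>n. qmul (x n) q)"

definition vzero :: qseq where "vzero = (\<lambda>n. 0)"

definition l2inner :: "qseq \<Rightarrow> qseq \<Rightarrow> quat" where
  "l2inner x y = (\<Sum>n. qmul (qcnj (x n)) (y n))"

definition l2norm :: "qseq \<Rightarrow> real" where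
  "l2norm x = sqrt (\<Sum>n. (norm (x n))\<^sup>2)"

definition l2_tendsto :: "(nat \<Rightarrow> qseq) \<Rightarrow> qseq \<Rightarrow> bool" where
  "l2_tendsto xs x \<longleftrightarrow> (\<lambda>k. l2norm (vsub (xs k) x)) \<longlonglongrightarrow> 0"

definition dense_in_H :: "qseq set \<Rightarrow> bool" where
  "dense_in_H A \<longleftrightarrow> A \<subseteq> l2H \<and> (\<forall>x\<in>l2H. \<forall>\<epsilon>>0. \<exists>y\<in>A. l2norm (vsub x y) < \<epsilon>)"

text \<open>An operator is a pair (domain, map); values outside the domain are irrelevant.\<close>

definition right_linear_op :: "qseq set \<Rightarrow> (qseq \<Rightarrow> qseq) \<Rightarrow> bool" where
  "right_linear_op D T \<longleftrightarrow> D \<subseteq> l2H \<and> vzero \<in> D \<and>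
     (\<forall>x\<in>D. \<forall>y\<in>D. vadd x y \<in> D) \<and> (\<forall>x\<in>D. \<forall>q. vrmul x q \<in> D) \<and>
     (\<forall>x\<in>D. T x \<in> l2H) \<and>
     (\<forall>x\<in>D. \<forall>y\<in>D. T (vadd x y) = vadd (T x) (T y)) \<and>
     (\<forall>x\<in>D. \<forall>q. T (vrmul x q) = vrmul (T x) q)"

definition closed_op :: "qseq set \<Rightarrow> (qseq \<Rightarrow> qseq) \<Rightarrow> bool" where
  "closed_op D T \<longleftrightarrow> (\<forall>xs x y. (\<forall>k. xs k \<in> D) \<and> x \<in> l2H \<and> y \<in> l2H \<and>
      l2_tendsto xs x \<and> l2_tendsto (\<lambda>k. T (xs k)) y \<longrightarrow> x \<in> D \<and> T x = y)"

definition adj_dom :: "qseq set \<Rightarrow> (qseq \<Rightarrow> qseq) \<Rightarrow> qseq set" where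
  "adj_dom D T = {y \<in> l2H. \<exists>z\<in>l2H. \<forall>x\<in>D. l2inner y (T x) = l2inner z x}"

definition adj_op :: "qseq set \<Rightarrow> (qseq \<Rightarrow> qseq) \<Rightarrow> qseq \<Rightarrow> qseq" where
  "adj_op D T y = (THE z. z \<in> l2H \<and> (\<forall>x\<in>D. l2inner y (T x) = l2inner z x))"

definition normal_op :: "qseq set \<Rightarrow> (qseq \<Rightarrow> qseq) \<Rightarrow> bool" where
  "normal_op D T \<longleftrightarrow>
     (let DA = adj_dom D T; A = adj_op D T in
      {y \<in> DA. A y \<in> D} = {x \<in> D. T x \<in> DA} \<and>
      (\<forall>x \<in> {y \<in> DA. A y \<in> D}. T (A x) = A (T x)))"

definition dom_sq :: "qseq set \<Rightarrow> (qseq \<Rightarrow> qseq) \<Rightarrow> qseq set" where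
  "dom_sq D T = {x \<in> D. T x \<in> D}"

definition Delta_q :: "(qseq \<Rightarrow> qseq) \<Rightarrow> quat \<Rightarrow> qseq \<Rightarrow> qseq" where
  "Delta_q T q x = vadd (vsub (T (T x)) (vrmul (T x) (q + qcnj q))) (vrmul x (qof_real ((norm q)\<^sup>2)))"

definition spherical_resolvent :: "qseq set \<Rightarrow> (qseq \<Rightarrow> qseq) \<Rightarrow> quat set" where
  "spherical_resolvent D T = {q.
     inj_on (Delta_q T q) (dom_sq D T) \<and>
     (\<forall>y\<in>l2H. \<forall>\<epsilon>>0. \<exists>x\<in>dom_sq D T. l2norm (vsub (Delta_q T q x) y) < \<epsilon>) \<and>
     (\<exists>C. \<forall>x\<in>dom_sq D T. l2norm x \<le> C * l2norm (Delta_q T q x))}"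

definition spherical_spectrum :: "qseq set \<Rightarrow> (qseq \<Rightarrow> qseq) \<Rightarrow> quat set" where
  "spherical_spectrum D T = UNIV - spherical_resolvent D T"

text \<open>An orthonormal basis: an orthonormal family that is total (only 0 is orthogonal to all).
  Since l2(H) is separable and infinite dimensional, bases are indexed by nat.\<close>
definition onb :: "(nat \<Rightarrow> qseq) \<Rightarrow> bool" where
  "onb \<phi> \<longleftrightarrow> (\<forall>r. \<phi> r \<in> l2H) \<and>
     (\<forall>r s. l2inner (\<phi> r) (\<phi> s) = (if r = s then qone else 0)) \<and>
     (\<forall>x\<in>l2H. (\<forall>r. l2inner (\<phi> r) x = 0) \<longrightarrow> x = vzero)"

definition bounded_op :: "(qseq \<Rightarrow> qseq) \<Rightarrow> bool" where
  "bounded_op T \<longleftrightarrow> right_linear_op l2H T \<and> (\<exists>C. \<forall>x\<in>l2H. l2norm (T x) \<le> C * l2norm x)"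

definition op_norm :: "(qseq \<Rightarrow> qseq) \<Rightarrow> real" where
  "op_norm T = (SUP x \<in> {x \<in> l2H. l2norm x \<le> 1}. l2norm (T x))"

definition hilbert_schmidt :: "(qseq \<Rightarrow> qseq) \<Rightarrow> bool" where
  "hilbert_schmidt T \<longleftrightarrow> bounded_op T \<and>
     (\<exists>\<phi>. onb \<phi> \<and> summable (\<lambda>r. (l2norm (T (\<phi> r)))\<^sup>2))"

definition diagonal_op :: "qseq set \<Rightarrow> (qseq \<Rightarrow> qseq) \<Rightarrow> bool" where
  "diagonal_op D T \<longleftrightarrow> right_linear_op D T \<and> dense_in_H D \<and> closed_op D T \<and>
     (\<exists>\<phi> q. onb \<phi> \<and> (\<forall>r. \<phi> r \<in> D) \<and> (\<forall>r. T (\<phi> r) = vrmul (\<phi> r) (q r)))"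

end

(*
  A normal operator on a quaternionic Hilbert space is treated as a real-linear operator commuting
  with the right multiplications by two anticommuting imaginary units. Spectral projections come
  from orbit growth: for a self-adjoint S the vectors with |S^n x| = O(r^n) form a closed subspace
  on which |Sx| <= r|x|, and |Sx| >= r|x| on its orthogonal complement. Applied to the real part of
  N and to the two signs of its imaginary part this yields, at every scale 2^-n, orthogonal
  projections onto cells on which N is a complex scalar up to O(2^-n). A cell that is not zero lies
  near the spectrum, and a rectifiable curve meets only O(2^n) cells of scale 2^-n.

  Orthonormalize the components in the cells of scale n of the first n basis vectors, n = 1, 2, ...
  Every vector produced at stage n stays in one cell of the preceding scale, since the span of the
  earlier vectors is invariant under those projections. So stage n contributes at most
  O(n 2^n) O(4^-n) to the sum of the squared errors |N phi - phi q|^2. The series converges, and it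
  is small if the construction starts at a fine scale.

  Since the curve is bounded, so is the spectrum, and then N is bounded and everywhere defined:
  otherwise a spectral subspace of (1 + N* N)^-1 near 0 would carry a large approximate eigenvalue.
*)
theory Submission
  imports Defs
begin

section \<open>Hilbert spaces and orthogonal projections\<close>

text \<open>Growth of orbits sees only the modulus of a self-adjoint operator. Hence the real and
  imaginary parts of N are first shifted so as to be positive; the growth subspaces then play the
  role of a resolution of the identity, without measures or functional calculus. The obstacle is
  noncommutativity. If N x is close to x (a + b m) and j anticommutes with m, then N (x j) is close
  to (x j) (a - b m). A cell is therefore not a quaternionic subspace, while the orthonormalization
  has to be quaternionic. The remedy is that only the family of all cells has to be stable under J:
  then the quaternionic span of a cell-stable set of vectors is stable under every cell projection.
  The price is that each point near the curve is charged with cells at both signs of its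
  m-coordinate, in accordance with the fact that Omega_K determines a point of K only up to that
  sign. Stage n cuts at scale M + n + 1, but its error is measured at scale M + n, because it is the
  coarser projections that preserve the span of what came before.\<close>

lemma proj_exists:
  fixes M :: "'a::{real_inner,complete_space} set"
  assumes M: "subspace M" "closed M"
  shows "\<exists>p\<in>M. \<forall>y\<in>M. (x - p) \<bullet> y = 0"
proof -
  define d where "d = infdist x M"
  have ne: "M \<noteq> {}" using M subspace_0 by blast
  have lower: "d \<le> norm (x - y)" if "y \<in> M" for y
    unfolding d_def by (metis dist_norm infdist_le that)
  have d0: "d \<ge> 0" unfolding d_def by (rule infdist_nonneg)
  have "\<exists>p. \<forall>n. p n \<in> M \<and> norm (x - p n) < d + inverse (Suc n)"
  proof -
    have "\<exists>y\<in>M. norm (x - y) < d + inverse (Suc n)" for n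
    proof (rule ccontr)
      assume "\<not> ?thesis"
      then have "d + inverse (Suc n) \<le> dist x y" if "y \<in> M" for y
        using that by (auto simp: dist_norm not_less)
      then have "d + inverse (Suc n) \<le> infdist x M"
        unfolding infdist_notempty[OF ne] by (intro cINF_greatest[OF ne])
      then show False by (simp add: d_def)
    qed
    then show ?thesis by metis
  qed
  then obtain p where p: "\<And>n. p n \<in> M" "\<And>n. norm (x - p n) < d + inverse (Suc n)" by blast
  \<comment> \<open>Parallelogram identity for \<open>x - p m\<close> and \<open>x - p n\<close>:
    their mean is \<open>x\<close> minus a point of \<open>M\<close>, hence has norm at least
    \<open>d\<close>.\<close>
  have par: "(norm (p m - p n))\<^sup>2 \<le> 2 * ((d + inverse (Suc m))\<^sup>2 - d\<^sup>2) + 2 * ((d + inverse (Suc n))\<^sup>2 - d\<^sup>2)" for m n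
  proof -
    have "(1/2) *\<^sub>R (p m + p n) \<in> M" using p(1) M(1) by (simp add: subspace_add subspace_scale)
    from lower[OF this] have "d\<^sup>2 \<le> (norm (x - (1/2) *\<^sub>R (p m + p n)))\<^sup>2"
      using d0 by (simp add: power_mono)
    moreover have "(norm (p m - p n))\<^sup>2 = 2 * (norm (x - p m))\<^sup>2 + 2 * (norm (x - p n))\<^sup>2
        - 4 * (norm (x - (1/2) *\<^sub>R (p m + p n)))\<^sup>2"
      unfolding power2_norm_eq_inner by (simp add: algebra_simps inner_commute)
    moreover have "(norm (x - p n))\<^sup>2 \<le> (d + inverse (Suc n))\<^sup>2" for n
      using p(2)[of n] by (intro power_mono) auto
    moreover have "P \<le> 2 * (A' - D) + 2 * (B' - D)"
      if "A \<le> A'" "B \<le> B'" "D \<le> C" "P = 2 * A + 2 * B - 4 * C" for A A' B B' C D P :: real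
      using that by argo
    ultimately show ?thesis by blast
  qed
  have lim0: "(\<lambda>n. 2 * ((d + inverse (real (Suc n)))\<^sup>2 - d\<^sup>2)) \<longlonglongrightarrow> 0"
  proof -
    have "(\<lambda>n. 2 * ((d + inverse (real (Suc n)))\<^sup>2 - d\<^sup>2)) \<longlonglongrightarrow> 2 * ((d + 0)\<^sup>2 - d\<^sup>2)"
      by (intro tendsto_intros LIMSEQ_inverse_real_of_nat)
    then show ?thesis by simp
  qed
  have "Cauchy p"
  proof (rule CauchyI)
    fix e :: real assume e: "e > 0"
    then have "e\<^sup>2 / 2 > 0" by simp
    from order_tendstoD(2)[OF lim0 this] obtain K
      where K: "\<And>n. n \<ge> K \<Longrightarrow> 2 * ((d + inverse (real (Suc n)))\<^sup>2 - d\<^sup>2) < e\<^sup>2 / 2"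
      unfolding eventually_sequentially by blast
    have "norm (p m - p n) < e" if "m \<ge> K" "n \<ge> K" for m n
    proof -
      have "(norm (p m - p n))\<^sup>2 < e\<^sup>2" using par[of m n] K[OF that(1)] K[OF that(2)] by linarith
      then show ?thesis using e by (simp add: power2_less_imp_less)
    qed
    then show "\<exists>M. \<forall>m\<ge>M. \<forall>n\<ge>M. norm (p m - p n) < e" by blast
  qed
  then obtain q where q: "p \<longlonglongrightarrow> q" using Cauchy_convergent convergentD by blast
  have qM: "q \<in> M" using closed_sequentially[OF M(2)] p(1) q by blast
  have qd: "norm (x - q) \<le> d"
  proof -
    have "(\<lambda>n. norm (x - p n)) \<longlonglongrightarrow> norm (x - q)" by (intro tendsto_intros q)
    moreover have "(\<lambda>n. d + inverse (real (Suc n))) \<longlonglongrightarrow> d + 0"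
      by (intro tendsto_intros LIMSEQ_inverse_real_of_nat)
    ultimately show ?thesis using p(2) by (simp add: LIMSEQ_le less_imp_le)
  qed
  have "(x - q) \<bullet> y = 0" if y: "y \<in> M" for y
  proof (cases "y = 0")
    case False
    \<comment> \<open>The real \<open>t\<close> that minimizes the norm of
      \<open>x - q - t y\<close>; minimality of \<open>q\<close> then forces the linear term to
      vanish.\<close>
    define t where "t = ((x - q) \<bullet> y) / (y \<bullet> y)"
    have yy: "y \<bullet> y > 0" using False by simp
    have "q + t *\<^sub>R y \<in> M" using qM y M(1) by (simp add: subspace_add subspace_scale)
    from lower[OF this] have "norm (x - q) \<le> norm (x - (q + t *\<^sub>R y))" using qd by linarith
    then have "(x - q) \<bullet> (x - q) \<le> (x - (q + t *\<^sub>R y)) \<bullet> (x - (q + t *\<^sub>R y))"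
      by (simp add: norm_le)
    also have "\<dots> = (x - q) \<bullet> (x - q) - 2 * t * ((x - q) \<bullet> y) + t * t * (y \<bullet> y)"
      by (simp add: algebra_simps inner_commute)
    finally have "2 * t * ((x - q) \<bullet> y) \<le> t * (t * (y \<bullet> y))" by simp
    moreover have "t * (y \<bullet> y) = (x - q) \<bullet> y" unfolding t_def using yy by simp
    ultimately have "t * ((x - q) \<bullet> y) \<le> 0" by simp
    then have "((x - q) \<bullet> y)\<^sup>2 / (y \<bullet> y) \<le> 0" unfolding t_def by (simp add: power2_eq_square)
    then have "((x - q) \<bullet> y)\<^sup>2 \<le> 0" using yy by (simp add: divide_le_0_iff)
    then show ?thesis by simp
  qed simp
  then show ?thesis using qM by blast
qed

definition proj :: "'a::real_inner set \<Rightarrow> 'a \<Rightarrow> 'a" where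
  "proj M x = (SOME p. p \<in> M \<and> (\<forall>y\<in>M. (x - p) \<bullet> y = 0))"

definition orthproj :: "('a::real_inner \<Rightarrow> 'a) \<Rightarrow> bool" where
  "orthproj P \<longleftrightarrow> bounded_linear P \<and> (\<forall>x. P (P x) = P x) \<and> (\<forall>x y. P x \<bullet> y = x \<bullet> P y)"

section \<open>Bounded operators together with their adjoints\<close>

definition adj :: "('a::real_inner \<Rightarrow> 'b::real_inner) \<Rightarrow> ('b \<Rightarrow> 'a) \<Rightarrow> bool" where
  "adj C C' \<longleftrightarrow> bounded_linear C \<and> bounded_linear C' \<and> (\<forall>x y. C x \<bullet> y = x \<bullet> C' y)"

lemma inner_eq_on_dense:
  fixes z z' :: "'a::real_inner"
  assumes "closure D = UNIV" "\<And>x. x \<in> D \<Longrightarrow> z \<bullet> x = z' \<bullet> x"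
  shows "z = z'"
proof -
  have "closed {x. z \<bullet> x = z' \<bullet> x}" by (intro closed_Collect_eq continuous_intros)
  then have "closure D \<subseteq> {x. z \<bullet> x = z' \<bullet> x}" using assms(2) by (intro closure_minimal) auto
  then have "\<forall>x. z \<bullet> x = z' \<bullet> x" using assms(1) by auto
  then show ?thesis using vector_eq_rdot by blast
qed

lemma adj_bl: "adj C C' \<Longrightarrow> bounded_linear C" "adj C C' \<Longrightarrow> bounded_linear C'"
  and adjD: "adj C C' \<Longrightarrow> C x \<bullet> y = x \<bullet> C' y"
  by (auto simp: adj_def)

lemma adj_sym: "adj C C' \<Longrightarrow> adj C' C"
  unfolding adj_def by (metis inner_commute)

lemma adj_compose: "adj C C' \<Longrightarrow> adj D D' \<Longrightarrow> adj (\<lambda>x. C (D x)) (\<lambda>x. D' (C' x))"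
  by (auto simp: adj_def intro: bounded_linear_compose)

lemma adj_add: "adj C C' \<Longrightarrow> adj D D' \<Longrightarrow> adj (\<lambda>x. C x + D x) (\<lambda>x. D' x + C' x)"
  by (auto simp: adj_def inner_left_distrib inner_right_distrib intro: bounded_linear_add)

lemma adj_diff: "adj C C' \<Longrightarrow> adj D D' \<Longrightarrow> adj (\<lambda>x. C x - D x) (\<lambda>x. C' x - D' x)"
  by (auto simp: adj_def inner_diff_left inner_diff_right intro: bounded_linear_sub)

lemma adj_scaleR: "adj C C' \<Longrightarrow> adj (\<lambda>x. r *\<^sub>R C x) (\<lambda>x. r *\<^sub>R C' x)"
  by (auto simp: adj_def intro: bounded_linear_const_scaleR)

lemma adj_id: "adj (\<lambda>x. x) (\<lambda>x. x)"
  by (auto simp: adj_def bounded_linear_ident)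

lemma adj_unique: "adj C C' \<Longrightarrow> adj C C'' \<Longrightarrow> C' = C''"
proof
  fix y
  assume "adj C C'" "adj C C''"
  then have "x \<bullet> C' y = x \<bullet> C'' y" for x by (metis adjD)
  then show "C' y = C'' y" using vector_eq_ldot by blast
qed

text \<open>Taking adjoints on both sides of \<open>S' C = C S\<close> gives
  \<open>C' S' = S C'\<close>, and adjoints are unique.\<close>

lemma adj_intertwine:
  assumes "adj S S" "adj S' S'" "adj C C'" "\<And>x. S' (C x) = C (S x)"
  shows "S (C' x) = C' (S' x)"
proof -
  have "adj (\<lambda>x. S' (C x)) (\<lambda>x. C' (S' x))" "adj (\<lambda>x. C (S x)) (\<lambda>x. S (C' x))"
    using assms adj_compose by blast+
  moreover have "(\<lambda>x. S' (C x)) = (\<lambda>x. C (S x))" using assms(4) by auto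
  ultimately show ?thesis using adj_unique by metis
qed

lemma orthproj_adj: "orthproj P \<Longrightarrow> adj P P"
  by (auto simp: orthproj_def adj_def)

lemma orthproj_idem: "orthproj P \<Longrightarrow> P (P x) = P x"
  by (simp add: orthproj_def)

context
  fixes M :: "'a::{real_inner,complete_space} set"
  assumes M: "subspace M" "closed M"
begin

lemma proj_in: "proj M x \<in> M" and proj_orth: "y \<in> M \<Longrightarrow> (x - proj M x) \<bullet> y = 0"
proof -
  have "\<exists>p. p \<in> M \<and> (\<forall>y\<in>M. (x - p) \<bullet> y = 0)" using proj_exists[OF M, of x] by auto
  from someI_ex[OF this] show "proj M x \<in> M" "y \<in> M \<Longrightarrow> (x - proj M x) \<bullet> y = 0"
    unfolding proj_def by auto
qed

lemma proj_unique:
  assumes "p \<in> M" "\<And>y. y \<in> M \<Longrightarrow> (x - p) \<bullet> y = 0"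
  shows "proj M x = p"
proof -
  have "proj M x - p \<in> M" using assms(1) proj_in M(1) by (simp add: subspace_diff)
  then have "(x - p) \<bullet> (proj M x - p) - (x - proj M x) \<bullet> (proj M x - p) = 0"
    using assms(2) proj_orth by simp
  then have "(proj M x - p) \<bullet> (proj M x - p) = 0" by (simp add: inner_diff_left)
  then show ?thesis by simp
qed

lemma proj_id: "x \<in> M \<Longrightarrow> proj M x = x"
  by (rule proj_unique) auto

lemma orthproj_proj: "orthproj (proj M)"
  unfolding orthproj_def
proof (intro conjI allI)
  show "bounded_linear (proj M)"
  proof (rule bounded_linear_intro[where K=1])
    show "proj M (x + y) = proj M x + proj M y" for x y
      by (rule proj_unique)
        (use proj_in M(1) proj_orth[of _ x] proj_orth[of _ y] in
          \<open>auto simp: subspace_add algebra_simps\<close>)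
    show "proj M (r *\<^sub>R x) = r *\<^sub>R proj M x" for r x
    proof (rule proj_unique)
      fix y assume "y \<in> M"
      then have "r * ((x - proj M x) \<bullet> y) = 0" using proj_orth by simp
      then show "(r *\<^sub>R x - r *\<^sub>R proj M x) \<bullet> y = 0" by (simp add: algebra_simps)
    qed (use proj_in M(1) in \<open>auto simp: subspace_scale\<close>)
    show "norm (proj M x) \<le> norm x * 1" for x
    proof -
      have "(norm (proj M x))\<^sup>2 = x \<bullet> proj M x"
        using proj_orth[OF proj_in, of x x] by (simp add: power2_norm_eq_inner inner_diff_left)
      also have "\<dots> \<le> norm x * norm (proj M x)" by (rule norm_cauchy_schwarz)
      finally have "norm (proj M x) * norm (proj M x) \<le> norm x * norm (proj M x)"
        by (simp add: power2_eq_square)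
      then show ?thesis by (cases "norm (proj M x) = 0") (use mult_le_cancel_right_pos in \<open>force+\<close>)
    qed
  qed
  show "proj M (proj M x) = proj M x" for x by (rule proj_id[OF proj_in])
  show "proj M x \<bullet> y = x \<bullet> proj M y" for x y
  proof -
    have "(x - proj M x) \<bullet> proj M y = 0" "(y - proj M y) \<bullet> proj M x = 0"
      using proj_orth proj_in by auto
    then show ?thesis by (simp only: inner_diff_left) (metis eq_iff_diff_eq_0 inner_commute)
  qed
qed

end

text \<open>Since \<open>C'\<close> maps \<open>M'\<close> into \<open>M\<close>, moving it across
  the inner product shows that \<open>C\<close> maps the complement of \<open>M\<close> into the
  complement of \<open>M'\<close>. So \<open>C\<close> respects both parts of the decomposition of
  \<open>x\<close>.\<close>

lemma proj_intertwine:
  fixes M :: "'a::{real_inner,complete_space} set" and M' :: "'b::{real_inner,complete_space} set"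
  assumes "subspace M" "closed M" "subspace M'" "closed M'"
    and "adj C C'" "\<And>x. x \<in> M \<Longrightarrow> C x \<in> M'" "\<And>x. x \<in> M' \<Longrightarrow> C' x \<in> M"
  shows "proj M' (C x) = C (proj M x)"
proof (rule proj_unique)
  interpret C: bounded_linear C using assms(5) adj_bl by blast
  show "C (proj M x) \<in> M'" using assms proj_in by blast
  fix y assume "y \<in> M'"
  then have "(x - proj M x) \<bullet> C' y = 0" using assms proj_orth by blast
  then show "(C x - C (proj M x)) \<bullet> y = 0"
    using adjD[OF assms(5)] by (metis C.diff)
qed (use assms in auto)

text \<open>The lower bound makes the range on \<open>W\<close> closed. A vector \<open>w\<close> of
  \<open>W\<close> orthogonal to that range satisfies
  \<open>S w \<bullet> S w = w \<bullet> S (S w) = 0\<close>, so the lower bound gives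
  \<open>w = 0\<close>.\<close>

lemma selfadj_surj:
  fixes S :: "'a::{real_inner,complete_space} \<Rightarrow> 'a"
  assumes S: "adj S S" and W: "subspace W" "closed W" "\<And>x. x \<in> W \<Longrightarrow> S x \<in> W"
    and c: "c > 0" "\<And>x. x \<in> W \<Longrightarrow> c * norm x \<le> norm (S x)"
    and x: "x \<in> W"
  shows "\<exists>y\<in>W. S y = x"
proof -
  interpret S: bounded_linear S using S adj_bl by blast
  have sub: "subspace (S ` W)" using W(1) by (simp add: S.linear linear_subspace_image)
  have "closed (S ` W)"
    unfolding closed_sequential_limits
  proof (intro allI impI, elim conjE)
    fix f l assume f: "\<forall>n. f n \<in> S ` W" and l: "f \<longlonglongrightarrow> l"
    from f have "\<forall>n. \<exists>z. z \<in> W \<and> f n = S z" by auto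
    then obtain g where g: "\<And>n. g n \<in> W" "\<And>n. f n = S (g n)" by metis
    have "Cauchy f" using l LIMSEQ_imp_Cauchy by blast
    have "Cauchy g"
    proof (rule CauchyI)
      fix e :: real assume "e > 0"
      then have "c * e > 0" using c by simp
      from CauchyD[OF \<open>Cauchy f\<close> this] obtain K where
        K: "\<And>m n. m \<ge> K \<Longrightarrow> n \<ge> K \<Longrightarrow> norm (f m - f n) < c * e" by blast
      have "norm (g m - g n) < e" if "m \<ge> K" "n \<ge> K" for m n
      proof -
        have "c * norm (g m - g n) \<le> norm (S (g m - g n))"
          using c(2) g(1) W(1) subspace_diff by blast
        also have "\<dots> < c * e" using K[OF that] by (simp add: g(2) S.diff)
        finally show ?thesis using c(1) by simp
      qed
      then show "\<exists>M. \<forall>m\<ge>M. \<forall>n\<ge>M. norm (g m - g n) < e" by blast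
    qed
    then obtain y where y: "g \<longlonglongrightarrow> y" using Cauchy_convergent convergentD by blast
    then have "y \<in> W" using closed_sequentially[OF W(2)] g(1) by blast
    moreover have "(\<lambda>n. S (g n)) \<longlonglongrightarrow> S y" by (rule S.tendsto[OF y])
    then have "l = S y" using l g(2) LIMSEQ_unique by (metis (no_types, lifting) ext)
    ultimately show "l \<in> S ` W" by blast
  qed
  note cl = this
  define w where "w = x - proj (S ` W) x"
  have pW: "proj (S ` W) x \<in> W" using proj_in[OF sub cl, of x] W(3) by auto
  then have wW: "w \<in> W" unfolding w_def using x W(1) subspace_diff by blast
  have "w \<bullet> S (S w) = 0" unfolding w_def by (rule proj_orth[OF sub cl]) (use W(3) wW w_def in auto)
  then have "S w \<bullet> S w = 0" using adjD[OF S] by metis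
  then have "norm (S w) = 0" by simp
  then have "c * norm w \<le> 0" using c(2)[OF wW] by simp
  then have "norm w \<le> 0" using c(1) mult_le_0_iff by (metis norm_ge_zero order_antisym_conv order_less_imp_not_less linorder_not_le)
  then have "x = proj (S ` W) x" unfolding w_def by simp
  then show ?thesis using proj_in[OF sub cl, of x] by auto
qed

lemma form_Cauchy_Schwarz:
  fixes Q :: "'a::real_inner \<Rightarrow> 'a"
  assumes Q: "adj Q Q" and Z: "subspace Z" and pos: "\<And>x. x \<in> Z \<Longrightarrow> 0 \<le> Q x \<bullet> x"
    and xy: "x \<in> Z" "y \<in> Z"
  shows "(Q x \<bullet> y)\<^sup>2 \<le> (Q x \<bullet> x) * (Q y \<bullet> y)"
proof -
  interpret Q: bounded_linear Q using Q adj_bl by blast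
  have sym: "Q y \<bullet> x = Q x \<bullet> y" using adjD[OF Q] by (metis inner_commute)
  have *: "0 \<le> Q x \<bullet> x + 2 * t * (Q x \<bullet> y) + t * t * (Q y \<bullet> y)" for t
  proof -
    have "0 \<le> Q (x + t *\<^sub>R y) \<bullet> (x + t *\<^sub>R y)" using pos xy Z by (simp add: subspace_add subspace_scale)
    also have "\<dots> = Q x \<bullet> x + 2 * t * (Q x \<bullet> y) + t * t * (Q y \<bullet> y)"
      by (simp add: Q.add Q.scale algebra_simps sym)
    finally show ?thesis .
  qed
  define a b c where "a = Q x \<bullet> x" and "b = Q x \<bullet> y" and "c = Q y \<bullet> y"
  have c0: "c \<ge> 0" "a \<ge> 0" using pos xy by (auto simp: a_def c_def)
  have q: "0 \<le> a + 2 * t * b + t * t * c" for t using * by (simp add: a_def b_def c_def)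
  show ?thesis
  proof (cases "c = 0")
    case True
    have "b = 0"
    proof (rule ccontr)
      assume "b \<noteq> 0"
      \<comment> \<open>With \<open>c = 0\<close> the quadratic is linear in \<open>t\<close>; at
        this \<open>t\<close> its value is -1.\<close>
      then show False using q[of "- (a + 1) / (2 * b)"] True by (simp add: field_simps)
    qed
    then show ?thesis using c0 by (simp flip: a_def b_def c_def)
  next
    case False
    then have "0 \<le> a - b\<^sup>2 / c" using q[of "- b / c"] by (simp add: field_simps power2_eq_square)
    then show ?thesis using False c0 by (simp add: field_simps flip: a_def b_def c_def)
  qed
qed

text \<open>Cauchy-Schwarz for the form of \<open>Q\<close>, applied to \<open>x\<close> and
  \<open>Q x\<close>, bounds the fourth power of \<open>norm (Q x)\<close> by \<open>c^2\<close>
  times the squares of the norms of \<open>x\<close> and \<open>Q x\<close>.\<close>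

lemma form_bound_norm:
  fixes Q :: "'a::real_inner \<Rightarrow> 'a"
  assumes Q: "adj Q Q" and Z: "subspace Z" "\<And>x. x \<in> Z \<Longrightarrow> Q x \<in> Z"
    and pos: "\<And>x. x \<in> Z \<Longrightarrow> 0 \<le> Q x \<bullet> x" and le: "\<And>x. x \<in> Z \<Longrightarrow> Q x \<bullet> x \<le> c * (norm x)\<^sup>2"
    and x: "x \<in> Z"
  shows "norm (Q x) \<le> c * norm x"
proof (cases "Q x = 0")
  case True
  show ?thesis
  proof (cases "x = 0")
    case False
    have "0 \<le> c * (norm x)\<^sup>2" using pos[OF x] le[OF x] by linarith
    then have "0 \<le> c" using False by (simp add: zero_le_mult_iff)
    then show ?thesis using True by simp
  qed (use True in simp)
next
  case False
  define n where "n = norm (Q x)"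
  have n: "n > 0" using False by (simp add: n_def)
  have x0: "norm x > 0"
    using False adj_bl(1)[OF Q] by (metis bounded_linear.linear linear_0 zero_less_norm_iff)
  have "(Q x \<bullet> Q x)\<^sup>2 \<le> (Q x \<bullet> x) * (Q (Q x) \<bullet> Q x)"
    by (rule form_Cauchy_Schwarz[OF Q Z(1) pos]) (use x Z in auto)
  also have "\<dots> \<le> (c * (norm x)\<^sup>2) * (c * n\<^sup>2)"
    using le[OF x] le[OF Z(2)[OF x]] pos[OF x] pos[OF Z(2)[OF x]] unfolding n_def
    by (intro mult_mono) auto
  finally have "n\<^sup>2 * n\<^sup>2 \<le> (c * norm x)\<^sup>2 * n\<^sup>2"
    by (simp add: n_def power2_norm_eq_inner[symmetric] power_mult_distrib power2_eq_square mult_ac)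
  then have "n\<^sup>2 \<le> (c * norm x)\<^sup>2"
    by (metis mult_le_cancel_right_pos n zero_less_power)
  moreover have "0 \<le> c * norm x"
  proof -
    have "0 \<le> c * (norm x)\<^sup>2" using pos[OF x] le[OF x] by linarith
    then show ?thesis using x0 by (simp add: zero_le_mult_iff)
  qed
  ultimately show ?thesis unfolding n_def by (rule power2_le_imp_le)
qed

section \<open>Splitting by growth of orbits\<close>

text \<open>For self-adjoint \<open>S\<close> and \<open>r > 0\<close> this is the spectral subspace
  of the modulus of \<open>S\<close> for the interval from 0 to \<open>r\<close>. Being defined by
  orbits alone, it is carried along by every bounded map that intertwines.\<close>

definition growth :: "('a::real_normed_vector \<Rightarrow> 'a) \<Rightarrow> real \<Rightarrow> 'a set" where
  "growth S r = {x. \<exists>K. \<forall>n. norm ((S ^^ n) x) \<le> K * r ^ n}"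

lemma bounded_linear_funpow:
  fixes S :: "'a::real_normed_vector \<Rightarrow> 'a"
  shows "bounded_linear S \<Longrightarrow> bounded_linear (S ^^ n)"
proof (induction n)
  case 0
  show ?case unfolding funpow.simps id_def by (rule bounded_linear_ident)
next
  case (Suc n)
  then show ?case using bounded_linear_compose[of S "S ^^ n"] by (simp add: o_def)
qed

lemma adj_funpow:
  fixes S :: "'a::real_inner \<Rightarrow> 'a"
  shows "adj S S \<Longrightarrow> adj (S ^^ n) (S ^^ n)"
proof (induction n)
  case 0
  then show ?case using adj_id by (simp add: id_def)
next
  case (Suc n)
  from adj_compose[OF Suc.prems Suc.IH[OF Suc.prems]] show ?case
    by (simp add: o_def funpow_swap1)
qed

lemma subspace_growth:
  assumes "bounded_linear S" "r > 0"
  shows "subspace (growth S r)"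
proof -
  interpret T: bounded_linear "S ^^ n" for n using assms(1) by (rule bounded_linear_funpow)
  show ?thesis
  proof (rule subspaceI)
    show "0 \<in> growth S r" by (auto simp: growth_def T.zero intro!: exI[of _ 0])
    fix x y assume "x \<in> growth S r" "y \<in> growth S r"
    then obtain K L where "\<And>n. norm ((S ^^ n) x) \<le> K * r ^ n" "\<And>n. norm ((S ^^ n) y) \<le> L * r ^ n"
      by (auto simp: growth_def)
    then have "norm ((S ^^ n) (x + y)) \<le> (K + L) * r ^ n" for n
      unfolding T.add distrib_right by (intro norm_triangle_mono)
    then show "x + y \<in> growth S r" unfolding growth_def by blast
  next
    fix c x assume "x \<in> growth S r"
    then obtain K where "\<And>n. norm ((S ^^ n) x) \<le> K * r ^ n" by (auto simp: growth_def)
    then have "norm ((S ^^ n) (c *\<^sub>R x)) \<le> (\<bar>c\<bar> * K) * r ^ n" for n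
      by (simp add: T.scale mult_left_mono mult.assoc)
    then show "c *\<^sub>R x \<in> growth S r" unfolding growth_def by blast
  qed
qed

lemma funpow_intertwine: "(\<And>x. S' (C x) = C (S x)) \<Longrightarrow> (S' ^^ n) (C x) = C ((S ^^ n) x)"
  by (induction n) auto

lemma growth_intertwine:
  assumes "bounded_linear C" "\<And>x. S' (C x) = C (S x)" "x \<in> growth S r"
  shows "C x \<in> growth S' r"
proof -
  obtain B where B: "B > 0" "\<And>x. norm (C x) \<le> norm x * B"
    using bounded_linear.pos_bounded[OF assms(1)] by auto
  obtain K where K: "\<And>n. norm ((S ^^ n) x) \<le> K * r ^ n" using assms(3) by (auto simp: growth_def)
  have "norm ((S' ^^ n) (C x)) \<le> (K * B) * r ^ n" for n
  proof -
    have "norm ((S' ^^ n) (C x)) = norm (C ((S ^^ n) x))"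
      by (simp add: funpow_intertwine[of S' C S, OF assms(2)])
    also have "\<dots> \<le> norm ((S ^^ n) x) * B" by (rule B)
    also have "\<dots> \<le> (K * r ^ n) * B" using K B by (intro mult_right_mono) auto
    finally show ?thesis by (simp add: mult_ac)
  qed
  then show ?thesis unfolding growth_def by blast
qed

text \<open>Self-adjointness makes the orbit norms log-convex, so a bounded growth rate is attained
  from the first step.\<close>

lemma growth_norm_le:
  fixes S :: "'a::real_inner \<Rightarrow> 'a"
  assumes S: "adj S S" and r: "r > 0" and x: "x \<in> growth S r"
  shows "norm (S x) \<le> r * norm x"
proof (rule ccontr)
  assume neg: "\<not> ?thesis"
  interpret S: bounded_linear S using S adj_bl by blast
  obtain K where K: "\<And>n. norm ((S ^^ n) x) \<le> K * r ^ n" using x by (auto simp: growth_def)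
  define a where "a n = norm ((S ^^ n) x)" for n
  have a0: "a 0 = norm x" "a (Suc 0) = norm (S x)" by (auto simp: a_def)
  have lc: "(a (Suc n))\<^sup>2 \<le> a n * a (Suc (Suc n))" for n
  proof -
    have "(a (Suc n))\<^sup>2 = S ((S ^^ n) x) \<bullet> S ((S ^^ n) x)" by (simp add: a_def power2_norm_eq_inner)
    also have "\<dots> = (S ^^ n) x \<bullet> S (S ((S ^^ n) x))" using adjD[OF S] by blast
    also have "\<dots> \<le> a n * a (Suc (Suc n))" unfolding a_def using norm_cauchy_schwarz by simp
    finally show ?thesis .
  qed
  have x0: "a 0 > 0" using neg by (auto simp: a0 S.zero)
  define q where "q = a (Suc 0) / a 0"
  have q: "q > r" using neg x0 by (simp add: q_def a0 field_simps)
  have step: "a n > 0 \<and> a (Suc n) \<ge> q * a n" for n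
  proof (induction n)
    case 0
    then show ?case using x0 by (simp add: q_def)
  next
    case (Suc n)
    have "q * a n > 0" using Suc q r by simp
    then have p: "a (Suc n) > 0" using Suc by linarith
    have "(q * a n) * a (Suc n) \<le> a (Suc n) * a (Suc n)" using Suc p by (intro mult_right_mono) auto
    also have "\<dots> \<le> a n * a (Suc (Suc n))" using lc[of n] by (simp add: power2_eq_square)
    finally have "a n * (q * a (Suc n)) \<le> a n * a (Suc (Suc n))" by (simp add: mult_ac)
    then show ?case using Suc p mult_le_cancel_left_pos by blast
  qed
  have pw: "q ^ n * a 0 \<le> a n" for n
  proof (induction n)
    case (Suc n)
    have "q ^ Suc n * a 0 = q * (q ^ n * a 0)" by simp
    also have "\<dots> \<le> q * a n" using Suc q r by (intro mult_left_mono) auto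
    also have "\<dots> \<le> a (Suc n)" using step by blast
    finally show ?case .
  qed simp
  have "q / r > 1" using q r by simp
  then obtain n where n: "(q / r) ^ n > K / a 0" using real_arch_pow by blast
  have "q ^ n * a 0 \<le> K * r ^ n" using pw[of n] K[of n] unfolding a_def by linarith
  then have "(q / r) ^ n \<le> K / a 0" using r x0 by (simp add: power_divide field_simps)
  then show False using n by simp
qed

lemma growth_funpow_le:
  fixes S :: "'a::real_inner \<Rightarrow> 'a"
  assumes S: "adj S S" and r: "r > 0" and x: "x \<in> growth S r"
  shows "norm ((S ^^ n) x) \<le> norm x * r ^ n"
proof (induction n)
  case (Suc n)
  have "(S ^^ n) x \<in> growth S r"
    by (rule growth_intertwine[OF bounded_linear_funpow[OF adj_bl(1)[OF S]] _ x])
      (simp add: funpow_swap1)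
  from growth_norm_le[OF S r this] have "norm ((S ^^ Suc n) x) \<le> r * norm ((S ^^ n) x)" by simp
  also have "\<dots> \<le> r * (norm x * r ^ n)" using Suc r by (intro mult_left_mono) auto
  finally show ?case by (simp add: mult_ac)
qed simp

text \<open>For a general operator the constant in \<open>growth\<close> may blow up along a
  convergent sequence. Here \<open>growth_funpow_le\<close> allows the constant
  \<open>norm x\<close>, and the set becomes an intersection of closed conditions.\<close>

lemma closed_growth:
  fixes S :: "'a::real_inner \<Rightarrow> 'a"
  assumes S: "adj S S" and r: "r > 0"
  shows "closed (growth S r)"
proof -
  interpret T: bounded_linear "S ^^ n" for n
    using adj_bl(1)[OF S] by (rule bounded_linear_funpow)
  have "growth S r = {x. \<forall>n. norm ((S ^^ n) x) \<le> norm x * r ^ n}"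
    using growth_funpow_le[OF S r] by (auto simp: growth_def)
  also have "closed \<dots>"
    by (intro closed_Collect_all closed_Collect_le continuous_intros T.continuous_on)
  finally show ?thesis .
qed

definition ortho :: "'a::real_inner set \<Rightarrow> 'a set" where
  "ortho M = {x. \<forall>y\<in>M. x \<bullet> y = 0}"

lemma subspace_ortho: "subspace (ortho M)"
  by (auto simp: ortho_def subspace_def inner_left_distrib)

lemma closed_ortho: "closed (ortho M)"
  unfolding ortho_def Ball_def by (intro closed_Collect_all closed_Collect_imp closed_Collect_eq continuous_intros) auto

lemma ortho_inter: "x \<in> M \<Longrightarrow> x \<in> ortho M \<Longrightarrow> x = 0"
  by (auto simp: ortho_def)

lemma ortho_intertwine:
  assumes "adj C C'" "\<And>x. x \<in> M' \<Longrightarrow> C' x \<in> M" "x \<in> ortho M"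
  shows "C x \<in> ortho M'"
  using assms by (auto simp: ortho_def adj_def)

text \<open>With \<open>Q n = (\<Sum>k\<le>n. S\<^bsup>2k\<^esup>)\<close> the vectors \<open>y n = (Q n)\<^bsup>-1\<^esup> x\<close> converge (their
  limit is the positive part of \<open>1 - S\<^sup>2\<close> applied to \<open>x\<close>) and the limit has a bounded orbit, so it
  vanishes when \<open>x\<close> is orthogonal to the vectors with bounded orbit.\<close>

lemma growth_perp_one:
  fixes S :: "'a::{real_inner,complete_space} \<Rightarrow> 'a"
  assumes S: "adj S S" and x: "x \<in> ortho (growth S 1)"
  shows "norm x \<le> norm (S x)"
proof -
  interpret S: bounded_linear S using S adj_bl by blast
  interpret T: bounded_linear "S ^^ n" for n
    using adj_bl(1)[OF S] by (rule bounded_linear_funpow)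
  have Tadj: "adj (S ^^ n) (S ^^ n)" for n by (rule adj_funpow[OF S])
  define W where "W = ortho (growth S 1)"
  define Q where "Q n x = (\<Sum>k\<le>n. (S ^^ k) ((S ^^ k) x))" for n and x :: 'a
  have Qinner: "Q n x \<bullet> y = (\<Sum>k\<le>n. (S ^^ k) x \<bullet> (S ^^ k) y)" for n x y
    unfolding Q_def inner_sum_left using adjD[OF Tadj] by simp
  have Qadj: "adj (Q n) (Q n)" for n
    unfolding adj_def
  proof (intro conjI allI)
    show "bounded_linear (Q n)" unfolding Q_def
      by (intro bounded_linear_sum bounded_linear_compose[OF T.bounded_linear] T.bounded_linear)
    then show "bounded_linear (Q n)" .
    show "Q n x \<bullet> y = x \<bullet> Q n y" for x y
      by (simp add: Qinner inner_commute[of x] inner_commute[of "(S ^^ _) y"])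
  qed
  have Qpos: "(norm ((S ^^ k) y))\<^sup>2 \<le> Q n y \<bullet> y" if "k \<le> n" for k n y
    unfolding Qinner power2_norm_eq_inner using that
    by (intro member_le_sum[of k "{..n}" "\<lambda>k. (S ^^ k) y \<bullet> (S ^^ k) y"]) auto
  have Qlow: "norm y \<le> norm (Q n y)" for n y
  proof -
    have "norm y * norm y \<le> norm (Q n y) * norm y"
      using Qpos[of 0 n y] norm_cauchy_schwarz[of "Q n y" y] by (simp add: power2_eq_square)
    then show ?thesis by (cases "y = 0") auto
  qed
  have Winv: "S y \<in> W" if "y \<in> W" for y
    unfolding W_def by (rule ortho_intertwine[OF S, of _ "growth S 1"])
      (use growth_intertwine[of S S S _ 1] S.bounded_linear that W_def in auto)
  have WT: "(S ^^ k) y \<in> W" if "y \<in> W" for k y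
    using that by (induction k) (auto intro: Winv)
  have QW: "Q n y \<in> W" if "y \<in> W" for n y
    unfolding Q_def using that WT subspace_ortho[of "growth S 1"] unfolding W_def[symmetric]
    by (intro subspace_sum) auto
  have "\<exists>y\<in>W. Q n y = x" for n
    by (rule selfadj_surj[OF Qadj, where W = W and c = 1])
      (use Qlow x QW in \<open>auto simp: W_def subspace_ortho closed_ortho\<close>)
  then obtain y where yW: "\<And>n. y n \<in> W" and Qy: "\<And>n. Q n (y n) = x" by metis
  have Qmono: "Q m z \<bullet> z \<le> Q n z \<bullet> z" if "m \<le> n" for m n z
    unfolding Qinner using that by (intro sum_mono2) auto
  \<comment> \<open>\<open>Q m\<close> dominates the identity, and its form at \<open>y n\<close> is
    at most that of \<open>Q n\<close>. The estimate makes \<open>x \<bullet> y n\<close> decreasing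
    and transfers its Cauchy property to \<open>y\<close>.\<close>
  have key: "(norm (y m - y n))\<^sup>2 \<le> x \<bullet> y m - x \<bullet> y n" if "m \<le> n" for m n
  proof -
    interpret Q: bounded_linear "Q m" using Qadj adj_bl by blast
    have "(norm (y m - y n))\<^sup>2 \<le> Q m (y m - y n) \<bullet> (y m - y n)"
      using Qpos[of 0 m "y m - y n"] by simp
    also have "\<dots> = x \<bullet> y m - x \<bullet> y n - Q m (y n) \<bullet> y m + Q m (y n) \<bullet> y n"
      by (simp add: Q.diff Qy algebra_simps inner_diff_left inner_diff_right)
    also have "Q m (y n) \<bullet> y m = x \<bullet> y n" using adjD[OF Qadj] Qy by (metis inner_commute)
    also have "Q m (y n) \<bullet> y n \<le> x \<bullet> y n" using Qmono[OF that, of "y n"] Qy by simp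
    finally show ?thesis by simp
  qed
  have dec: "decseq (\<lambda>n. x \<bullet> y n)"
    unfolding decseq_def using key by (meson diff_ge_0_iff_ge order_trans zero_le_power2)
  have "0 \<le> x \<bullet> y n" for n
    using order_trans[OF zero_le_power2 Qpos[of 0 n "y n"]] Qy by simp
  then have "convergent (\<lambda>n. x \<bullet> y n)" using dec by (metis decseq_convergent convergentI)
  then have C: "Cauchy (\<lambda>n. x \<bullet> y n)" by (rule convergent_Cauchy)
  have "Cauchy y"
  proof (rule CauchyI')
    fix e :: real assume "e > 0"
    then have "e\<^sup>2 > 0" by simp
    from CauchyD[OF C this] obtain K
      where K: "\<And>m n. m \<ge> K \<Longrightarrow> n \<ge> K \<Longrightarrow> norm (x \<bullet> y m - x \<bullet> y n) < e\<^sup>2" by blast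
    have "dist (y m) (y n) < e" if "m \<ge> K" "n > m" for m n
    proof -
      have "(norm (y m - y n))\<^sup>2 < e\<^sup>2" using key[of m n] K[of m n] that by auto
      then show ?thesis using \<open>e > 0\<close> by (simp add: dist_norm power2_less_imp_less)
    qed
    then show "\<exists>M. \<forall>m\<ge>M. \<forall>n>m. dist (y m) (y n) < e" by blast
  qed
  then obtain z where z: "y \<longlonglongrightarrow> z" using Cauchy_convergent convergentD by blast
  have "z \<in> W" using closed_sequentially[OF closed_ortho] yW z unfolding W_def by blast
  moreover have "z \<in> growth S 1"
  proof -
    have ynle: "norm (y n) \<le> norm x" for n using Qlow[of "y n" n] Qy by simp
    have le: "norm ((S ^^ k) (y n)) \<le> norm x" if "k \<le> n" for k n
    proof (rule power2_le_imp_le)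
      have "(norm ((S ^^ k) (y n)))\<^sup>2 \<le> x \<bullet> y n" using Qpos[OF that, of "y n"] Qy by simp
      also have "x \<bullet> y n \<le> norm x * norm (y n)" by (rule norm_cauchy_schwarz)
      also have "norm x * norm (y n) \<le> norm x * norm x" using ynle by (intro mult_left_mono) auto
      also have "norm x * norm x = (norm x)\<^sup>2" by (rule power2_eq_square[symmetric])
      finally show "(norm ((S ^^ k) (y n)))\<^sup>2 \<le> (norm x)\<^sup>2" .
    qed simp
    have "norm ((S ^^ k) z) \<le> norm x" for k
    proof (rule LIMSEQ_le_const2)
      show "(\<lambda>n. norm ((S ^^ k) (y n))) \<longlonglongrightarrow> norm ((S ^^ k) z)"
        by (intro tendsto_intros T.tendsto z)
      show "\<exists>N. \<forall>n\<ge>N. norm ((S ^^ k) (y n)) \<le> norm x" using le by blast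
    qed
    then have "norm ((S ^^ k) z) \<le> norm x * 1 ^ k" for k by simp
    then show ?thesis unfolding growth_def by blast
  qed
  ultimately have "z = 0" using ortho_inter W_def by blast
  \<comment> \<open>The geometric sum telescopes: \<open>Q n - S^2 Q n\<close> is the identity minus
    the power \<open>2 n + 2\<close> of \<open>S\<close>.\<close>
  have tel: "x - S (S x) = y n - S (S ((S ^^ n) ((S ^^ n) (y n))))" for n
  proof -
    have "Q n v - S (S (Q n v)) = v - S (S ((S ^^ n) ((S ^^ n) v)))" for v
    proof (induction n)
      case (Suc n)
      have q: "Q (Suc n) v = Q n v + S (S ((S ^^ n) ((S ^^ n) v)))"
        by (simp add: Q_def funpow_swap1)
      have p: "(S ^^ Suc n) ((S ^^ Suc n) v) = S (S ((S ^^ n) ((S ^^ n) v)))"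
        by (simp add: funpow_swap1)
      have "(a + b) - (c + d) = w - d" if "a - c = w - b" for a b c d w :: 'a
      proof -
        have "(a + b) - (c + d) = (a - c) + b - d" by simp
        then show ?thesis using that by simp
      qed
      from this[OF Suc] show ?case unfolding q p S.add .
    qed (simp add: Q_def)
    then show ?thesis using Qy by metis
  qed
  \<comment> \<open>Substituting \<open>x = Q n (y n)\<close> and distributing the powers of
    \<open>S\<close> evenly turns the expression into the form of \<open>Q n\<close> at the power
    \<open>n + 1\<close> of \<open>S\<close> applied to \<open>y n\<close>.\<close>
  have nn: "0 \<le> S (S ((S ^^ n) ((S ^^ n) (y n)))) \<bullet> x" for n
  proof -
    have sw: "(S ^^ k) (S ((S ^^ n) w)) = S ((S ^^ n) ((S ^^ k) w))" for k w
      by (simp add: funpow_swap1) (metis add.commute comp_apply funpow_add)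
    have "S (S ((S ^^ n) ((S ^^ n) (y n)))) \<bullet> x = S ((S ^^ n) (y n)) \<bullet> S ((S ^^ n) (Q n (y n)))"
      unfolding Qy using adjD[OF S] adjD[OF Tadj] by (metis funpow_swap1)
    also have "S ((S ^^ n) (Q n (y n))) = Q n (S ((S ^^ n) (y n)))"
      unfolding Q_def by (simp add: T.sum S.sum sw)
    also have "S ((S ^^ n) (y n)) \<bullet> Q n (S ((S ^^ n) (y n))) \<ge> 0"
      using order_trans[OF zero_le_power2 Qpos[of 0 n "S ((S ^^ n) (y n))"]] by (simp add: inner_commute)
    finally show ?thesis .
  qed
  \<comment> \<open>As \<open>y n\<close> tends to 0, \<open>tel\<close> identifies the limit, and
    by \<open>nn\<close> it is nonnegative.\<close>
  have "(\<lambda>n. (S (S ((S ^^ n) ((S ^^ n) (y n))))) \<bullet> x) \<longlonglongrightarrow> (S (S x) - x) \<bullet> x"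
  proof -
    have e: "S (S ((S ^^ n) ((S ^^ n) (y n)))) = y n + (S (S x) - x)" for n
      using tel[of n] by (simp add: algebra_simps)
    have "(\<lambda>n. (y n + (S (S x) - x)) \<bullet> x) \<longlonglongrightarrow> (z + (S (S x) - x)) \<bullet> x"
      by (intro tendsto_intros z)
    then show ?thesis unfolding e \<open>z = 0\<close> by simp
  qed
  then have "0 \<le> (S (S x) - x) \<bullet> x" using nn by (intro LIMSEQ_le_const) auto
  moreover have "S (S x) \<bullet> x = S x \<bullet> S x" using adjD[OF S] by blast
  ultimately have "x \<bullet> x \<le> S x \<bullet> S x" by (simp add: inner_diff_left)
  then show ?thesis by (simp add: norm_le)
qed

lemma growth_perp:
  fixes S :: "'a::{real_inner,complete_space} \<Rightarrow> 'a"
  assumes S: "adj S S" and r: "r > 0" and x: "x \<in> ortho (growth S r)"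
  shows "r * norm x \<le> norm (S x)"
proof -
  define U where "U x = (1 / r) *\<^sub>R S x" for x
  have U: "adj U U" unfolding U_def by (rule adj_scaleR[OF S])
  interpret S: bounded_linear S using S adj_bl by blast
  have "(U ^^ n) x = (1 / r ^ n) *\<^sub>R (S ^^ n) x" for n x
    by (induction n) (auto simp: U_def S.scale)
  then have "norm ((U ^^ n) x) \<le> K * 1 ^ n \<longleftrightarrow> norm ((S ^^ n) x) \<le> K * r ^ n" for n x K
    using r by (simp add: field_simps)
  then have "growth U 1 = growth S r" by (simp add: growth_def)
  then have "norm x \<le> norm (U x)" using growth_perp_one[OF U] x by simp
  then show ?thesis using r by (simp add: U_def field_simps)
qed

section \<open>Dyadic spectral projections of a positive operator\<close>

lemma growth_mono:
  assumes "0 < s" "s \<le> t"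
  shows "growth S s \<subseteq> growth S t"
proof
  fix x assume "x \<in> growth S s"
  then obtain K where K: "\<And>n. norm ((S ^^ n) x) \<le> K * s ^ n" by (auto simp: growth_def)
  have "0 \<le> K" using order_trans[OF norm_ge_zero K[of 0]] by simp
  have "norm ((S ^^ n) x) \<le> K * t ^ n" for n
  proof -
    have "K * s ^ n \<le> K * t ^ n" using \<open>0 \<le> K\<close> assms by (intro mult_left_mono power_mono) auto
    then show ?thesis using K[of n] by linarith
  qed
  then show "x \<in> growth S t" unfolding growth_def by blast
qed

lemma orthproj_zero: "orthproj (\<lambda>x. 0)"
  by (simp add: orthproj_def bounded_linear_zero)

text \<open>The value 0 for \<open>t \<le> 0\<close> excludes even the kernel of \<open>S\<close>,
  which thereby falls into the lowest dyadic interval.\<close>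

definition specproj :: "('a::real_inner \<Rightarrow> 'a) \<Rightarrow> real \<Rightarrow> 'a \<Rightarrow> 'a" where
  "specproj S t = (if t \<le> 0 then (\<lambda>x. 0) else proj (growth S t))"

text \<open>For positive \<open>S\<close> this is the spectral projection of the interval that is
  open at \<open>k / 2^n\<close> and closed at \<open>(k + 1) / 2^n\<close>; for
  \<open>k = 0\<close> the point 0 belongs to it as well.\<close>

definition dyproj :: "('a::real_inner \<Rightarrow> 'a) \<Rightarrow> nat \<Rightarrow> nat \<Rightarrow> 'a \<Rightarrow> 'a" where
  "dyproj S n k x = specproj S (real (Suc k) / 2 ^ n) x - specproj S (real k / 2 ^ n) x"

context
  fixes S :: "'a::{real_inner,complete_space} \<Rightarrow> 'a"
  assumes S: "adj S S"
begin

lemma subspace_closed_growth: "t > 0 \<Longrightarrow> subspace (growth S t)" "t > 0 \<Longrightarrow> closed (growth S t)"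
  using subspace_growth[of S] closed_growth[OF S] adj_bl(1)[OF S] by auto

lemma orthproj_specproj: "orthproj (specproj S t)"
  unfolding specproj_def using orthproj_proj[OF subspace_closed_growth] orthproj_zero by auto

lemma specproj_le: "s \<le> t \<Longrightarrow> specproj S t (specproj S s x) = specproj S s x"
proof (cases "s \<le> 0")
  case True
  then show ?thesis using linear_0[OF bounded_linear.linear] orthproj_specproj[of t]
    unfolding orthproj_def by (auto simp: specproj_def)
next
  case False
  assume "s \<le> t"
  then show ?thesis using False growth_mono[of s t S] proj_in[OF subspace_closed_growth, of s x]
    by (auto simp: specproj_def intro: proj_id[OF subspace_closed_growth])
qed

text \<open>The adjoint form of \<open>specproj_le\<close>.\<close>

lemma specproj_ge: "s \<le> t \<Longrightarrow> specproj S s (specproj S t x) = specproj S s x"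
proof -
  assume st: "s \<le> t"
  have "specproj S s (specproj S t x) \<bullet> y = specproj S s x \<bullet> y" for y
    using orthproj_specproj[of s] orthproj_specproj[of t] specproj_le[OF st] unfolding orthproj_def by metis
  then show ?thesis using vector_eq_rdot by blast
qed

lemma specproj_full:
  assumes "\<And>x. norm (S x) \<le> b * norm x" "b \<le> t" "0 < t"
  shows "specproj S t x = x"
proof -
  have "norm ((S ^^ n) x) \<le> norm x * t ^ n" for n
  proof (induction n)
    case (Suc n)
    have "norm ((S ^^ Suc n) x) \<le> b * norm ((S ^^ n) x)" using assms(1) by simp
    also have "\<dots> \<le> t * norm ((S ^^ n) x)" using assms by (intro mult_right_mono) auto
    also have "\<dots> \<le> t * (norm x * t ^ n)" using assms Suc by (intro mult_left_mono) auto
    finally show ?case by (simp add: mult_ac)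
  qed simp
  then have "x \<in> growth S t" unfolding growth_def by blast
  then show ?thesis using assms proj_id[OF subspace_closed_growth] by (simp add: specproj_def)
qed

lemma specproj_diff_zero:
  assumes "specproj S s x = 0" "s > 0"
  shows "x \<in> ortho (growth S s)"
  using assms proj_orth[OF subspace_closed_growth, of s _ x] by (auto simp: specproj_def ortho_def)

lemma orthproj_dyproj: "orthproj (dyproj S n k)"
proof -
  have st: "real k / 2 ^ n \<le> real (Suc k) / 2 ^ n" by (simp add: divide_right_mono)
  note F = orthproj_specproj[unfolded orthproj_def]
  show ?thesis unfolding orthproj_def
  proof (intro conjI allI)
    show "bounded_linear (dyproj S n k)" unfolding dyproj_def using F by (intro bounded_linear_sub) auto
    have d: "specproj S t (x - y) = specproj S t x - specproj S t y" for t x y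
      using F by (simp add: bounded_linear.linear linear_diff)
    show "dyproj S n k (dyproj S n k x) = dyproj S n k x" for x
      unfolding dyproj_def d using F specproj_le[OF st] specproj_ge[OF st] by simp
    show "dyproj S n k x \<bullet> y = x \<bullet> dyproj S n k y" for x y
      unfolding dyproj_def inner_diff_left inner_diff_right using F by simp
  qed
qed

lemma dyproj_sum: "(\<Sum>k<K. dyproj S n k x) = specproj S (real K / 2 ^ n) x"
  by (induction K) (auto simp: dyproj_def specproj_def)

text \<open>Both intervals are written on the finer grid. Each of the four products of spectral
  projections collapses to the one with the smaller endpoint, so only the position of
  \<open>k'\<close> relative to the block from \<open>k q\<close> to \<open>(k + 1) q\<close>
  matters.\<close>

lemma dyproj_nested:
  assumes "n \<le> n'"
  shows "dyproj S n k (dyproj S n' k' x) = (if k = k' div 2 ^ (n' - n) then dyproj S n' k' x else 0)"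
proof -
  define q where "q = (2::nat) ^ (n' - n)"
  have q: "real q * 2 ^ n = 2 ^ n'" "q > 0"
    using assms by (auto simp: q_def simp flip: power_add)
  have scale: "real j / 2 ^ n = real (j * q) / 2 ^ n'" for j
    using q by (simp add: field_simps flip: q(1))
  have le: "real i / 2 ^ n' \<le> real j / 2 ^ n'" if "i \<le> j" for i j
    using that by (simp add: divide_right_mono)
  have d: "specproj S t (x - y) = specproj S t x - specproj S t y" for t x y
    using orthproj_specproj[of t] by (simp add: orthproj_def bounded_linear.linear linear_diff)
  have e: "dyproj S n k y = specproj S (real (Suc k * q) / 2 ^ n') y - specproj S (real (k * q) / 2 ^ n') y" for y
    unfolding dyproj_def scale ..
  have kk: "k' div q * q \<le> k'" "k' < Suc (k' div q) * q"
    using dividend_less_div_times[OF q(2), of k'] by (simp_all add: mult.commute)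
  consider "k = k' div q" | "k < k' div q" | "k > k' div q" by linarith
  then show ?thesis
  proof cases
    case 1
    then have a: "k * q \<le> k'" "k' < Suc k * q" using kk by (simp_all del: mult_Suc)
    then have "k * q \<le> Suc k'" "k' \<le> Suc k * q" "Suc k' \<le> Suc k * q" by linarith+
    with a(1) show ?thesis using 1
      unfolding e unfolding dyproj_def d by (simp add: specproj_le[OF le] specproj_ge[OF le] q_def del: mult_Suc of_nat_Suc of_nat_mult)
  next
    case 2
    then have "Suc k * q \<le> k' div q * q" "k * q \<le> k' div q * q" by (auto intro: mult_right_mono simp del: mult_Suc)
    then have "k * q \<le> k'" "k * q \<le> Suc k'" "Suc k * q \<le> k'" "Suc k * q \<le> Suc k'"
      using kk by linarith+
    then show ?thesis using 2
      unfolding e unfolding dyproj_def d by (simp add: specproj_le[OF le] specproj_ge[OF le] q_def del: mult_Suc of_nat_Suc of_nat_mult)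
  next
    case 3
    then have "Suc (k' div q) * q \<le> Suc k * q" "Suc (k' div q) * q \<le> k * q"
      by (auto intro!: mult_right_mono simp del: mult_Suc)
    then have "k' \<le> k * q" "Suc k' \<le> k * q" "k' \<le> Suc k * q" "Suc k' \<le> Suc k * q"
      using kk by linarith+
    then show ?thesis using 3
      unfolding e unfolding dyproj_def d by (simp add: specproj_le[OF le] specproj_ge[OF le] q_def del: mult_Suc of_nat_Suc of_nat_mult)
  qed
qed

end

lemma specproj_intertwine:
  fixes S :: "'a::{real_inner,complete_space} \<Rightarrow> 'a" and S' :: "'b::{real_inner,complete_space} \<Rightarrow> 'b"
  assumes S: "adj S S" "adj S' S'" and C: "adj C C'" "\<And>x. S' (C x) = C (S x)"
  shows "specproj S' t (C x) = C (specproj S t x)"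
proof (cases "t \<le> 0")
  case True
  then show ?thesis using adj_bl(1)[OF C(1)] by (simp add: specproj_def bounded_linear.linear linear_0)
next
  case False
  then show ?thesis unfolding specproj_def
    using proj_intertwine[OF subspace_closed_growth[OF S(1)] subspace_closed_growth[OF S(2)] C(1), of t t]
      growth_intertwine[of C S' S, OF adj_bl(1)[OF C(1)] C(2)]
      growth_intertwine[of C' S S', OF adj_bl(2)[OF C(1)] adj_intertwine[OF S C]]
    by auto
qed

lemma dyproj_intertwine:
  fixes S :: "'a::{real_inner,complete_space} \<Rightarrow> 'a" and S' :: "'b::{real_inner,complete_space} \<Rightarrow> 'b"
  assumes S: "adj S S" "adj S' S'" and C: "adj C C'" "\<And>x. S' (C x) = C (S x)"
  shows "dyproj S' n k (C x) = C (dyproj S n k x)"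
  unfolding dyproj_def specproj_intertwine[OF S C]
  using adj_bl(1)[OF C(1)] by (simp add: bounded_linear.linear linear_diff)

text \<open>On \<open>Z\<close> the form of \<open>Q = S^2 - s^2\<close> lies between 0 and
  \<open>t^2 - s^2\<close>, which bounds the norm of \<open>Q\<close>. Now
  \<open>Q = (S + s) (S - s)\<close>, and \<open>S + s\<close> is bounded below by \<open>s\<close>
  since \<open>S\<close> is positive.\<close>

lemma pos_near_scalar:
  fixes S :: "'a::real_inner \<Rightarrow> 'a"
  assumes S: "adj S S" and pos: "\<And>x. 0 \<le> S x \<bullet> x"
    and Z: "subspace Z" "\<And>x. x \<in> Z \<Longrightarrow> S x \<in> Z" and s: "s > 0" "s \<le> t"
    and lo: "\<And>x. x \<in> Z \<Longrightarrow> s * norm x \<le> norm (S x)"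
    and hi: "\<And>x. x \<in> Z \<Longrightarrow> norm (S x) \<le> t * norm x"
    and x: "x \<in> Z"
  shows "norm (S x - s *\<^sub>R x) \<le> (t\<^sup>2 - s\<^sup>2) / s * norm x"
proof -
  interpret S: bounded_linear S using S adj_bl by blast
  define Q where "Q x = S (S x) - s\<^sup>2 *\<^sub>R x" for x
  have Qadj: "adj Q Q" unfolding Q_def by (rule adj_diff[OF adj_compose[OF S S] adj_scaleR[OF adj_id]])
  have Qf: "Q y \<bullet> y = (norm (S y))\<^sup>2 - s\<^sup>2 * (norm y)\<^sup>2" for y
    using adjD[OF S, of "S y" y] by (simp add: Q_def inner_diff_left power2_norm_eq_inner)
  have "norm (Q x) \<le> (t\<^sup>2 - s\<^sup>2) * norm x"
  proof (rule form_bound_norm[OF Qadj Z(1) _ _ _ x])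
    fix y assume y: "y \<in> Z"
    show "Q y \<in> Z" unfolding Q_def using y Z by (simp add: subspace_diff subspace_scale)
    have "(s * norm y)\<^sup>2 \<le> (norm (S y))\<^sup>2" using lo[OF y] s by (intro power_mono) auto
    then show "0 \<le> Q y \<bullet> y" by (simp add: Qf power_mult_distrib)
    have "(norm (S y))\<^sup>2 \<le> (t * norm y)\<^sup>2" using hi[OF y] by (intro power_mono) auto
    then show "Q y \<bullet> y \<le> (t\<^sup>2 - s\<^sup>2) * (norm y)\<^sup>2"
      by (simp add: Qf power_mult_distrib left_diff_distrib)
  qed
  moreover define y where "y = S x - s *\<^sub>R x"
  have "Q x = S y + s *\<^sub>R y"
    by (simp add: Q_def y_def S.diff S.scale algebra_simps power2_eq_square)
  moreover have "s * norm y \<le> norm (S y + s *\<^sub>R y)"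
  proof -
    have "s * (norm y * norm y) \<le> (S y + s *\<^sub>R y) \<bullet> y"
      using pos[of y] by (simp add: inner_add_left power2_norm_eq_inner flip: power2_eq_square)
    also have "\<dots> \<le> norm (S y + s *\<^sub>R y) * norm y" by (rule norm_cauchy_schwarz)
    finally show ?thesis by (cases "y = 0") auto
  qed
  ultimately have "s * norm y \<le> (t\<^sup>2 - s\<^sup>2) * norm x" by simp
  then show ?thesis using s by (simp add: y_def field_simps)
qed

text \<open>The constant 3 is the maximum of \<open>(2 k + 1) / k\<close> over
  \<open>k \<ge> 1\<close>, which is what \<open>(t^2 - s^2) / s\<close> amounts to in units of the
  mesh.\<close>

lemma dyproj_estimate:
  fixes S :: "'a::{real_inner,complete_space} \<Rightarrow> 'a"
  assumes S: "adj S S" and pos: "\<And>x. 0 \<le> S x \<bullet> x" and x: "dyproj S n k x = x"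
  shows "norm (S x - (real k / 2 ^ n) *\<^sub>R x) \<le> 3 / 2 ^ n * norm x"
proof -
  interpret S: bounded_linear S using S adj_bl by blast
  define s t where "s = real k / 2 ^ n" and "t = real (Suc k) / 2 ^ n"
  have st: "s \<le> t" "0 \<le> s" "0 < t" by (auto simp: s_def t_def divide_right_mono)
  define Z where "Z = {x. dyproj S n k x = x}"
  note P = orthproj_dyproj[OF S, of n k, unfolded orthproj_def]
  interpret P: bounded_linear "dyproj S n k" using P by blast
  have Z: "subspace Z" unfolding Z_def subspace_def by (auto simp: P.zero P.add P.scale)
  have ZS: "S y \<in> Z" if "y \<in> Z" for y
    using that dyproj_intertwine[OF S S S, of n k y] by (simp add: Z_def)
  have Ft: "specproj S t y = y" and Fs: "specproj S s y = 0" if "y \<in> Z" for y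
  proof -
    have d: "specproj S r (x - y) = specproj S r x - specproj S r y" for r x y
      using orthproj_specproj[OF S, of r] by (simp add: orthproj_def bounded_linear.linear linear_diff)
    have "y = specproj S t y - specproj S s y" using that by (simp add: Z_def dyproj_def s_def t_def)
    from arg_cong[OF this, of "specproj S t"] arg_cong[OF this, of "specproj S s"] this
    show "specproj S t y = y" "specproj S s y = 0"
      using st unfolding d
      by (simp_all add: specproj_le[OF S] specproj_ge[OF S])
  qed
  have hi: "norm (S y) \<le> t * norm y" if "y \<in> Z" for y
    using Ft[OF that] st growth_norm_le[OF S] proj_in[OF subspace_closed_growth[OF S], of t y]
    unfolding specproj_def by (metis not_less)
  show ?thesis
  proof (cases "k = 0")
    \<comment> \<open>The lowest interval has no positive lower endpoint to divide by, but there the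
      upper bound alone suffices.\<close>
    case True
    have "x \<in> Z" using x by (simp add: Z_def)
    from hi[OF this] show ?thesis using True by (simp add: t_def divide_right_mono mult_right_mono order_trans)
  next
    case False
    then have s0: "s > 0" by (simp add: s_def)
    have lo: "s * norm y \<le> norm (S y)" if "y \<in> Z" for y
      using growth_perp[OF S s0] specproj_diff_zero[OF S Fs[OF that] s0] by blast
    have "norm (S x - s *\<^sub>R x) \<le> (t\<^sup>2 - s\<^sup>2) / s * norm x"
      by (rule pos_near_scalar[OF S pos Z ZS s0 st(1) lo hi]) (use x in \<open>auto simp: Z_def\<close>)
    also have "(t\<^sup>2 - s\<^sup>2) / s * norm x \<le> 3 / 2 ^ n * norm x"
    proof (rule mult_right_mono)
      have "(t\<^sup>2 - s\<^sup>2) / s = (2 * real k + 1) / real k / 2 ^ n"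
        using False unfolding s_def t_def by (simp add: field_simps power2_eq_square)
      also have "(2 * real k + 1) / real k \<le> 3" using False by (simp add: field_simps)
      then have "(2 * real k + 1) / real k / 2 ^ n \<le> 3 / 2 ^ n" by (intro divide_right_mono) auto
      finally show "(t\<^sup>2 - s\<^sup>2) / s \<le> 3 / 2 ^ n" .
    qed simp
    finally show ?thesis by (simp add: s_def)
  qed
qed

section \<open>Spectral cells of a normal operator commuting with quaternion units\<close>

lemma orthproj_compose:
  assumes "orthproj P" "orthproj Q" "\<And>x. P (Q x) = Q (P x)"
  shows "orthproj (\<lambda>x. P (Q x))"
  using assms unfolding orthproj_def by (auto intro: bounded_linear_compose)

lemma bounded_linear_linear_rules:
  assumes "bounded_linear f"
  shows "f (x + y) = f x + f y" "f (x - y) = f x - f y" "f (r *\<^sub>R x) = r *\<^sub>R f x"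
    "f 0 = 0" "f (- x) = - f x" "f (sum g A) = (\<Sum>i\<in>A. f (g i))"
  using assms by (auto simp: bounded_linear.linear linear_add linear_diff linear_scale linear_0
      linear_neg linear_sum)

lemma dyproj_commute:
  fixes S S' :: "'a::{real_inner,complete_space} \<Rightarrow> 'a"
  assumes S: "adj S S" "adj S' S'" and comm: "\<And>x. S (S' x) = S' (S x)"
  shows "dyproj S n k (dyproj S' n' k' x) = dyproj S' n' k' (dyproj S n k x)"
  by (rule dyproj_intertwine[OF S(1) S(1) orthproj_adj[OF orthproj_dyproj[OF S(2)]]
        dyproj_intertwine[OF S(2) S(2) S(1) comm[symmetric], symmetric]])

text \<open>A model for a bounded normal right linear operator: \<open>I\<close> and
  \<open>J\<close> stand for right multiplication by two anticommuting imaginary units, which are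
  skew for the real inner product. No quaternion occurs, so the arguments stay in a real Hilbert
  space.\<close>

locale quat_normal =
  fixes L L' I J :: "'a::{real_inner,complete_space} \<Rightarrow> 'a"
  assumes adjL: "adj L L'" and LL': "L (L' x) = L' (L x)"
    and adjI: "adj I (\<lambda>x. - I x)" and adjJ: "adj J (\<lambda>x. - J x)"
    and II: "I (I x) = - x" and JJ: "J (J x) = - x" and IJ: "I (J x) = - J (I x)"
    and LI: "L (I x) = I (L x)" and LJ: "L (J x) = J (L x)"
begin

lemmas blL = adj_bl(1)[OF adjL] and blL' = adj_bl(2)[OF adjL] and blI = adj_bl(1)[OF adjI]
  and blJ = adj_bl(1)[OF adjJ]
lemmas L_simps = bounded_linear_linear_rules[OF blL] and L'_simps = bounded_linear_linear_rules[OF blL']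
  and I_simps = bounded_linear_linear_rules[OF blI] and J_simps = bounded_linear_linear_rules[OF blJ]

lemma norm_I: "norm (I x) = norm x"
  using adjD[OF adjI, of x "I x"] II by (simp add: norm_eq_sqrt_inner)

lemma inner_I: "I x \<bullet> x = 0"
  using adjD[OF adjI, of x x] by (simp add: inner_commute)

lemma L'_comm: 
  assumes "adj C C'" "C' = (\<lambda>x. - C x)" "\<And>x. L (C x) = C (L x)"
  shows "L' (C x) = C (L' x)"
proof -
  have "adj (\<lambda>x. L (C x)) (\<lambda>x. - C (L' x))"
    using adj_compose[OF adjL assms(1)] assms(2) by simp
  moreover have "adj (\<lambda>x. C (L x)) (\<lambda>x. L' (- C x))"
    using adj_compose[OF assms(1) adjL] assms(2) by simp
  ultimately have "(\<lambda>x. - C (L' x)) = (\<lambda>x. L' (- C x))"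
    using adj_unique assms(3) by (metis (no_types, lifting) ext)
  then show ?thesis by (metis L'_simps(5) neg_equal_iff_equal)
qed

lemma L'I: "L' (I x) = I (L' x)" by (rule L'_comm[OF adjI refl LI])

lemma L'J: "L' (J x) = J (L' x)" by (rule L'_comm[OF adjJ refl LJ])

text \<open>A common bound for the real and the imaginary part. Adding \<open>c\<close> makes them
  positive with norm at most \<open>2 c\<close>; without the shift, growth could not tell a spectral
  value from its negative.\<close>

definition c where "c = onorm L + onorm L'"

lemma c_ge: "0 \<le> c" "norm (L x) + norm (L' x) \<le> 2 * c * norm x"
proof -
  have "0 \<le> onorm L" "0 \<le> onorm L'" by (rule onorm_pos_le[OF blL] onorm_pos_le[OF blL'])+
  moreover have "norm (L x) \<le> onorm L * norm x" "norm (L' x) \<le> onorm L' * norm x"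
    by (rule onorm[OF blL] onorm[OF blL'])+
  moreover have "0 \<le> onorm L * norm x" "0 \<le> onorm L' * norm x" using calculation by simp_all
  moreover have "2 * c * norm x = 2 * (onorm L * norm x) + 2 * (onorm L' * norm x)"
    by (simp add: c_def algebra_simps)
  ultimately show "0 \<le> c" "norm (L x) + norm (L' x) \<le> 2 * c * norm x"
    unfolding c_def by linarith+
qed

text \<open>\<open>J\<close> anticommutes with \<open>im\<close>, hence it exchanges \<open>S2\<close> and \<open>S3\<close>; both are used so that the
  family of cells below is stable under \<open>J\<close>.\<close>

definition im where "im x = (- 1 / 2) *\<^sub>R I (L x - L' x)"
definition S1 where "S1 x = c *\<^sub>R x + (1 / 2) *\<^sub>R (L x + L' x)"
definition S2 where "S2 x = c *\<^sub>R x + im x"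
definition S3 where "S3 x = c *\<^sub>R x - im x"

lemma adj_im: "adj im im"
proof -
  have "adj (\<lambda>x. I (L x - L' x)) (\<lambda>x. L' (- I x) - L (- I x))"
    using adj_compose[OF adjI adj_diff[OF adjL adj_sym[OF adjL]]] .
  also have "(\<lambda>x. L' (- I x) - L (- I x)) = (\<lambda>x. I (L x - L' x))"
    by (simp add: L_simps L'_simps I_simps LI L'I)
  finally show ?thesis unfolding im_def by (rule adj_scaleR)
qed

lemma adj_S: "adj S1 S1" "adj S2 S2" "adj S3 S3"
proof -
  have "(\<lambda>x. L x + L' x) = (\<lambda>x. L' x + L x)" by (simp add: add.commute)
  moreover have "adj (\<lambda>x. L x + L' x) (\<lambda>x. L x + L' x)" by (rule adj_add[OF adjL adj_sym[OF adjL]])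
  ultimately have "adj (\<lambda>x. (1 / 2) *\<^sub>R (L x + L' x)) (\<lambda>x. (1 / 2) *\<^sub>R (L x + L' x))"
    by (intro adj_scaleR) simp
  from adj_add[OF adj_scaleR[OF adj_id, of c] this]
  show "adj S1 S1" unfolding S1_def by (simp add: add.commute)
  from adj_add[OF adj_scaleR[OF adj_id, of c] adj_im]
  show "adj S2 S2" unfolding S2_def by (simp add: add.commute)
  from adj_diff[OF adj_scaleR[OF adj_id, of c] adj_im]
  show "adj S3 S3" unfolding S3_def .
qed

lemma norm_im: "norm (im x) \<le> c * norm x"
proof -
  have "norm (im x) = norm (L x - L' x) / 2" by (simp add: im_def norm_I)
  also have "\<dots> \<le> (norm (L x) + norm (L' x)) / 2" using norm_triangle_ineq4 by (intro divide_right_mono) auto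
  finally show ?thesis using c_ge(2)[of x] by simp
qed

lemma norm_re: "norm ((1 / 2) *\<^sub>R (L x + L' x)) \<le> c * norm x"
  using c_ge(2)[of x] norm_triangle_ineq[of "L x" "L' x"] by simp

lemma pos_aux: "norm y \<le> c * norm x \<Longrightarrow> 0 \<le> (c *\<^sub>R x + y) \<bullet> x"
proof -
  assume "norm y \<le> c * norm x"
  then have "norm y * norm x \<le> c * norm x * norm x" by (intro mult_right_mono) auto
  moreover have "\<bar>y \<bullet> x\<bar> \<le> norm y * norm x" by (rule Cauchy_Schwarz_ineq2)
  ultimately have "- (y \<bullet> x) \<le> c * (x \<bullet> x)"
    by (simp add: power2_norm_eq_inner[symmetric] power2_eq_square mult.assoc)
  then show ?thesis by (simp add: inner_add_left)
qed

lemma pos_S: "0 \<le> S1 x \<bullet> x" "0 \<le> S2 x \<bullet> x" "0 \<le> S3 x \<bullet> x"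
  unfolding S1_def S2_def S3_def using pos_aux[OF norm_re] pos_aux[OF norm_im, of x]
    pos_aux[of "- im x" x] norm_im[of x] by auto

lemma norm_S: "norm (S1 x) \<le> 2 * c * norm x" "norm (S2 x) \<le> 2 * c * norm x" "norm (S3 x) \<le> 2 * c * norm x"
proof -
  have *: "norm (c *\<^sub>R x + y) \<le> 2 * c * norm x" if "norm y \<le> c * norm x" for y
    using norm_triangle_ineq[of "c *\<^sub>R x" y] that c_ge(1) by simp
  show "norm (S1 x) \<le> 2 * c * norm x" "norm (S2 x) \<le> 2 * c * norm x" "norm (S3 x) \<le> 2 * c * norm x"
    unfolding S1_def S2_def S3_def using *[OF norm_re] *[OF norm_im] *[of "- im x"] norm_im[of x] by auto
qed

lemma L_split: "L x = (S1 x - c *\<^sub>R x) + I (S2 x - c *\<^sub>R x)"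
proof -
  have "I (im x) = (1 / 2) *\<^sub>R (L x - L' x)" by (simp add: im_def I_simps II algebra_simps)
  moreover have "S1 x - c *\<^sub>R x = (1 / 2) *\<^sub>R (L x + L' x)" "S2 x - c *\<^sub>R x = im x"
    by (simp_all add: S1_def S2_def)
  ultimately show ?thesis by (simp add: scaleR_2[symmetric] flip: scaleR_add_right)
qed

text \<open>\<open>J\<close> is deliberately absent: it permutes the cells instead of commuting with
  them, while everything listed here commutes with each cell.\<close>

definition commutes where
  "commutes C \<longleftrightarrow> (\<exists>C'. adj C C') \<and> (\<forall>x. L (C x) = C (L x)) \<and> (\<forall>x. L' (C x) = C (L' x)) \<and> (\<forall>x. I (C x) = C (I x))"

lemma commutes_S:
  assumes "commutes C"
  shows "S1 (C x) = C (S1 x)" "S2 (C x) = C (S2 x)" "S3 (C x) = C (S3 x)"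
proof -
  obtain C' where C': "adj C C'" using assms by (auto simp: commutes_def)
  note C_simps = bounded_linear_linear_rules[OF adj_bl(1)[OF C']]
  have C: "L (C x) = C (L x)" "L' (C x) = C (L' x)" "I (C x) = C (I x)" for x
    using assms by (auto simp: commutes_def)
  show "S1 (C x) = C (S1 x)" "S2 (C x) = C (S2 x)" "S3 (C x) = C (S3 x)"
    by (simp_all add: S1_def S2_def S3_def im_def C C_simps I_simps)
qed

lemma im_L: "im (L x) = L (im x)" "im (L' x) = L' (im x)" "im (I x) = I (im x)"
  by (simp_all add: im_def L_simps L'_simps I_simps LI L'I LL')

lemma S_LI: "S1 (L x) = L (S1 x)" "S2 (L x) = L (S2 x)" "S3 (L x) = L (S3 x)"
  "S1 (L' x) = L' (S1 x)" "S2 (L' x) = L' (S2 x)" "S3 (L' x) = L' (S3 x)"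
  "S1 (I x) = I (S1 x)" "S2 (I x) = I (S2 x)" "S3 (I x) = I (S3 x)"
  by (simp_all add: S1_def S2_def S3_def im_L L_simps L'_simps I_simps LI L'I LL' add.commute)

lemma commutes_S123: "commutes S1" "commutes S2" "commutes S3"
  unfolding commutes_def S_LI using adj_S by blast+

lemma S_comm: "S1 (S2 x) = S2 (S1 x)" "S1 (S3 x) = S3 (S1 x)" "S2 (S3 x) = S3 (S2 x)"
  using commutes_S(1)[OF commutes_S123(2)] commutes_S(1)[OF commutes_S123(3)]
    commutes_S(2)[OF commutes_S123(3)] by simp_all

lemma S_J: "S1 (J x) = J (S1 x)" "S2 (J x) = J (S3 x)" "S3 (J x) = J (S2 x)"
proof -
  have "im (J x) = - J (im x)" by (simp add: im_def LJ L'J J_simps I_simps IJ algebra_simps)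
  then show "S1 (J x) = J (S1 x)" "S2 (J x) = J (S3 x)" "S3 (J x) = J (S2 x)"
    by (simp_all add: S1_def S2_def S3_def J_simps LJ L'J)
qed

text \<open>The third index costs only a bounded factor in the number of nonzero cells: as
  \<open>S2 + S3 = 2 c\<close>, it is determined by the second one up to a few steps of the
  grid.\<close>

definition cell :: "nat \<Rightarrow> nat \<times> nat \<times> nat \<Rightarrow> 'a \<Rightarrow> 'a" where
  "cell n q x = dyproj S1 n (fst q) (dyproj S2 n (fst (snd q)) (dyproj S3 n (snd (snd q)) x))"

lemma dyproj_comm:
  "dyproj S1 n k (dyproj S2 n' k' x) = dyproj S2 n' k' (dyproj S1 n k x)"
  "dyproj S1 n k (dyproj S3 n' k' x) = dyproj S3 n' k' (dyproj S1 n k x)"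
  "dyproj S2 n k (dyproj S3 n' k' x) = dyproj S3 n' k' (dyproj S2 n k x)"
  using dyproj_commute[OF adj_S(1) adj_S(2) S_comm(1)] dyproj_commute[OF adj_S(1) adj_S(3) S_comm(2)]
    dyproj_commute[OF adj_S(2) adj_S(3) S_comm(3)] by simp_all

lemma orthproj_cell: "orthproj (cell n q)"
proof -
  let ?P1 = "dyproj S1 n (fst q)" and ?P2 = "dyproj S2 n (fst (snd q))" and ?P3 = "dyproj S3 n (snd (snd q))"
  have "orthproj (\<lambda>x. ?P2 (?P3 x))"
    by (rule orthproj_compose[OF orthproj_dyproj[OF adj_S(2)] orthproj_dyproj[OF adj_S(3)]]) (rule dyproj_comm(3))
  then have "orthproj (\<lambda>x. ?P1 (?P2 (?P3 x)))"
    by (rule orthproj_compose[OF orthproj_dyproj[OF adj_S(1)]]) (simp only: dyproj_comm)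
  then show ?thesis by (simp only: cell_def[abs_def])
qed

lemmas cell_simps = bounded_linear_linear_rules[OF adj_bl(1)[OF orthproj_adj[OF orthproj_cell]]]

lemma cell_commutes:
  assumes C: "commutes C"
  shows "cell n q (C x) = C (cell n q x)"
proof -
  obtain C' where C': "adj C C'" using C by (auto simp: commutes_def)
  have "dyproj S1 n k (C x) = C (dyproj S1 n k x)" for k x
    by (rule dyproj_intertwine[OF adj_S(1) adj_S(1) C']) (rule commutes_S(1)[OF C])
  moreover have "dyproj S2 n k (C x) = C (dyproj S2 n k x)" for k x
    by (rule dyproj_intertwine[OF adj_S(2) adj_S(2) C']) (rule commutes_S(2)[OF C])
  moreover have "dyproj S3 n k (C x) = C (dyproj S3 n k x)" for k x
    by (rule dyproj_intertwine[OF adj_S(3) adj_S(3) C']) (rule commutes_S(3)[OF C])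
  ultimately show ?thesis by (simp only: cell_def)
qed

lemma commutes_I: "commutes I"
  using adjI LI L'I by (auto simp: commutes_def)

lemma commutes_L: "commutes L"
  using adjL LL' LI by (auto simp: commutes_def)

lemma commutes_L': "commutes L'"
  using adj_sym[OF adjL] LL' L'I by (auto simp: commutes_def)

lemma cell_J: "cell n (k1, k2, k3) (J x) = J (cell n (k1, k3, k2) x)"
proof -
  have "dyproj S1 n k (J x) = J (dyproj S1 n k x)" for k x
    by (rule dyproj_intertwine[OF adj_S(1) adj_S(1) adjJ]) (rule S_J(1))
  moreover have "dyproj S2 n k (J x) = J (dyproj S3 n k x)" for k x
    by (rule dyproj_intertwine[OF adj_S(3) adj_S(2) adjJ]) (rule S_J(2))
  moreover have "dyproj S3 n k (J x) = J (dyproj S2 n k x)" for k x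
    by (rule dyproj_intertwine[OF adj_S(2) adj_S(3) adjJ]) (rule S_J(3))
  ultimately show ?thesis by (simp only: cell_def fst_conv snd_conv dyproj_comm(3))
qed

lemma commutes_cell: "commutes (cell n q)"
  unfolding commutes_def
proof (intro conjI allI)
  show "\<exists>C'. adj (cell n q) C'"
    by (rule exI[of _ "cell n q"]) (rule orthproj_adj[OF orthproj_cell])
qed (simp_all only: cell_commutes[OF commutes_I] cell_commutes[OF commutes_L] cell_commutes[OF commutes_L'])

lemma cell_cell_comm: "cell n q (cell n' q' x) = cell n' q' (cell n q x)"
  by (rule cell_commutes[where C = "cell n' q'", OF commutes_cell])

lemma cell_nested:
  assumes "n \<le> n'"
  shows "(\<forall>x. cell n q (cell n' q' x) = cell n' q' x) \<or> (\<forall>x. cell n q (cell n' q' x) = 0)"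
proof -
  obtain k1 k2 k3 l1 l2 l3 where q: "q = (k1, k2, k3)" "q' = (l1, l2, l3)" by (metis prod_cases3)
  note Z = bounded_linear_linear_rules(4)[OF adj_bl(1)[OF orthproj_adj[OF orthproj_dyproj[OF adj_S(1)]]]]
    bounded_linear_linear_rules(4)[OF adj_bl(1)[OF orthproj_adj[OF orthproj_dyproj[OF adj_S(2)]]]]
    bounded_linear_linear_rules(4)[OF adj_bl(1)[OF orthproj_adj[OF orthproj_dyproj[OF adj_S(3)]]]]
  have "cell n q (cell n' q' x) = dyproj S1 n k1 (dyproj S1 n' l1 (dyproj S2 n k2 (dyproj S2 n' l2 (dyproj S3 n k3 (dyproj S3 n' l3 x)))))" for x
    by (simp add: cell_def q dyproj_comm)
  then show ?thesis
    by (simp add: dyproj_nested[OF adj_S(1) assms] dyproj_nested[OF adj_S(2) assms] dyproj_nested[OF adj_S(3) assms] Z)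
      (simp add: cell_def q)
qed

text \<open>The three operators are bounded by \<open>2 c\<close>, and the first \<open>K\<close>
  intervals of mesh \<open>2^-n\<close> reach beyond that.\<close>

lemma cell_sum:
  assumes "2 * c * 2 ^ n \<le> real K" "0 < K"
  shows "(\<Sum>q\<in>{..<K} \<times> {..<K} \<times> {..<K}. cell n q x) = x"
proof -
  have t: "2 * c \<le> real K / 2 ^ n" "0 < real K / 2 ^ n" using assms by (auto simp: field_simps)
  note b = adj_bl(1)[OF orthproj_adj[OF orthproj_dyproj]]
  have "(\<Sum>q\<in>{..<K} \<times> {..<K} \<times> {..<K}. cell n q x)
    = (\<Sum>k1<K. \<Sum>k2<K. \<Sum>k3<K. dyproj S1 n k1 (dyproj S2 n k2 (dyproj S3 n k3 x)))"
    by (simp add: sum.cartesian_product' cell_def)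
  also have "\<dots> = (\<Sum>k1<K. dyproj S1 n k1 (\<Sum>k2<K. dyproj S2 n k2 (\<Sum>k3<K. dyproj S3 n k3 x)))"
    by (simp add: bounded_linear_linear_rules(6)[OF b[OF adj_S(1)]] bounded_linear_linear_rules(6)[OF b[OF adj_S(2)]])
  also have "\<dots> = x"
    by (simp add: dyproj_sum adj_S specproj_full[OF adj_S(1) norm_S(1) t] specproj_full[OF adj_S(2) norm_S(2) t]
        specproj_full[OF adj_S(3) norm_S(3) t])
  finally show ?thesis .
qed

lemma cell_fix:
  assumes "cell n (k1, k2, k3) x = x"
  shows "dyproj S1 n k1 x = x" "dyproj S2 n k2 x = x" "dyproj S3 n k3 x = x"
proof -
  note i = orthproj_idem[OF orthproj_dyproj]
  have "dyproj S1 n k1 (cell n (k1, k2, k3) x) = cell n (k1, k2, k3) x"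
    "dyproj S2 n k2 (cell n (k1, k2, k3) x) = cell n (k1, k2, k3) x"
    "dyproj S3 n k3 (cell n (k1, k2, k3) x) = cell n (k1, k2, k3) x"
    unfolding cell_def fst_conv snd_conv
    by (simp_all only: i[OF adj_S(1)])
      (simp_all only: dyproj_comm(1)[symmetric] dyproj_comm(2,3)[symmetric] i[OF adj_S(2)] i[OF adj_S(3)])
  then show "dyproj S1 n k1 x = x" "dyproj S2 n k2 x = x" "dyproj S3 n k3 x = x" using assms by auto
qed

section \<open>Approximate eigenvectors in cells\<close>

definition scal :: "real \<Rightarrow> real \<Rightarrow> 'a \<Rightarrow> 'a" where
  "scal a b x = a *\<^sub>R x + b *\<^sub>R I x"

text \<open>Both constants are 3 + 3, one \<open>dyproj_estimate\<close> for each operator involved: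
  \<open>L\<close> is assembled from \<open>S1\<close> and \<open>S2\<close>, and
  \<open>S2 + S3\<close> is the scalar \<open>2 c\<close>.\<close>

lemma cell_estimate:
  assumes "cell n (k1, k2, k3) x = x"
  shows "norm (L x - scal (real k1 / 2 ^ n - c) (real k2 / 2 ^ n - c) x) \<le> 6 / 2 ^ n * norm x"
    and "x \<noteq> 0 \<Longrightarrow> \<bar>2 * c - (real k2 + real k3) / 2 ^ n\<bar> \<le> 6 / 2 ^ n"
proof -
  let ?a = "real k1 / 2 ^ n" and ?b = "real k2 / 2 ^ n" and ?d = "real k3 / 2 ^ n"
  note e = dyproj_estimate[OF adj_S(1) pos_S(1) cell_fix(1)[OF assms]]
    dyproj_estimate[OF adj_S(2) pos_S(2) cell_fix(2)[OF assms]]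
    dyproj_estimate[OF adj_S(3) pos_S(3) cell_fix(3)[OF assms]]
  have "L x - scal (?a - c) (?b - c) x = (S1 x - ?a *\<^sub>R x) + I (S2 x - ?b *\<^sub>R x)"
    by (subst L_split) (simp add: scal_def I_simps algebra_simps)
  then have "norm (L x - scal (?a - c) (?b - c) x) \<le> norm (S1 x - ?a *\<^sub>R x) + norm (S2 x - ?b *\<^sub>R x)"
    using norm_triangle_ineq[of "S1 x - ?a *\<^sub>R x" "I (S2 x - ?b *\<^sub>R x)"] by (simp add: norm_I)
  then show "norm (L x - scal (?a - c) (?b - c) x) \<le> 6 / 2 ^ n * norm x" using e by simp
  assume "x \<noteq> 0"
  have "(2 * c - (real k2 + real k3) / 2 ^ n) *\<^sub>R x = (S2 x - ?b *\<^sub>R x) + (S3 x - ?d *\<^sub>R x)"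
    by (simp add: S2_def S3_def algebra_simps add_divide_distrib flip: scaleR_2)
  then have "norm ((2 * c - (real k2 + real k3) / 2 ^ n) *\<^sub>R x) \<le> norm (S2 x - ?b *\<^sub>R x) + norm (S3 x - ?d *\<^sub>R x)"
    using norm_triangle_ineq[of "S2 x - ?b *\<^sub>R x" "S3 x - ?d *\<^sub>R x"] by presburger
  also have "\<dots> \<le> 6 / 2 ^ n * norm x" using e by simp
  finally have "\<bar>2 * c - (real k2 + real k3) / 2 ^ n\<bar> * norm x \<le> 6 / 2 ^ n * norm x"
    by (simp only: norm_scaleR)
  then show "\<bar>2 * c - (real k2 + real k3) / 2 ^ n\<bar> \<le> 6 / 2 ^ n"
    by (rule mult_right_le_imp_le) (use \<open>x \<noteq> 0\<close> in simp)
qed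

end

lemma subspace_closure:
  fixes A :: "'a::real_normed_vector set"
  assumes "subspace A"
  shows "subspace (closure A)"
proof (rule subspaceI)
  show "0 \<in> closure A" using closure_subset subspace_0[OF assms] by blast
next
  fix x y assume "x \<in> closure A" "y \<in> closure A"
  then obtain f g where "\<And>n. f n \<in> A" "f \<longlonglongrightarrow> x" "\<And>n. g n \<in> A" "g \<longlonglongrightarrow> y"
    unfolding closure_sequential by metis
  then have "\<And>n. f n + g n \<in> A" "(\<lambda>n. f n + g n) \<longlonglongrightarrow> x + y"
    using subspace_add[OF assms] tendsto_add by blast+
  then show "x + y \<in> closure A" unfolding closure_sequential by (intro exI[of _ "\<lambda>n. f n + g n"]) blast
next
  fix c x assume "x \<in> closure A"
  then obtain f where "\<And>n. f n \<in> A" "f \<longlonglongrightarrow> x" unfolding closure_sequential by metis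
  then have "\<And>n. c *\<^sub>R f n \<in> A" "(\<lambda>n. c *\<^sub>R f n) \<longlonglongrightarrow> c *\<^sub>R x"
    using subspace_scale[OF assms] tendsto_scaleR[OF tendsto_const] by blast+
  then show "c *\<^sub>R x \<in> closure A" unfolding closure_sequential by (intro exI[of _ "\<lambda>n. c *\<^sub>R f n"]) blast
qed

context quat_normal
begin

lemma scal_rules: "scal a b (x + y) = scal a b x + scal a b y" "scal a b (r *\<^sub>R x) = r *\<^sub>R scal a b x"
  "scal a b x - scal a' b' x = scal (a - a') (b - b') x"
  by (simp_all add: scal_def I_simps algebra_simps)

lemma norm_scal: "norm (scal a b x) = sqrt (a\<^sup>2 + b\<^sup>2) * norm x"
proof -
  have "(norm (scal a b x))\<^sup>2 = (a\<^sup>2 + b\<^sup>2) * (norm x)\<^sup>2"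
    using inner_I[of x] norm_I[of x] unfolding scal_def power2_norm_eq_inner
    by (simp add: inner_add_left inner_add_right norm_eq_sqrt_inner inner_commute[of x "I x"] algebra_simps power2_eq_square)
  then have "norm (scal a b x) = sqrt ((a\<^sup>2 + b\<^sup>2) * (norm x)\<^sup>2)"
    by (metis norm_ge_zero real_sqrt_abs abs_of_nonneg)
  then show ?thesis by (simp add: real_sqrt_mult)
qed

text \<open>\<open>scal a b\<close> commutes with \<open>L\<close>, so the quadratic factors into
  \<open>L - scal a (- b)\<close> after \<open>L - scal a b\<close>. The quadratic is the operator
  that defines the spherical spectrum, while the last factor is the one controlled by cells.\<close>

lemma quadratic_bound:
  "norm (L (L x) - (2 * a) *\<^sub>R L x + (a\<^sup>2 + b\<^sup>2) *\<^sub>R x)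
    \<le> (onorm L + sqrt (a\<^sup>2 + b\<^sup>2)) * norm (L x - scal a b x)"
proof -
  let ?y = "L x - scal a b x"
  have e: "L ?y = L (L x) - scal a b (L x)" by (simp add: scal_def L_simps LI)
  have "L (L x) - (2 * a) *\<^sub>R L x + (a\<^sup>2 + b\<^sup>2) *\<^sub>R x = L ?y - scal a (- b) ?y"
    unfolding e by (simp add: scal_def I_simps II algebra_simps power2_eq_square flip: scaleR_2)
  then have "norm (L (L x) - (2 * a) *\<^sub>R L x + (a\<^sup>2 + b\<^sup>2) *\<^sub>R x) \<le> norm (L ?y) + norm (scal a (- b) ?y)"
    using norm_triangle_ineq4 by simp
  also have "\<dots> \<le> (onorm L + sqrt (a\<^sup>2 + b\<^sup>2)) * norm ?y"
    using onorm[OF blL, of ?y] by (simp add: norm_scal algebra_simps)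
  finally show ?thesis .
qed

text \<open>At every scale some cell meets \<open>z\<close>, and cutting by it stays in the range of
  \<open>P\<close> because the two commute. The scalars attached to these cells are bounded, so a
  subsequence of them converges to the required pair. The projection \<open>P\<close> serves to
  locate spectrum in a prescribed part of the space.\<close>

lemma approx_eigenvalue:
  assumes P: "orthproj P" "commutes P" and z: "P z = z" "z \<noteq> 0"
  shows "\<exists>a b. \<forall>e>0. \<exists>x. P x = x \<and> norm x = 1 \<and> norm (L x - scal a b x) < e"
proof -
  have "\<exists>q x. cell n q x = x \<and> P x = x \<and> norm x = 1" for n
  proof -
    obtain K :: nat where K: "max (2 * c * 2 ^ n) 1 \<le> real K" using real_arch_simple by blast
    then have "(\<Sum>q\<in>{..<K} \<times> {..<K} \<times> {..<K}. cell n q z) = z" by (intro cell_sum) auto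
    then obtain q where q: "cell n q z \<noteq> 0" using z(2) by (metis (no_types, lifting) sum.neutral)
    define x where "x = (1 / norm (cell n q z)) *\<^sub>R cell n q z"
    have "cell n q x = x" "norm x = 1"
      using q by (simp_all add: x_def cell_simps orthproj_idem[OF orthproj_cell])
    moreover have "P x = x"
      using cell_commutes[OF P(2), of n q z] bounded_linear_linear_rules(3)[of P] P(1) z(1)
      by (simp add: x_def orthproj_def)
    ultimately show ?thesis by blast
  qed
  then obtain q x where x: "\<And>n. cell n (q n) (x n) = x n" "\<And>n. P (x n) = x n" "\<And>n. norm (x n) = 1"
    by metis
  define k1 k2 k3 where "k1 n = fst (q n)" and "k2 n = fst (snd (q n))" and "k3 n = snd (snd (q n))" for n
  define al be where "al n = real (k1 n) / 2 ^ n - c" and "be n = real (k2 n) / 2 ^ n - c" for n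
  have est: "norm (L (x n) - scal (al n) (be n) (x n)) \<le> 6 / 2 ^ n" for n
    using cell_estimate(1)[of n "k1 n" "k2 n" "k3 n" "x n"] x by (simp add: k1_def k2_def k3_def al_def be_def)
  have "norm (al n, be n) \<le> 2 * c + 6" for n
  proof -
    have "norm (al n, be n) = norm (scal (al n) (be n) (x n))" by (simp add: norm_scal x norm_Pair)
    also have "\<dots> \<le> norm (L (x n)) + norm (L (x n) - scal (al n) (be n) (x n))"
      using norm_triangle_ineq4[of "L (x n)" "L (x n) - scal (al n) (be n) (x n)"] by simp
    also have "\<dots> \<le> 2 * c + 6"
    proof -
      have "norm (L (x n)) \<le> 2 * c"
        using c_ge(2)[of "x n"] norm_ge_zero[of "L' (x n)"] unfolding x(3) by linarith
      moreover have "(6::real) / 2 ^ n \<le> 6" by (simp add: divide_le_eq)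
      ultimately show ?thesis using est[of n] by linarith
    qed
    finally show ?thesis .
  qed
  then have "bounded (range (\<lambda>n. (al n, be n)))" unfolding bounded_iff by blast
  from bounded_imp_convergent_subsequence[OF this]
  obtain l r where r: "strict_mono r" and l: "((\<lambda>n. (al n, be n)) \<circ> r) \<longlonglongrightarrow> l" by blast
  obtain a b where ab: "l = (a, b)" by force
  have lim: "(\<lambda>n. al (r n)) \<longlonglongrightarrow> a" "(\<lambda>n. be (r n)) \<longlonglongrightarrow> b"
    using tendsto_fst[OF l] tendsto_snd[OF l] by (simp_all add: ab o_def)
  have "(\<lambda>n. 6 / 2 ^ n :: real) \<longlonglongrightarrow> 0"
    using tendsto_mult[OF tendsto_const LIMSEQ_inverse_realpow_zero[of 2], of 6] by (simp add: divide_inverse)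
  then have "(\<lambda>n. 6 / 2 ^ r n :: real) \<longlonglongrightarrow> 0" using LIMSEQ_subseq_LIMSEQ[OF _ r] by (auto simp: o_def)
  then have "(\<lambda>n. 6 / 2 ^ r n + sqrt ((al (r n) - a)\<^sup>2 + (be (r n) - b)\<^sup>2)) \<longlonglongrightarrow> 0 + sqrt ((a - a)\<^sup>2 + (b - b)\<^sup>2)"
    by (intro tendsto_intros lim)
  then have t0: "(\<lambda>n. 6 / 2 ^ r n + sqrt ((al (r n) - a)\<^sup>2 + (be (r n) - b)\<^sup>2)) \<longlonglongrightarrow> 0" by simp
  have "\<exists>y. P y = y \<and> norm y = 1 \<and> norm (L y - scal a b y) < e" if e: "e > 0" for e
  proof -
    obtain n where n: "6 / 2 ^ r n + sqrt ((al (r n) - a)\<^sup>2 + (be (r n) - b)\<^sup>2) < e"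
      using order_tendstoD(2)[OF t0 e] unfolding eventually_sequentially by blast
    let ?u = "L (x (r n)) - scal (al (r n)) (be (r n)) (x (r n))"
    let ?v = "scal (al (r n) - a) (be (r n) - b) (x (r n))"
    have "L (x (r n)) - scal a b (x (r n)) = ?u + ?v" by (simp flip: scal_rules(3))
    then have "norm (L (x (r n)) - scal a b (x (r n))) \<le> norm ?u + norm ?v" by (simp only: norm_triangle_ineq)
    also have "\<dots> \<le> 6 / 2 ^ r n + sqrt ((al (r n) - a)\<^sup>2 + (be (r n) - b)\<^sup>2)"
      using est[of "r n"] by (simp add: norm_scal x(3))
    finally have "norm (L (x (r n)) - scal a b (x (r n))) \<le> 6 / 2 ^ r n + sqrt ((al (r n) - a)\<^sup>2 + (be (r n) - b)\<^sup>2)" .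
    then show ?thesis using n x(2,3) by (intro exI[of _ "x (r n)"]) auto
  qed
  then show ?thesis by blast
qed

section \<open>Quaternionic spans and quaternionic orthogonality\<close>

definition mults :: "'a \<Rightarrow> 'a set" where
  "mults a = {a, I a, J a, I (J a)}"

text \<open>The closed quaternionic subspace generated by \<open>A\<close>, since
  \<open>mults a\<close> spans the quaternionic line through \<open>a\<close> over the
  reals.\<close>

definition qspan :: "'a set \<Rightarrow> 'a set" where
  "qspan A = closure (span (\<Union> (mults ` A)))"

lemma subspace_qspan: "subspace (qspan A)" and closed_qspan: "closed (qspan A)"
  by (simp_all add: qspan_def subspace_closure)

lemma mults_qspan: "a \<in> A \<Longrightarrow> x \<in> mults a \<Longrightarrow> x \<in> qspan A"
  unfolding qspan_def by (meson UN_I closure_subset span_base subsetD)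

lemma self_qspan: "a \<in> A \<Longrightarrow> a \<in> qspan A"
  by (rule mults_qspan) (auto simp: mults_def)

lemma qspan_least:
  assumes "subspace N" "closed N" "\<And>a x. a \<in> A \<Longrightarrow> x \<in> mults a \<Longrightarrow> x \<in> N"
  shows "qspan A \<subseteq> N"
  unfolding qspan_def using assms by (intro closure_minimal span_minimal) auto

lemma qspan_invariant:
  assumes "bounded_linear T" "\<And>a x. a \<in> A \<Longrightarrow> x \<in> mults a \<Longrightarrow> T x \<in> qspan B" "x \<in> qspan A"
  shows "T x \<in> qspan B"
proof -
  interpret T: bounded_linear T by fact
  have "qspan A \<subseteq> T -` qspan B"
  proof (rule qspan_least)
    show "subspace (T -` qspan B)"
      using subspace_qspan[of B] by (simp add: T.linear linear_subspace_vimage)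
    show "closed (T -` qspan B)" by (intro closed_vimage closed_qspan T.continuous_on continuous_on_id)
  qed (use assms(2) in auto)
  then show ?thesis using assms(3) by auto
qed

lemma qspan_I: "x \<in> qspan A \<Longrightarrow> I x \<in> qspan A"
proof (rule qspan_invariant[OF blI])
  fix a y assume a: "a \<in> A" "y \<in> mults a"
  have "a \<in> qspan A" "I a \<in> qspan A" "J a \<in> qspan A" "I (J a) \<in> qspan A"
    using mults_qspan[OF a(1)] by (auto simp: mults_def)
  then show "I y \<in> qspan A" using a(2) subspace_neg[OF subspace_qspan] by (auto simp: mults_def II)
qed

lemma qspan_J: "x \<in> qspan A \<Longrightarrow> J x \<in> qspan A"
proof (rule qspan_invariant[OF blJ])
  fix a y assume a: "a \<in> A" "y \<in> mults a"
  have h: "a \<in> qspan A" "I a \<in> qspan A" "J a \<in> qspan A" "I (J a) \<in> qspan A"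
    using mults_qspan[OF a(1)] by (auto simp: mults_def)
  have "J (I a) = - I (J a)" "J (I (J a)) = I a" using IJ[of a] IJ[of "J a"] by (auto simp: JJ I_simps)
  then show "J y \<in> qspan A" using a(2) subspace_neg[OF subspace_qspan] h by (auto simp: mults_def JJ)
qed

lemma qspan_mono: "A \<subseteq> B \<Longrightarrow> qspan A \<subseteq> qspan B"
  unfolding qspan_def by (intro closure_mono span_mono) auto

text \<open>The hypothesis has to range over all \<open>q\<close>, because applying cell
  \<open>(k1, k2, k3)\<close> to \<open>J a\<close> amounts to applying cell
  \<open>(k1, k3, k2)\<close> to \<open>a\<close>.\<close>

lemma qspan_cell:
  assumes "\<And>a q. a \<in> A \<Longrightarrow> cell n q a \<in> qspan A" "x \<in> qspan A"
  shows "cell n q x \<in> qspan A"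
proof (rule qspan_invariant[OF _ _ assms(2)])
  show "bounded_linear (cell n q)" by (rule adj_bl(1)[OF orthproj_adj[OF orthproj_cell]])
  obtain k1 k2 k3 where q: "q = (k1, k2, k3)" by (metis prod_cases3)
  fix a y assume a: "a \<in> A" "y \<in> mults a"
  then show "cell n q y \<in> qspan A"
    using assms(1)[OF a(1)] qspan_I qspan_J
    by (auto simp: mults_def q cell_commutes[OF commutes_I] cell_J)
qed

text \<open>\<open>qorth x\<close> is the set of vectors that are orthogonal to \<open>x\<close> with respect to the
  quaternionic inner product.\<close>

definition qorth :: "'a \<Rightarrow> 'a set" where
  "qorth x = ortho (mults x)"

lemma qorth_I: "y \<in> qorth x \<Longrightarrow> I y \<in> qorth x"
  using adjD[OF adjI] by (auto simp: qorth_def ortho_def mults_def II)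

lemma qorth_J: "y \<in> qorth x \<Longrightarrow> J y \<in> qorth x"
proof -
  have "J (I x) = - I (J x)" "J (I (J x)) = I x" using IJ[of x] IJ[of "J x"] by (auto simp: JJ I_simps)
  then show "y \<in> qorth x \<Longrightarrow> J y \<in> qorth x"
    using adjD[OF adjJ] by (auto simp: qorth_def ortho_def mults_def JJ)
qed

lemma qorth_sym: "y \<in> qorth x \<Longrightarrow> x \<in> qorth y"
proof -
  assume y: "y \<in> qorth x"
  have "z \<bullet> x = 0" if "z \<in> qorth x" for z using that by (simp add: qorth_def ortho_def mults_def)
  then show ?thesis using y qorth_I[OF y] qorth_J[OF y] qorth_I[OF qorth_J[OF y]]
    unfolding qorth_def[of y] by (auto simp: ortho_def mults_def inner_commute[of x])
qed

lemma qspan_qorth: "A \<subseteq> qorth x \<Longrightarrow> qspan A \<subseteq> qorth x"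
proof (rule qspan_least)
  show "subspace (qorth x)" "closed (qorth x)" by (simp_all add: qorth_def subspace_ortho closed_ortho)
  fix a y assume "A \<subseteq> qorth x" "a \<in> A" "y \<in> mults a"
  then show "y \<in> qorth x" using qorth_I[of _ x] qorth_J[of _ x] unfolding mults_def by blast
qed

end

section \<open>A quasi-diagonal basis\<close>

lemma sum_Suc_div_pow2: "(\<Sum>n<N. real (Suc n) / 2 ^ n) \<le> 4"
proof -
  have "(\<Sum>n<N. real (Suc n) / 2 ^ n) = 4 - 2 * (real N + 2) / 2 ^ N"
  proof (induction N)
    case (Suc N)
    have "(\<Sum>n<Suc N. real (Suc n) / 2 ^ n) = 4 - 2 * (real N + 2) / 2 ^ N + (real N + 1) / 2 ^ N"
      using Suc by simp
    also have "\<dots> = 4 - 2 * (real (Suc N) + 2) / 2 ^ Suc N" by (simp add: field_simps)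
    finally show ?case .
  qed simp
  then show ?thesis by simp
qed

text \<open>\<open>C\<close> records the linear growth of the number of cells with
  \<open>2^n\<close>, \<open>e\<close> is a total sequence, and \<open>M\<close> is the starting
  scale, whose choice makes the final error small.\<close>

locale quat_normal_cells = quat_normal L L' I J
  for L L' I J :: "'a::{real_inner,complete_space} \<Rightarrow> 'a" +
  fixes C :: real and e :: "nat \<Rightarrow> 'a" and M :: nat
  assumes few: "\<And>n. finite {q. \<exists>x. cell n q x \<noteq> 0} \<and> real (card {q. \<exists>x. cell n q x \<noteq> 0}) \<le> C * 2 ^ n"
    and total: "\<And>x. (\<And>k. e k \<in> qorth x) \<Longrightarrow> x = 0"
begin

text \<open>The index \<open>(n, k, q)\<close> stands for the stage, the vector \<open>e k\<close> and the cell. Only the order of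
  the stages matters; within a stage \<open>R\<close> is an arbitrary well-order.\<close>

type_synonym idx = "nat \<times> nat \<times> nat \<times> nat \<times> nat"

definition R :: "(idx \<times> idx) set" where
  "R = inv_image (less_than <*lex*> less_than) (\<lambda>i. (fst i, to_nat (snd i)))"

lemma wf_R: "wf R"
  unfolding R_def by (intro wf_inv_image wf_lex_prod wf_less_than)

lemma trans_R: "(i, j) \<in> R \<Longrightarrow> (j, k) \<in> R \<Longrightarrow> (i, k) \<in> R"
  by (auto simp: R_def)

lemma total_R: "(i, j) \<in> R \<or> i = j \<or> (j, i) \<in> R"
  by (auto simp: R_def prod_eq_iff)

text \<open>Admitting only \<open>e 0\<close> to \<open>e n\<close> at stage \<open>n\<close> keeps
  every stage finite. The value 0 elsewhere is harmless, as Gram-Schmidt turns it into 0 and zero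
  vectors are discarded at the end.\<close>

fun gen :: "idx \<Rightarrow> 'a" where
  "gen (n, k, q) = (if k \<le> n then cell (M + n + 1) q (e k) else 0)"

definition W :: "idx \<Rightarrow> 'a set" where
  "W j = qspan {gen i |i. (i, j) \<in> R}"

definition u :: "idx \<Rightarrow> 'a" where
  "u j = gen j - proj (W j) (gen j)"

lemma W_sub: "subspace (W j)" "closed (W j)"
  by (simp_all add: W_def subspace_qspan closed_qspan)

lemma gen_W: "(i, j) \<in> R \<Longrightarrow> gen i \<in> W j"
  unfolding W_def by (rule self_qspan) blast

lemma u_W: "(i, j) \<in> R \<Longrightarrow> u i \<in> W j"
proof -
  assume ij: "(i, j) \<in> R"
  have "W i \<subseteq> W j" unfolding W_def using ij trans_R by (intro qspan_mono) blast
  then show ?thesis unfolding u_def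
    using gen_W[OF ij] proj_in[OF W_sub, of i "gen i"] by (intro subspace_diff W_sub) auto
qed

lemma u_zero: "gen j = 0 \<Longrightarrow> u j = 0"
  using proj_id[OF W_sub subspace_0[OF W_sub(1)]] by (simp add: u_def)

lemma u_qorth:
  assumes "i \<noteq> j"
  shows "u i \<in> qorth (u j)"
proof -
  have *: "u b \<in> qorth (u a)" if "(a, b) \<in> R" for a b
  proof -
    have "u a \<in> W b" using u_W[OF that] .
    then have "mults (u a) \<subseteq> W b" using qspan_I qspan_J unfolding W_def mults_def by blast
    then show ?thesis using proj_orth[OF W_sub, of _ b "gen b"]
      by (auto simp: qorth_def ortho_def u_def)
  qed
  show ?thesis using total_R[of i j] assms *[of i j] *[of j i] qorth_sym by blast
qed

text \<open>For a generator of the same stage the coarser cell contains or misses the finer one. For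
  an earlier stage the vector \<open>e k'\<close> was already cut by all cells of scale
  \<open>M + n\<close> at stage \<open>n - 1\<close>, so the result is again an earlier generator,
  up to a nested cell that fixes or kills it.\<close>

lemma gen_cell:
  assumes "(i, (n, k, q)) \<in> R"
  shows "cell (M + n) q' (gen i) \<in> W (n, k, q)"
proof -
  obtain n' k' q'' where i: "i = (n', k', q'')" by (metis prod_cases3)
  have n': "n' \<le> n" using assms by (auto simp: R_def i)
  have z: "0 \<in> W (n, k, q)" by (rule subspace_0[OF W_sub(1)])
  show ?thesis
  proof (cases "k' \<le> n'")
    case False
    then show ?thesis using z by (simp add: i cell_simps)
  next
    case True
    show ?thesis
    proof (cases "n' = n")
      case True': True
      have "M + n \<le> M + n + 1" by simp
      from cell_nested[OF this, of q' q''] show ?thesis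
        using gen_W[OF assms] z True by (auto simp: i True')
    next
      case False
      then have lt: "M + n' + 1 \<le> M + n" "n' < n" using n' by auto
      \<comment> \<open>Exchanging the two cells exhibits \<open>cell (M + n) q' (e k')\<close>,
        which is the generator \<open>(n - 1, k', q')\<close> because stage \<open>n - 1\<close>
        cuts at scale \<open>M + (n - 1) + 1\<close>.\<close>
      have "cell (M + n) q' (gen i) = cell (M + n' + 1) q'' (cell (M + n) q' (e k'))"
        using True by (simp add: i) (rule cell_cell_comm)
      moreover have "cell (M + n) q' (e k') \<in> W (n, k, q)"
      proof -
        obtain n0 where n0: "n = Suc n0" using lt by (cases n) auto
        have "((n0, k', q'), (n, k, q)) \<in> R" by (simp add: R_def n0)
        from gen_W[OF this] show ?thesis using True lt n0 by simp
      qed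
      ultimately show ?thesis using cell_nested[OF lt(1), of q'' q'] z by auto
    qed
  qed
qed

text \<open>By \<open>gen_cell\<close> the span \<open>W\<close> is invariant under all cells of
  scale \<open>M + n\<close>, so these commute with the projection onto \<open>W\<close>. A cell
  that fixes the generator therefore fixes its component orthogonal to \<open>W\<close>.\<close>

lemma u_cell:
  assumes "u (n, k, q) \<noteq> 0"
  shows "\<exists>q'. cell (M + n) q' (u (n, k, q)) = u (n, k, q)"
proof -
  let ?j = "(n, k, q)"
  have g0: "gen ?j \<noteq> 0" using assms u_zero by blast
  then have k: "k \<le> n" by (auto split: if_splits)
  obtain K :: nat where K: "max (2 * c * 2 ^ (M + n)) 1 \<le> real K" using real_arch_simple by blast
  then have "(\<Sum>q\<in>{..<K} \<times> {..<K} \<times> {..<K}. cell (M + n) q (gen ?j)) = gen ?j" by (intro cell_sum) auto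
  then obtain q' where q': "cell (M + n) q' (gen ?j) \<noteq> 0" using g0 by (metis (no_types, lifting) sum.neutral)
  have "M + n \<le> M + n + 1" by simp
  \<comment> \<open>A coarser cell that does not kill the generator contains the finer cell from
    which it was cut.\<close>
  from cell_nested[OF this, of q' q] have fix_gen: "cell (M + n) q' (gen ?j) = gen ?j"
    using q' k by auto
  have inv: "cell (M + n) r x \<in> W ?j" if "x \<in> W ?j" for r x
    unfolding W_def
  proof (rule qspan_cell)
    show "x \<in> qspan {gen i |i. (i, ?j) \<in> R}" using that unfolding W_def .
    fix y q' assume "y \<in> {gen i |i. (i, ?j) \<in> R}"
    then show "cell (M + n) q' y \<in> qspan {gen i |i. (i, ?j) \<in> R}"
      using gen_cell unfolding W_def by blast
  qed
  have "proj (W ?j) (cell (M + n) q' (gen ?j)) = cell (M + n) q' (proj (W ?j) (gen ?j))"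
    by (rule proj_intertwine[OF W_sub W_sub orthproj_adj[OF orthproj_cell] inv inv])
  then have "cell (M + n) q' (u ?j) = u ?j" using fix_gen by (simp add: u_def cell_simps del: gen.simps)
  then show ?thesis by blast
qed

lemma u_estimate:
  assumes "u (n, k, q) \<noteq> 0"
  shows "\<exists>a b. norm (L (u (n, k, q)) - scal a b (u (n, k, q))) \<le> 6 / 2 ^ (M + n) * norm (u (n, k, q))"
proof -
  obtain q' where "cell (M + n) q' (u (n, k, q)) = u (n, k, q)" using u_cell[OF assms] by blast
  then show ?thesis using cell_estimate(1)[of "M + n"] by (metis prod_cases3)
qed

text \<open>Induction along \<open>R\<close> recovers every \<open>gen j\<close> from
  \<open>u j\<close> and the earlier generators; then \<open>e k\<close> is the sum of the
  generators \<open>(k, k, q)\<close> of stage \<open>k\<close>.\<close>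

lemma u_total:
  assumes "\<And>j. u j \<in> qorth x"
  shows "x = 0"
proof (rule total)
  have sub: "subspace (qorth x)" by (simp add: qorth_def subspace_ortho)
  have g: "gen j \<in> qorth x" for j
  proof (induction j rule: wf_induct_rule[OF wf_R])
    case (1 j)
    have "W j \<subseteq> qorth x" unfolding W_def using 1 by (intro qspan_qorth) blast
    then have "proj (W j) (gen j) \<in> qorth x" using proj_in[OF W_sub] by blast
    from subspace_add[OF sub assms[of j] this] show ?case by (simp add: u_def)
  qed
  fix k
  obtain K :: nat where K: "max (2 * c * 2 ^ (M + k + 1)) 1 \<le> real K" using real_arch_simple by blast
  then have "e k = (\<Sum>q\<in>{..<K} \<times> {..<K} \<times> {..<K}. cell (M + k + 1) q (e k))"
    by (intro cell_sum[symmetric]) auto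
  also have "\<dots> \<in> qorth x"
  proof (rule subspace_sum[OF sub])
    fix q show "cell (M + k + 1) q (e k) \<in> qorth x" using g[of "(k, k, q)"] by simp
  qed
  finally show "e k \<in> qorth x" .
qed

lemma few_u: 
  "finite {i. fst i = n \<and> u i \<noteq> 0}" 
  "real (card {i. fst i = n \<and> u i \<noteq> 0}) \<le> real (Suc n) * (C * 2 ^ (M + n + 1))"
proof -
  let ?Q = "{q. \<exists>x. cell (M + n + 1) q x \<noteq> 0}"
  have sub: "{i. fst i = n \<and> u i \<noteq> 0} \<subseteq> (\<lambda>(k, q). (n, k, q)) ` ({..n} \<times> ?Q)"
  proof
    fix i assume i: "i \<in> {i. fst i = n \<and> u i \<noteq> 0}"
    then obtain k q where ikq: "i = (n, k, q)" by (cases i) auto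
    then have "gen (n, k, q) \<noteq> 0" using i u_zero by blast
    then have "k \<le> n" "q \<in> ?Q" by (auto split: if_splits)
    then show "i \<in> (\<lambda>(k, q). (n, k, q)) ` ({..n} \<times> ?Q)" using ikq by auto
  qed
  have fin: "finite ({..n} \<times> ?Q)" using few by blast
  then show "finite {i. fst i = n \<and> u i \<noteq> 0}" using sub finite_subset by blast
  have "card {i. fst i = n \<and> u i \<noteq> 0} \<le> card ({..n} \<times> ?Q)"
    using card_mono[OF finite_imageI[OF fin] sub] card_image_le[OF fin] le_trans by blast
  also have "\<dots> = Suc n * card ?Q" by (simp add: card_cartesian_product)
  finally have "real (card {i. fst i = n \<and> u i \<noteq> 0}) \<le> real (Suc n) * real (card ?Q)"
    by (simp only: of_nat_mult[symmetric] of_nat_le_iff)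
  also have "\<dots> \<le> real (Suc n) * (C * 2 ^ (M + n + 1))"
    using few[of "M + n + 1"] by (intro mult_left_mono) auto
  finally show "real (card {i. fst i = n \<and> u i \<noteq> 0}) \<le> real (Suc n) * (C * 2 ^ (M + n + 1))" .
qed

text \<open>Stage \<open>n\<close> contributes at most \<open>(n + 1) C 2^(M + n + 1)\<close>
  vectors with squared error \<open>36 / 4^(M + n)\<close>, that is \<open>72 C / 2^M\<close> times
  \<open>(n + 1) / 2^n\<close>. The sum of the last factors is at most 4, whence 288. The basis is
  delivered as a set because the nonzero \<open>u j\<close> are not yet enumerated.\<close>

lemma quasi_diagonal:
  obtains B a b where "countable B" "\<And>x. x \<in> B \<Longrightarrow> norm x = 1"
    "\<And>x y. x \<in> B \<Longrightarrow> y \<in> B \<Longrightarrow> x \<noteq> y \<Longrightarrow> x \<in> qorth y"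
    "\<And>z. (\<And>x. x \<in> B \<Longrightarrow> x \<in> qorth z) \<Longrightarrow> z = 0"
    "\<And>F. finite F \<Longrightarrow> F \<subseteq> B \<Longrightarrow> (\<Sum>x\<in>F. (norm (L x - scal (a x) (b x) x))\<^sup>2) \<le> 288 * C / 2 ^ M"
proof -
  define D where "D = {i. u i \<noteq> 0}"
  define v where "v i = (1 / norm (u i)) *\<^sub>R u i" for i
  have nv: "norm (v i) = 1" if "i \<in> D" for i using that by (simp add: v_def D_def)
  have sq: "subspace (qorth z)" for z by (simp add: qorth_def subspace_ortho)
  have ov: "v i \<in> qorth (v j)" if "i \<noteq> j" for i j
  proof -
    have "v i \<in> qorth (u j)" unfolding v_def using u_qorth[OF that] by (intro subspace_scale sq)
    then have "u j \<in> qorth (v i)" by (rule qorth_sym)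
    then have "v j \<in> qorth (v i)" unfolding v_def[of j] by (intro subspace_scale sq)
    then show ?thesis by (rule qorth_sym)
  qed
  have "\<exists>a b. norm (L (v i) - scal a b (v i)) \<le> 6 / 2 ^ (M + fst i)" if i: "i \<in> D" for i
  proof -
    obtain n k q where nkq: "i = (n, k, q)" by (metis prod_cases3)
    obtain a b where ab: "norm (L (u i) - scal a b (u i)) \<le> 6 / 2 ^ (M + n) * norm (u i)"
      using u_estimate[of n k q] i by (auto simp: D_def nkq)
    have "norm (L (v i) - scal a b (v i)) = norm (L (u i) - scal a b (u i)) / norm (u i)"
      unfolding v_def L_simps scal_rules by (simp flip: scaleR_diff_right)
    also have "\<dots> \<le> 6 / 2 ^ (M + n)" using ab i by (simp add: D_def divide_le_eq)
    finally show ?thesis using nkq by auto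
  qed
  then obtain a b where ab: "\<And>i. i \<in> D \<Longrightarrow> norm (L (v i) - scal (a i) (b i) (v i)) \<le> 6 / 2 ^ (M + fst i)"
    by metis
  have injv: "inj_on v D"
  proof (rule inj_onI, rule ccontr)
    fix i j assume ij: "i \<in> D" "j \<in> D" "v i = v j" "i \<noteq> j"
    then have "v i \<bullet> v i = 0" using ov[OF ij(4)] by (simp add: qorth_def ortho_def mults_def)
    then show False using nv[OF ij(1)] by simp
  qed
  define B where "B = v ` D"
  define g where "g = inv_into D v"
  have gv: "g (v i) = i" if "i \<in> D" for i using inv_into_f_f[OF injv that] by (simp add: g_def)
  have "real (card {q. \<exists>x. cell 0 q x \<noteq> 0}) \<le> C" using few[of 0] by simp
  then have C0: "0 \<le> C" by (rule order_trans[OF of_nat_0_le_iff])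
  show thesis
  proof (rule that[of B "a \<circ> g" "b \<circ> g"])
    show "countable B" unfolding B_def by simp
    show "norm x = 1" if "x \<in> B" for x using that nv by (auto simp: B_def)
    show "x \<in> qorth y" if xy: "x \<in> B" "y \<in> B" "x \<noteq> y" for x y
    proof -
      obtain i j where "x = v i" "y = v j" using xy unfolding B_def by blast
      then show ?thesis using ov[of i j] xy(3) by blast
    qed
    show "z = 0" if z: "\<And>x. x \<in> B \<Longrightarrow> x \<in> qorth z" for z
    proof (rule u_total)
      fix j show "u j \<in> qorth z"
      proof (cases "j \<in> D")
        case True
        then have "norm (u j) *\<^sub>R v j \<in> qorth z" using z by (intro subspace_scale sq) (auto simp: B_def)
        then show ?thesis using True by (simp add: v_def D_def)
      next
        case False
        then show ?thesis using subspace_0[OF sq] by (simp add: D_def)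
      qed
    qed
    fix F assume F: "finite F" "F \<subseteq> B"
    define G where "G = g ` F"
    have G: "finite G" "G \<subseteq> D" using F gv by (auto simp: G_def B_def)
    have FG: "F = v ` G" using F gv by (force simp: G_def B_def)
    have injG: "inj_on v G" using injv G inj_on_subset by blast
    obtain N where N: "\<And>i. i \<in> G \<Longrightarrow> fst i < N"
      using finite_nat_set_iff_bounded[of "fst ` G"] G(1) by auto
    have "(\<Sum>x\<in>F. (norm (L x - scal (a (g x)) (b (g x)) x))\<^sup>2)
        = (\<Sum>i\<in>G. (norm (L (v i) - scal (a i) (b i) (v i)))\<^sup>2)"
      unfolding FG using G gv by (subst sum.reindex[OF injG]) (auto intro!: sum.cong)
    also have "\<dots> \<le> (\<Sum>i\<in>G. (6 / 2 ^ (M + fst i))\<^sup>2)"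
      using ab G by (intro sum_mono power_mono) auto
    also have "\<dots> = (\<Sum>n<N. \<Sum>i | i \<in> G \<and> fst i = n. (6 / 2 ^ (M + fst i))\<^sup>2)"
      by (rule sum.group[symmetric]) (use G N in auto)
    also have "\<dots> \<le> (\<Sum>n<N. 72 * C / 2 ^ M * (real (Suc n) / 2 ^ n))"
    proof (rule sum_mono)
      fix n
      have "card {i. i \<in> G \<and> fst i = n} \<le> card {i. fst i = n \<and> u i \<noteq> 0}"
        using G by (intro card_mono few_u) (auto simp: D_def)
      then have cd: "real (card {i. i \<in> G \<and> fst i = n}) \<le> real (Suc n) * (C * 2 ^ (M + n + 1))"
        using few_u(2)[of n] by linarith
      have "(\<Sum>i | i \<in> G \<and> fst i = n. (6 / 2 ^ (M + fst i))\<^sup>2) = real (card {i. i \<in> G \<and> fst i = n}) * (6 / 2 ^ (M + n))\<^sup>2"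
        by simp
      also have "\<dots> \<le> real (Suc n) * (C * 2 ^ (M + n + 1)) * (6 / 2 ^ (M + n))\<^sup>2"
        using cd by (intro mult_right_mono) auto
      also have "\<dots> = 72 * C / 2 ^ M * (real (Suc n) / 2 ^ n)"
        by (simp add: power_add power2_eq_square)
      finally show "(\<Sum>i | i \<in> G \<and> fst i = n. (6 / 2 ^ (M + fst i))\<^sup>2) \<le> 72 * C / 2 ^ M * (real (Suc n) / 2 ^ n)" .
    qed
    also have "\<dots> = 72 * C / 2 ^ M * (\<Sum>n<N. real (Suc n) / 2 ^ n)" by (rule sum_distrib_left[symmetric])
    also have "\<dots> \<le> 72 * C / 2 ^ M * 4" using sum_Suc_div_pow2 C0 by (intro mult_left_mono) auto
    finally show "(\<Sum>x\<in>F. (norm (L x - scal ((a \<circ> g) x) ((b \<circ> g) x) x))\<^sup>2) \<le> 288 * C / 2 ^ M" by simp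
  qed
qed

end

section \<open>Boundedness from a bounded spectrum\<close>

text \<open>\<open>spec\<close> is all that is kept of the spectral hypothesis: a pair at which the
  quadratic operator has approximate null vectors lies in the disc of radius
  \<open>\<rho>\<close>.\<close>

locale normal_unbounded =
  fixes D D' :: "'a::{real_inner,complete_space} set" and N N' I J :: "'a \<Rightarrow> 'a" and \<rho> :: real
  assumes subD: "subspace D" and dense: "closure D = UNIV"
    and N_add: "\<And>x y. x \<in> D \<Longrightarrow> y \<in> D \<Longrightarrow> N (x + y) = N x + N y"
    and N_scale: "\<And>r x. x \<in> D \<Longrightarrow> N (r *\<^sub>R x) = r *\<^sub>R N x"
    and closed_graph: "closed ((\<lambda>x. (x, N x)) ` D)"
    and D': "D' = {y. \<exists>z. \<forall>x\<in>D. y \<bullet> N x = z \<bullet> x}"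
    and N': "\<And>x y. y \<in> D' \<Longrightarrow> x \<in> D \<Longrightarrow> y \<bullet> N x = N' y \<bullet> x"
    and normal_dom: "{y \<in> D'. N' y \<in> D} = {x \<in> D. N x \<in> D'}"
    and normal_eq: "\<And>x. x \<in> D \<Longrightarrow> N x \<in> D' \<Longrightarrow> N (N' x) = N' (N x)"
    and adjI: "adj I (\<lambda>x. - I x)" and adjJ: "adj J (\<lambda>x. - J x)"
    and II: "I (I x) = - x" and JJ: "J (J x) = - x" and IJ: "I (J x) = - J (I x)"
    and NI: "\<And>x. x \<in> D \<Longrightarrow> I x \<in> D" "\<And>x. x \<in> D \<Longrightarrow> N (I x) = I (N x)"
    and NJ: "\<And>x. x \<in> D \<Longrightarrow> J x \<in> D" "\<And>x. x \<in> D \<Longrightarrow> N (J x) = J (N x)"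
    and rho: "0 \<le> \<rho>"
    and spec: "\<And>a b. (\<And>e. e > 0 \<Longrightarrow> \<exists>x\<in>D. N x \<in> D \<and> norm x = 1 \<and>
        norm (N (N x) - (2 * a) *\<^sub>R N x + (a\<^sup>2 + b\<^sup>2) *\<^sub>R x) < e) \<Longrightarrow> a\<^sup>2 + b\<^sup>2 \<le> \<rho>\<^sup>2"
begin

lemma N'I:
  assumes "\<And>x. x \<in> D \<Longrightarrow> y \<bullet> N x = z \<bullet> x"
  shows "y \<in> D'" "N' y = z"
proof -
  show "y \<in> D'" using assms by (auto simp: D')
  then show "N' y = z" using N' assms by (intro inner_eq_on_dense[OF dense]) metis
qed

lemma N'_add: "y \<in> D' \<Longrightarrow> z \<in> D' \<Longrightarrow> y + z \<in> D' \<and> N' (y + z) = N' y + N' z"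
  using N'I[of "y + z" "N' y + N' z"] by (simp add: N' inner_add_left)

lemma N'_scale: "y \<in> D' \<Longrightarrow> r *\<^sub>R y \<in> D' \<and> N' (r *\<^sub>R y) = r *\<^sub>R N' y"
  using N'I[of "r *\<^sub>R y" "r *\<^sub>R N' y"] by (simp add: N')

lemma N_minus: "x \<in> D \<Longrightarrow> N (- x) = - N x"
  using N_scale[of x "-1"] by simp

lemma N'_skew:
  assumes K: "adj K (\<lambda>x. - K x)" "\<And>x. x \<in> D \<Longrightarrow> K x \<in> D" "\<And>x. x \<in> D \<Longrightarrow> N (K x) = K (N x)"
    and y: "y \<in> D'"
  shows "K y \<in> D' \<and> N' (K y) = K (N' y)"
proof -
  have "K y \<bullet> N x = K (N' y) \<bullet> x" if "x \<in> D" for x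
    using N'[OF y K(2)[OF that]] adjD[OF K(1)] K(3)[OF that] by simp
  then show ?thesis using N'I by blast
qed

definition D1 where "D1 = {x \<in> D. N x \<in> D'}"

lemma D1_D': "x \<in> D1 \<Longrightarrow> x \<in> D' \<and> N' x \<in> D"
  using normal_dom by (auto simp: D1_def)

lemma D1_lin:
  assumes "x \<in> D1" "y \<in> D1"
  shows "x + y \<in> D1" "N' (N (x + y)) = N' (N x) + N' (N y)" "r *\<^sub>R x \<in> D1" "N' (N (r *\<^sub>R x)) = r *\<^sub>R N' (N x)"
  using assms N'_add[of "N x" "N y"] N'_scale[of "N x" r] subD
  by (auto simp: D1_def N_add N_scale subspace_add subspace_scale)

lemma D1_inner: "x \<in> D1 \<Longrightarrow> y \<in> D \<Longrightarrow> N' (N x) \<bullet> y = N x \<bullet> N y"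
  using N' by (auto simp: D1_def)

text \<open>Von Neumann: \<open>(h, 0)\<close> splits orthogonally along the closed graph of \<open>N\<close>.\<close>

lemma resolvent_exists: "\<exists>x\<in>D1. x + N' (N x) = h"
proof -
  let ?G = "(\<lambda>x. (x, N x)) ` D"
  have sub: "subspace ?G"
  proof (rule subspaceI)
    show "0 \<in> ?G" using subspace_0[OF subD] N_scale[of 0 0] by (auto simp: image_iff zero_prod_def)
  next
    fix p q assume "p \<in> ?G" "q \<in> ?G"
    then obtain x y where "p = (x, N x)" "q = (y, N y)" "x \<in> D" "y \<in> D" by auto
    then show "p + q \<in> ?G"
      using subspace_add[OF subD, of x y] by (intro image_eqI[of _ _ "x + y"]) (auto simp: N_add)
  next
    fix c p assume "p \<in> ?G"
    then obtain x where "p = (x, N x)" "x \<in> D" by auto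
    then show "c *\<^sub>R p \<in> ?G"
      using subspace_scale[OF subD, of x c] by (intro image_eqI[of _ _ "c *\<^sub>R x"]) (auto simp: N_scale)
  qed
  from proj_exists[OF sub closed_graph, of "(h, 0)"]
  obtain x where x: "x \<in> D" and orth: "\<And>y. y \<in> D \<Longrightarrow> ((h, 0) - (x, N x)) \<bullet> (y, N y) = 0" by auto
  have "N x \<bullet> N y = (h - x) \<bullet> y" if "y \<in> D" for y
    using orth[OF that] by (simp add: inner_diff_left)
  from N'I[OF this] have "N x \<in> D'" "N' (N x) = h - x" by auto
  then show ?thesis using x by (intro bexI[of _ x]) (auto simp: D1_def)
qed

lemma D1_zero: "x \<in> D1 \<Longrightarrow> x + N' (N x) = 0 \<Longrightarrow> x = 0"
proof -
  assume x: "x \<in> D1" "x + N' (N x) = 0"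
  then have "(x + N' (N x)) \<bullet> x = 0" by simp
  then have "x \<bullet> x + N x \<bullet> N x = 0" using D1_inner[OF x(1), of x] x(1) by (simp add: D1_def inner_add_left)
  then have "x \<bullet> x = 0" using inner_ge_zero[of "N x"] inner_ge_zero[of x] by linarith
  then show ?thesis by simp
qed

text \<open>The resolvent \<open>(1 + N* N)^-1\<close>: bounded and positive although
  \<open>N\<close> need not be bounded, and small where \<open>N\<close> is large.\<close>

definition T where "T h = (SOME x. x \<in> D1 \<and> x + N' (N x) = h)"

lemma T: "T h \<in> D1" "T h + N' (N (T h)) = h"
proof -
  have "\<exists>x. x \<in> D1 \<and> x + N' (N x) = h" using resolvent_exists by blast
  from someI_ex[OF this] show "T h \<in> D1" "T h + N' (N (T h)) = h" unfolding T_def by auto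
qed

lemma T_unique: "x \<in> D1 \<Longrightarrow> x + N' (N x) = h \<Longrightarrow> T h = x"
proof -
  assume x: "x \<in> D1" "x + N' (N x) = h"
  have "T h + (- 1) *\<^sub>R x = 0"
  proof (rule D1_zero)
    have m: "(- 1) *\<^sub>R x \<in> D1" "N' (N ((- 1) *\<^sub>R x)) = (- 1) *\<^sub>R N' (N x)" using D1_lin[OF x(1) x(1)] by blast+
    show "T h + (- 1) *\<^sub>R x \<in> D1" using D1_lin(1)[OF T(1) m(1)] .
    have "N' (N (T h + (- 1) *\<^sub>R x)) = N' (N (T h)) - N' (N x)"
      using D1_lin(2)[OF T(1) m(1)] m(2) by simp
    then have "T h + (- 1) *\<^sub>R x + N' (N (T h + (- 1) *\<^sub>R x)) = (T h + N' (N (T h))) - (x + N' (N x))"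
      by simp
    then show "T h + (- 1) *\<^sub>R x + N' (N (T h + (- 1) *\<^sub>R x)) = 0"
      unfolding T(2) x(2) by simp
  qed
  then show ?thesis by simp
qed

lemma T_D: "T h \<in> D" "T h \<in> D'" "N (T h) \<in> D'" "N' (T h) \<in> D"
  using T(1)[of h] D1_D'[OF T(1)[of h]] by (auto simp: D1_def)

lemma T_inner: "T h \<bullet> h' = T h \<bullet> T h' + N (T h) \<bullet> N (T h')"
proof -
  have "T h \<bullet> h' = T h \<bullet> T h' + T h \<bullet> N' (N (T h'))" by (metis T(2) inner_add_right)
  also have "T h \<bullet> N' (N (T h')) = N (T h) \<bullet> N (T h')"
    using D1_inner[OF T(1) T_D(1)] by (simp add: inner_commute)
  finally show ?thesis .
qed

lemma norm_T: "norm (T h) \<le> norm h" "norm (N (T h)) \<le> norm h"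
proof -
  have e: "(norm (T h))\<^sup>2 + (norm (N (T h)))\<^sup>2 = T h \<bullet> h"
    using T_inner[of h h] by (simp add: power2_norm_eq_inner)
  have c: "T h \<bullet> h \<le> norm (T h) * norm h" by (rule norm_cauchy_schwarz)
  have "norm (T h) * norm (T h) \<le> norm (T h) * norm h"
    using e c zero_le_square[of "norm (N (T h))"] unfolding power2_eq_square by linarith
  then show t: "norm (T h) \<le> norm h" by (cases "T h = 0") auto
  have "norm (T h) * norm h \<le> norm h * norm h" using t by (intro mult_right_mono) auto
  then have "(norm (N (T h)))\<^sup>2 \<le> (norm h)\<^sup>2"
    using e c zero_le_power2[of "norm (T h)"] unfolding power2_eq_square[of "norm h"] by linarith
  then show "norm (N (T h)) \<le> norm h" by (rule power2_le_imp_le) simp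
qed

lemma T_lin: "T (x + y) = T x + T y" "T (r *\<^sub>R x) = r *\<^sub>R T x"
proof -
  note l = D1_lin[OF T(1) T(1)]
  show "T (x + y) = T x + T y"
    using T(2)[of x] T(2)[of y] by (intro T_unique l) (simp add: l algebra_simps)
  show "T (r *\<^sub>R x) = r *\<^sub>R T x"
    using T(2)[of x] by (intro T_unique l) (simp add: l flip: scaleR_add_right)
qed

lemma adj_T: "adj T T"
proof -
  have "bounded_linear T" using T_lin norm_T by (intro bounded_linear_intro[where K = 1]) auto
  moreover have "T x \<bullet> y = x \<bullet> T y" for x y
    using T_inner[of x y] T_inner[of y x] by (simp add: inner_commute)
  ultimately show ?thesis by (simp add: adj_def)
qed

lemma T_pos: "0 \<le> T h \<bullet> h"
  using T_inner[of h h] by simp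

lemma T_skew:
  assumes K: "adj K (\<lambda>x. - K x)" "\<And>x. x \<in> D \<Longrightarrow> K x \<in> D" "\<And>x. x \<in> D \<Longrightarrow> N (K x) = K (N x)"
  shows "T (K h) = K (T h)"
proof (rule T_unique)
  have n: "K (N (T h)) \<in> D'" "N' (K (N (T h))) = K (N' (N (T h)))"
    using N'_skew[OF K T_D(3)] by blast+
  show "K (T h) \<in> D1" using n K(2,3)[OF T_D(1)] by (simp add: D1_def)
  show "K (T h) + N' (N (K (T h))) = K h"
    using n K(3)[OF T_D(1)] T(2)[of h] adj_bl(1)[OF K(1)] by (metis bounded_linear_linear_rules(1))
qed

text \<open>The vector \<open>N' (N (T x)) = x - T x\<close> lies in \<open>D\<close>, so the
  equality of domains in normality puts \<open>N (T x)\<close> into \<open>D1\<close>. Normality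
  then yields \<open>N' N (N T x) = N N' (N T x) = N x - N (T x)\<close>, which is the equation
  characterizing \<open>T (N x)\<close>.\<close>

lemma T_N: "x \<in> D \<Longrightarrow> T (N x) = N (T x)"
proof (rule T_unique)
  assume x: "x \<in> D"
  have d: "N' (N (T x)) = x - T x" using T(2)[of x] by (simp add: algebra_simps)
  have "N' (N (T x)) \<in> D" unfolding d using x T_D(1) subD by (simp add: subspace_diff)
  then have "N (T x) \<in> {y \<in> D'. N' y \<in> D}" using T_D by simp
  then have D1: "N (T x) \<in> D1" unfolding normal_dom D1_def .
  then show "N (T x) \<in> D1" .
  have "N' (N (N (T x))) = N (N' (N (T x)))" using D1 by (intro normal_eq[symmetric]) (auto simp: D1_def)
  also have "\<dots> = N x - N (T x)"
    unfolding d using x T_D(1)[of x] N_add[of x "- T x"] N_minus subspace_neg[OF subD] by simp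
  finally show "N (T x) + N' (N (N (T x))) = N x" by simp
qed

lemma norm_N': "x \<in> D1 \<Longrightarrow> norm (N' x) = norm (N x)"
proof -
  assume x: "x \<in> D1"
  then have "N' x \<bullet> N' x = x \<bullet> N (N' x)" using N'[of x "N' x"] D1_D' by simp
  also have "\<dots> = N x \<bullet> N x"
    using x normal_eq[of x] D1_inner[OF x, of x] by (simp add: D1_def inner_commute)
  finally show ?thesis by (simp add: norm_eq_sqrt_inner)
qed

text \<open>Writing \<open>k\<close> as \<open>T k + N' (N (T k))\<close> makes every vector
  involved lie in the required domains; normality exchanges \<open>N\<close> and \<open>N'\<close>
  in the second term.\<close>

lemma adj_NT: "adj (\<lambda>h. N (T h)) (\<lambda>h. N' (T h))"
  unfolding adj_def
proof (intro conjI allI)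
  show "bounded_linear (\<lambda>h. N (T h))"
    using norm_T T_D by (intro bounded_linear_intro[where K = 1]) (auto simp: T_lin N_add N_scale)
  show "bounded_linear (\<lambda>h. N' (T h))"
    using norm_T T_D norm_N'[OF T(1)] N'_add N'_scale
    by (intro bounded_linear_intro[where K = 1]) (auto simp: T_lin)
  fix h k
  have "N (T h) \<bullet> k = N (T h) \<bullet> T k + N (T h) \<bullet> N' (N (T k))" by (metis T(2) inner_add_right)
  also have "N (T h) \<bullet> T k = T h \<bullet> N' (T k)"
    using N'[OF T_D(2)[of k] T_D(1)[of h]] by (simp add: inner_commute)
  also have "N (T h) \<bullet> N' (N (T k)) = N' (N (T h)) \<bullet> N' (T k)"
    using normal_eq[OF T_D(1,3), of k] N'[OF T_D(3,4), of h k] by simp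
  also have "T h \<bullet> N' (T k) + N' (N (T h)) \<bullet> N' (T k) = h \<bullet> N' (T k)"
    by (metis T(2) inner_add_left)
  finally show "N (T h) \<bullet> k = h \<bullet> N' (T k)" .
qed

lemma T_S: "T (N (T h)) = N (T (T h))" "T (N' (T h)) = N' (T (T h))"
proof -
  show 1: "T (N (T h)) = N (T (T h))" for h by (rule T_N[OF T_D(1)])
  show "T (N' (T h)) = N' (T (T h))" by (rule adj_intertwine[OF adj_T adj_T adj_NT]) (rule 1)
qed

text \<open>Where \<open>T\<close> is at most \<open>d\<close>, a unit vector has
  \<open>norm (N x)\<close> at least the root of \<open>1/d - 1\<close>, which exceeds that of
  \<open>\<rho>^2 + 1\<close>. On a band where \<open>T\<close> is also bounded below,
  \<open>N\<close> is bounded and has an approximate eigenvalue, which \<open>spec\<close> confines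
  to the disc of radius \<open>\<rho>\<close>: a contradiction.\<close>

lemma growth_T_trivial:
  assumes d: "d > 0" "d * (\<rho>\<^sup>2 + 1) < 1 - d" and z: "z \<in> growth T d"
  shows "z = 0"
proof (rule ccontr)
  assume z0: "z \<noteq> 0"
  \<comment> \<open>If \<open>z\<close> belonged to all smaller growth subspaces, then
    \<open>T z\<close> would be 0, and \<open>T\<close> is injective.\<close>
  have "\<exists>d'. 0 < d' \<and> d' < d \<and> z \<notin> growth T d'"
  proof (rule ccontr)
    assume *: "\<not> ?thesis"
    have "norm (T z) \<le> 0 + e" if "e > 0" for e
    proof -
      define d' where "d' = min (d / 2) (e / norm z)"
      have d': "0 < d'" "d' < d" "d' * norm z \<le> e"
        using d that z0 by (auto simp: d'_def min_def field_simps)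
      then have "norm (T z) \<le> d' * norm z" using * growth_norm_le[OF adj_T] by blast
      then show ?thesis using d' by simp
    qed
    then have "norm (T z) \<le> 0" by (rule field_le_epsilon)
    then have "T z = 0" by simp
    moreover have "N 0 = 0" using N_scale[OF subspace_0[OF subD], of 0] by simp
    moreover have "N' 0 = 0" using N'_scale[OF T_D(2), of 0] by simp
    ultimately show False using T(2)[of z] z0 by simp
  qed
  then obtain d' where d': "0 < d'" "d' < d" "z \<notin> growth T d'" by blast
  \<comment> \<open>The spectral band of \<open>T\<close> between \<open>d'\<close> and
    \<open>d\<close>. Its lower edge bounds \<open>N\<close> on \<open>W\<close> by
    \<open>1 / d'\<close>.\<close>
  define W where "W = growth T d \<inter> ortho (growth T d')"
  note sc = subspace_closed_growth[OF adj_T]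
  have W: "subspace W" "closed W"
    unfolding W_def
    by (rule subspace_inter[OF sc(1)[OF d(1)] subspace_ortho], rule closed_Int[OF sc(2)[OF d(1)] closed_ortho])
  define w where "w = z - proj (growth T d') z"
  have pin: "proj (growth T d') z \<in> growth T d'" using proj_in[OF sc] d' by blast
  have w: "w \<in> W" "w \<noteq> 0"
  proof -
    have "w \<in> growth T d" unfolding w_def
      using pin growth_mono[of d' d T] d d' z by (intro subspace_diff sc) auto
    moreover have "w \<in> ortho (growth T d')"
      unfolding w_def ortho_def using proj_orth[OF sc] d' by blast
    ultimately show "w \<in> W" by (simp add: W_def)
    show "w \<noteq> 0" using pin d'(3) by (auto simp: w_def)
  qed
  have inv: "C x \<in> W" if "adj C C'" "\<And>x. T (C x) = C (T x)" "x \<in> W" for C C' x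
  proof -
    have c: "T (C' x) = C' (T x)" for x
      by (rule adj_intertwine[OF adj_T adj_T that(1)]) (rule that(2))
    have x: "x \<in> growth T d" "x \<in> ortho (growth T d')" using that(3) by (simp_all add: W_def)
    have "C' y \<in> growth T d'" if "y \<in> growth T d'" for y
      by (rule growth_intertwine[OF adj_bl(2)[OF \<open>adj C C'\<close>] _ that]) (rule c)
    from ortho_intertwine[OF that(1) this x(2)] have "C x \<in> ortho (growth T d')" .
    moreover have "C x \<in> growth T d"
      by (rule growth_intertwine[OF adj_bl(1)[OF that(1)] _ x(1)]) (rule that(2))
    ultimately show ?thesis by (simp add: W_def)
  qed
  have WT: "T x \<in> W" if "x \<in> W" for x by (rule inv[OF adj_T _ that]) simp
  have lower: "d' * norm x \<le> norm (T x)" if "x \<in> W" for x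
    using growth_perp[OF adj_T d'(1)] that by (simp add: W_def)
  have surj: "\<exists>h\<in>W. T h = x" if "x \<in> W" for x
    by (rule selfadj_surj[OF adj_T W WT d'(1) lower that])
  have WN: "N x \<in> W" "N' x \<in> W" "x \<in> D1" "norm (N x) \<le> norm x * (1 / d')" if x: "x \<in> W" for x
  proof -
    obtain h where h: "h \<in> W" "T h = x" using surj[OF x] by blast
    show "x \<in> D1" using T(1)[of h] h by simp
    have "N (T h) \<in> W" by (rule inv[OF adj_NT _ h(1)]) (rule T_S(1))
    then show "N x \<in> W" using h by simp
    have "N' (T h) \<in> W" by (rule inv[OF adj_sym[OF adj_NT] _ h(1)]) (rule T_S(2))
    then show "N' x \<in> W" using h by simp
    have "norm (N x) \<le> norm h" using norm_T(2)[of h] h by simp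
    also have "\<dots> \<le> norm x * (1 / d')" using lower[OF h(1)] h(2) d'(1) by (simp add: field_simps)
    finally show "norm (N x) \<le> norm x * (1 / d')" .
  qed
  define P where "P = proj W"
  note PW = proj_in[OF W, folded P_def] and Pid = proj_id[OF W, folded P_def]
  have P: "orthproj P" unfolding P_def by (rule orthproj_proj[OF W])
  note P_lin = bounded_linear_linear_rules[OF adj_bl(1)[OF orthproj_adj[OF P]]]
  have PD: "P x \<in> D" "P x \<in> D'" for x
    using WN(3)[OF PW[of x]] D1_D'[OF WN(3)[OF PW[of x]]] by (simp_all add: D1_def)
  have nP: "norm (P x) \<le> norm x" for x
  proof -
    have "(norm (P x))\<^sup>2 \<le> norm x * norm (P x)"
      using P norm_cauchy_schwarz[of x "P x"] unfolding orthproj_def power2_norm_eq_inner by metis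
    then show ?thesis by (cases "P x = 0") (auto simp: power2_eq_square)
  qed
  have nNP: "norm (N (P x)) \<le> norm x * (1 / d')" for x
  proof -
    have "norm (P x) * (1 / d') \<le> norm x * (1 / d')" using nP d'(1) by (intro mult_right_mono) auto
    then show ?thesis using WN(4)[OF PW[of x]] by linarith
  qed
  have blNP: "bounded_linear (\<lambda>x. N (P x))"
    using PD nNP by (intro bounded_linear_intro[where K = "1 / d'"]) (auto simp: P_lin N_add N_scale)
  have blN'P: "bounded_linear (\<lambda>x. N' (P x))"
    using PD nNP N'_add N'_scale norm_N'[OF WN(3)[OF PW]]
    by (intro bounded_linear_intro[where K = "1 / d'"]) (auto simp: P_lin)
  have adjNP: "adj (\<lambda>x. N (P x)) (\<lambda>x. N' (P x))"
    unfolding adj_def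
  proof (intro conjI allI blNP blN'P)
    fix x y
    have sP: "P x \<bullet> y = x \<bullet> P y" for x y using P by (simp add: orthproj_def)
    have "N (P x) \<bullet> y = N (P x) \<bullet> P y" using sP[of "N (P x)" y] Pid[OF WN(1)[OF PW]] by simp
    also have "\<dots> = P x \<bullet> N' (P y)" using N'[OF PD(2)[of y] PD(1)[of x]] by (simp add: inner_commute)
    also have "\<dots> = x \<bullet> N' (P y)" using sP[of x "N' (P y)"] Pid[OF WN(2)[OF PW]] by simp
    finally show "N (P x) \<bullet> y = x \<bullet> N' (P y)" .
  qed
  have PK: "P (K x) = K (P x)"
    if K: "adj K (\<lambda>x. - K x)" "\<And>x. x \<in> D \<Longrightarrow> K x \<in> D" "\<And>x. x \<in> D \<Longrightarrow> N (K x) = K (N x)" for K x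
    unfolding P_def
  proof (rule proj_intertwine[OF W W K(1)])
    show "K y \<in> W" if "y \<in> W" for y by (rule inv[OF K(1) _ that]) (rule T_skew[OF K])
    then show "- K y \<in> W" if "y \<in> W" for y using that subspace_neg[OF W(1)] by blast
  qed
  \<comment> \<open>Composing with the projection extends \<open>N\<close> from the band to a
    bounded normal operator on the whole space.\<close>
  interpret q: quat_normal "\<lambda>x. N (P x)" "\<lambda>x. N' (P x)" I J
  proof unfold_locales
    fix x
    have "N (N' (P x)) = N' (N (P x))" using normal_eq[of "P x"] WN(3)[OF PW[of x]] by (simp add: D1_def)
    then show "N (P (N' (P x))) = N' (P (N (P x)))" using Pid WN PW by simp
    have "P (I x) = I (P x)" "P (J x) = J (P x)" by (rule PK[OF adjI NI] PK[OF adjJ NJ]; assumption)+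
    then show "N (P (I x)) = I (N (P x))" "N (P (J x)) = J (N (P x))"
      using NI(2) NJ(2) PD(1) by simp_all
  qed (fact adjNP adjI adjJ II JJ IJ)+
  have comP: "q.commutes P"
    unfolding q.commutes_def
  proof (intro conjI allI)
    show "\<exists>C'. adj P C'" by (rule exI[of _ P]) (rule orthproj_adj[OF P])
    fix x
    show "N (P (P x)) = P (N (P x))" using orthproj_idem[OF P] Pid[OF WN(1)[OF PW]] by simp
    show "N' (P (P x)) = P (N' (P x))" using orthproj_idem[OF P] Pid[OF WN(2)[OF PW]] by simp
    show "I (P x) = P (I x)" by (rule PK[OF adjI NI, symmetric]; assumption)
  qed
  obtain a b where ab: "\<And>e. e > 0 \<Longrightarrow> \<exists>x. P x = x \<and> norm x = 1 \<and> norm (N (P x) - q.scal a b x) < e"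
    using q.approx_eigenvalue[OF P comP Pid[OF w(1)] w(2)] by blast
  define r where "r = sqrt (a\<^sup>2 + b\<^sup>2)"
  have r0: "r \<ge> 0" by (simp add: r_def)
  have "a\<^sup>2 + b\<^sup>2 \<le> \<rho>\<^sup>2"
  proof (rule spec)
    fix e :: real assume e: "e > 0"
    define k where "k = onorm (\<lambda>x. N (P x)) + r + 1"
    have k: "k > 0" using r0 onorm_pos_le[OF blNP] unfolding k_def by linarith
    then have "e / k > 0" using e by simp
    from ab[OF this] obtain x where x: "P x = x" "norm x = 1" "norm (N (P x) - q.scal a b x) < e / k" by blast
    have xW: "x \<in> W" using x(1) PW by metis
    let ?y = "N (P x) - q.scal a b x"
    have "norm (N (N x) - (2 * a) *\<^sub>R N x + (a\<^sup>2 + b\<^sup>2) *\<^sub>R x) \<le> (onorm (\<lambda>x. N (P x)) + r) * norm ?y"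
      using q.quadratic_bound[of x a b] Pid[OF WN(1)[OF xW]] by (simp add: r_def x(1))
    also have "\<dots> \<le> k * norm ?y" unfolding k_def by (intro mult_right_mono) auto
    also have "\<dots> < e" using x(3) k by (simp add: field_simps)
    finally show "\<exists>x\<in>D. N x \<in> D \<and> norm x = 1 \<and> norm (N (N x) - (2 * a) *\<^sub>R N x + (a\<^sup>2 + b\<^sup>2) *\<^sub>R x) < e"
      using xW WN(3)[OF xW] WN(3)[OF WN(1)[OF xW]] x(2) by (auto simp: D1_def)
  qed
  then have rr: "r \<le> \<rho>" unfolding r_def using rho by (metis real_sqrt_le_mono real_sqrt_abs abs_of_nonneg)
  \<comment> \<open>With this accuracy, an approximate eigenvalue of modulus at most
    \<open>\<rho>\<close> forces the squared norm of \<open>N x\<close> below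
    \<open>\<rho>^2 + 1\<close>.\<close>
  have "sqrt (\<rho>\<^sup>2 + 1) - \<rho> > 0" using rho real_less_rsqrt[of \<rho> "\<rho>\<^sup>2 + 1"] by simp
  from ab[OF this] obtain x where x: "P x = x" "norm x = 1" "norm (N (P x) - q.scal a b x) < sqrt (\<rho>\<^sup>2 + 1) - \<rho>" by blast
  have xW: "x \<in> W" using x(1) PW by metis
  have "norm (N x) \<le> norm (N (P x) - q.scal a b x) + norm (q.scal a b x)"
    using norm_triangle_ineq[of "N (P x) - q.scal a b x" "q.scal a b x"] x(1) by simp
  then have "norm (N x) < sqrt (\<rho>\<^sup>2 + 1)" using x rr by (simp add: q.norm_scal r_def)
  then have up: "(norm (N x))\<^sup>2 < \<rho>\<^sup>2 + 1"
    using real_sqrt_less_iff[of "(norm (N x))\<^sup>2" "\<rho>\<^sup>2 + 1"] by simp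
  obtain h where h: "h \<in> W" "T h = x" using surj[OF xW] by blast
  \<comment> \<open>For the unit vector \<open>x = T h\<close> this reads
    \<open>1 \<le> (x \<bullet> h) d\<close>, and \<open>x \<bullet> h\<close> equals 1 plus the
    squared norm of \<open>N x\<close>: a lower bound for \<open>N\<close> on the band.\<close>
  have "(T h \<bullet> T h)\<^sup>2 \<le> (T h \<bullet> h) * (T (T h) \<bullet> T h)"
    by (rule form_Cauchy_Schwarz[OF adj_T W(1) T_pos]) (use h xW in auto)
  also have "\<dots> \<le> (T h \<bullet> h) * d"
  proof (rule mult_left_mono)
    have "T (T h) \<bullet> T h \<le> norm (T (T h)) * norm (T h)" by (rule norm_cauchy_schwarz)
    also have "\<dots> \<le> d * norm (T h) * norm (T h)"
      using growth_norm_le[OF adj_T d(1)] xW h by (intro mult_right_mono) (auto simp: W_def)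
    finally show "T (T h) \<bullet> T h \<le> d" using h x by simp
  qed (rule T_pos)
  finally have "1 \<le> (x \<bullet> h) * d" using h x(2) by (simp add: power2_norm_eq_inner[symmetric])
  moreover have "x \<bullet> h = 1 + (norm (N x))\<^sup>2"
    using T_inner[of h h] h x(2) by (simp add: power2_norm_eq_inner[symmetric])
  ultimately have "1 \<le> d + d * (norm (N x))\<^sup>2" by (simp add: algebra_simps)
  moreover have "d * (norm (N x))\<^sup>2 \<le> d * (\<rho>\<^sup>2 + 1)" using up d by (intro mult_left_mono) auto
  ultimately show False using d(2) by linarith
qed

text \<open>Once the growth subspace of \<open>T\<close> for \<open>d\<close> is trivial,
  \<open>T\<close> is bounded below by \<open>d\<close>, hence surjective, and every vector lies in
  its range \<open>D1\<close>.\<close>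

theorem everywhere_bounded:
  shows "D = UNIV" "D' = UNIV" "adj N N'" "N (N' x) = N' (N x)"
proof -
  \<comment> \<open>Chosen so that \<open>d (\<rho>^2 + 1) = 1 - 2 d\<close>.\<close>
  define d where "d = 1 / (\<rho>\<^sup>2 + 3)"
  have d: "d > 0" "d * (\<rho>\<^sup>2 + 1) < 1 - d"
  proof -
    have p: "\<rho>\<^sup>2 + 3 > 0" using zero_le_power2[of \<rho>] by linarith
    then show "d > 0" by (simp add: d_def)
    have "d * (\<rho>\<^sup>2 + 3) = 1" using p by (simp add: d_def)
    then have "d * (\<rho>\<^sup>2 + 1) = 1 - 2 * d" by (simp add: algebra_simps)
    then show "d * (\<rho>\<^sup>2 + 1) < 1 - d" using \<open>d > 0\<close> by linarith
  qed
  have lower: "d * norm x \<le> norm (T x)" for x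
  proof (rule growth_perp[OF adj_T d(1)])
    show "x \<in> ortho (growth T d)" unfolding ortho_def using growth_T_trivial[OF d] inner_zero_right by blast
  qed
  have surj: "\<exists>h. T h = x" for x
    using selfadj_surj[OF adj_T subspace_UNIV closed_UNIV _ d(1) lower, of x] by auto
  show D: "D = UNIV" "D' = UNIV" using T_D surj by (metis UNIV_eq_I)+
  have D1: "x \<in> D1" for x unfolding D1_def using D by auto
  have b: "norm (N x) \<le> norm x * (1 / d)" for x
  proof -
    obtain h where h: "T h = x" using surj by blast
    have "norm (N x) \<le> norm h" using norm_T(2)[of h] h by simp
    also have "\<dots> \<le> norm x * (1 / d)" using lower[of h] h d(1) by (simp add: field_simps)
    finally show ?thesis .
  qed
  have "bounded_linear N" using b by (intro bounded_linear_intro[where K = "1 / d"]) (auto simp: D N_add N_scale)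
  moreover have "bounded_linear N'"
    using b norm_N'[OF D1] N'_add N'_scale by (intro bounded_linear_intro[where K = "1 / d"]) (auto simp: D)
  ultimately show "adj N N'" using N' by (simp add: adj_def D inner_commute)
  show "N (N' x) = N' (N x)" using normal_eq D by simp
qed

end

section \<open>Quaternions and square-summable quaternion sequences\<close>

lemma quat_inner: "(a1, b1, c1, d1) \<bullet> (a2, b2, c2, d2 :: real) = a1 * a2 + b1 * b2 + c1 * c2 + (d1 * d2 :: real)"
  by simp

lemma quat_norm2: "(norm (a, b, c, d :: real))\<^sup>2 = a\<^sup>2 + b\<^sup>2 + c\<^sup>2 + (d :: real)\<^sup>2"
  unfolding power2_norm_eq_inner quat_inner by (simp add: power2_eq_square)

lemma qmul_assoc: "qmul (qmul p q) r = qmul p (qmul q r)"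
  by (cases p; cases q; cases r) (simp add: qmul_def algebra_simps)

lemma qmul_add: "qmul (p + q) r = qmul p r + qmul q r" "qmul p (q + r) = qmul p q + qmul p r"
  by (cases p; cases q; cases r; simp add: qmul_def algebra_simps)+

lemma qmul_scaleR: "qmul (t *\<^sub>R p) q = t *\<^sub>R qmul p q" "qmul p (t *\<^sub>R q) = t *\<^sub>R qmul p q"
  by (cases p; cases q; simp add: qmul_def algebra_simps)+

lemma qmul_of_real: "qmul p (qof_real t) = t *\<^sub>R p"
  by (cases p) (simp add: qmul_def qof_real_def mult.commute)

lemma qmul_one: "qmul p qone = p"
  by (simp add: qone_def qmul_of_real)

lemma norm_qmul: "norm (qmul p q) = norm p * norm q"
proof -
  have "(norm (qmul p q))\<^sup>2 = (norm p * norm q)\<^sup>2"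
    by (cases p; cases q)
      (simp add: qmul_def quat_norm2 power_mult_distrib, simp add: power2_eq_square algebra_simps)
  then show ?thesis by (simp add: power2_eq_iff_nonneg)
qed

lemma norm_qcnj: "norm (qcnj p) = norm p"
proof -
  have "(norm (qcnj p))\<^sup>2 = (norm p)\<^sup>2" by (cases p) (simp add: qcnj_def quat_norm2)
  then show ?thesis by (simp add: power2_eq_iff_nonneg)
qed

lemma qmul_inner: "qmul p q \<bullet> r = p \<bullet> qmul r (qcnj q)"
  by (cases p; cases q; cases r) (simp add: qmul_def qcnj_def algebra_simps)

lemma qcnj_qmul_inner: "qmul (qcnj p) q \<bullet> r = q \<bullet> qmul p r"
  by (cases p; cases q; cases r) (simp add: qmul_def qcnj_def algebra_simps)

lemma sphS_cases:
  assumes "m \<in> sphS"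
  obtains b c d where "m = (0, b, c, d)" "b\<^sup>2 + c\<^sup>2 + d\<^sup>2 = 1"
proof (cases m)
  case (fields a b c d)
  have "a = 0" "norm m = 1" using assms by (auto simp: sphS_def fields qcnj_def)
  then show thesis using that[of b c d] quat_norm2[of a b c d] by (simp add: fields)
qed

text \<open>Imaginary quaternions that are orthogonal as vectors of three-space anticommute, so any
  unit vector perpendicular to \<open>m\<close> serves.\<close>

lemma sphS_anticommuting:
  assumes "m \<in> sphS"
  obtains j where "j \<in> sphS" "qmul j m = - qmul m j"
proof -
  obtain b c d where m: "m = (0, b, c, d)" and n: "b\<^sup>2 + c\<^sup>2 + d\<^sup>2 = 1" by (rule sphS_cases[OF assms])
  have "\<exists>x y z. b * x + c * y + d * z = 0 \<and> x\<^sup>2 + y\<^sup>2 + z\<^sup>2 = (1::real)"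
  proof (cases "b = 0 \<and> c = 0")
    case True
    then show ?thesis by (intro exI[of _ 1] exI[of _ 0]) auto
  next
    case False
    define r where "r = sqrt (b\<^sup>2 + c\<^sup>2)"
    have "r\<^sup>2 = b\<^sup>2 + c\<^sup>2" "r \<noteq> 0" using False by (auto simp: r_def sum_power2_eq_zero_iff)
    then have "(b\<^sup>2 + c\<^sup>2) / r\<^sup>2 = 1" by (metis div_self power_not_zero)
    then have "b * (- c / r) + c * (b / r) + d * 0 = 0 \<and> (- c / r)\<^sup>2 + (b / r)\<^sup>2 + 0\<^sup>2 = 1"
      by (simp add: power_divide add_divide_distrib)
    then show ?thesis by blast
  qed
  then obtain x y z where o: "b * x + c * y + d * z = 0" and u: "x\<^sup>2 + y\<^sup>2 + z\<^sup>2 = (1::real)" by blast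
  have "norm (0::real, x, y, z) = 1"
    using quat_norm2[of 0 x y z] u by (simp add: power2_eq_1_iff) (metis norm_ge_zero not_one_le_zero neg_0_le_iff_le order_trans zero_le_one)
  then have "(0, x, y, z) \<in> sphS" by (simp add: sphS_def qcnj_def)
  moreover have "qmul (0, x, y, z) m = - qmul m (0, x, y, z)"
    using o by (simp add: qmul_def m algebra_simps)
  ultimately show thesis using that by blast
qed

lemma sphS_facts:
  assumes "m \<in> sphS"
  shows "qcnj m = - m" "norm m = 1" "qmul m m = - qone" "qone \<bullet> m = 0"
proof -
  show "qcnj m = - m" "norm m = 1" using assms by (auto simp: sphS_def)
  obtain b c d where m: "m = (0, b, c, d)" "b\<^sup>2 + c\<^sup>2 + d\<^sup>2 = 1" by (rule sphS_cases[OF assms])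
  then show "qmul m m = - qone" "qone \<bullet> m = 0"
    by (simp_all add: qmul_def qone_def qof_real_def power2_eq_square)
qed

lemma norm_qof_real_add:
  assumes "m \<in> sphS"
  shows "norm (qof_real a + b *\<^sub>R m) = sqrt (a\<^sup>2 + b\<^sup>2)"
proof -
  obtain b' c d where m: "m = (0, b', c, d)" "b'\<^sup>2 + c\<^sup>2 + d\<^sup>2 = 1" by (rule sphS_cases[OF assms])
  have "(norm (qof_real a + b *\<^sub>R m))\<^sup>2 = a\<^sup>2 + b\<^sup>2 * (b'\<^sup>2 + c\<^sup>2 + d\<^sup>2)"
    by (simp add: qof_real_def m(1) quat_norm2 power_mult_distrib algebra_simps)
  then show ?thesis using m(2) by (metis mult.right_neutral norm_ge_zero real_sqrt_abs abs_of_nonneg)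
qed

text \<open>Otherwise \<open>1\<close>, \<open>m\<close>, \<open>j\<close>, \<open>j m\<close> and
  \<open>p\<close> would be five nonzero pairwise orthogonal vectors in a real space of dimension
  four.\<close>

lemma quat_basis:
  assumes m: "m \<in> sphS" and j: "j \<in> sphS" and mj: "qmul j m = - qmul m j"
    and z: "p \<bullet> qone = 0" "p \<bullet> m = 0" "p \<bullet> j = 0" "p \<bullet> qmul j m = 0"
  shows "p = 0"
proof (rule ccontr)
  assume p: "p \<noteq> 0"
  define S where "S = {qone, m, j, qmul j m, p}"
  note sm = sphS_facts[OF m] and sj = sphS_facts[OF j]
  have n1: "norm qone = 1" by (simp add: qone_def qof_real_def norm_Pair)
  have o: "m \<bullet> j = 0"
  proof -
    obtain b c d where m': "m = (0, b, c, d)" by (rule sphS_cases[OF m])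
    obtain b' c' d' where j': "j = (0, b', c', d')" by (rule sphS_cases[OF j])
    show ?thesis using mj by (simp add: m' j' qmul_def algebra_simps)
  qed
  have "qmul j m \<bullet> qone = - (j \<bullet> m)" "qmul j m \<bullet> m = j \<bullet> qone" "qmul j m \<bullet> j = - (m \<bullet> qone)"
  proof -
    obtain b c d where m': "m = (0, b, c, d)" "b\<^sup>2 + c\<^sup>2 + d\<^sup>2 = 1" by (rule sphS_cases[OF m])
    obtain b' c' d' where j': "j = (0, b', c', d')" by (rule sphS_cases[OF j])
    show "qmul j m \<bullet> qone = - (j \<bullet> m)" "qmul j m \<bullet> m = j \<bullet> qone" "qmul j m \<bullet> j = - (m \<bullet> qone)"
      by (simp_all add: m' j' qmul_def qone_def qof_real_def algebra_simps)
  qed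
  then have o4: "qmul j m \<bullet> qone = 0" "qmul j m \<bullet> m = 0" "qmul j m \<bullet> j = 0"
    using o sm(4) sj(4) by (simp_all add: inner_commute)
  have nz: "qone \<noteq> 0" "m \<noteq> 0" "j \<noteq> 0" "qmul j m \<noteq> 0"
    using n1 sm(2) sj(2) norm_qmul[of j m] by auto
  have pw: "pairwise orthogonal S" unfolding S_def pairwise_insert orthogonal_def
    using o o4 sm(4) sj(4) z by (auto simp: inner_commute pairwise_def)
  have "0 \<notin> S" using nz p by (auto simp: S_def)
  then have ind: "independent S" using pairwise_orthogonal_independent[OF pw] by blast
  have ne: "u \<noteq> v" if "u \<bullet> v = 0" "u \<noteq> 0" for u v :: quat using that by auto
  have "distinct [qone, m, j, qmul j m, p]"
    using nz p o o4 sm(4) sj(4) z by (auto dest!: ne simp: inner_commute)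
  then have "card S = 5" using distinct_card[of "[qone, m, j, qmul j m, p]"] by (simp add: S_def)
  moreover have "card S \<le> DIM(quat)" using independent_card_le[OF ind] .
  ultimately show False by simp
qed

section \<open>The real Hilbert space of square-summable quaternion sequences\<close>

typedef qh = l2H
  by (rule exI[of _ vzero]) (simp add: l2H_def vzero_def)

lemma summable_Rep: "summable (\<lambda>n. (norm (Rep_qh x n))\<^sup>2)"
  using Rep_qh[of x] by (simp add: l2H_def)

lemma l2H_add:
  assumes "x \<in> l2H" "y \<in> l2H"
  shows "(\<lambda>n. x n + y n) \<in> l2H"
proof -
  have s: "summable (\<lambda>n. 2 * (norm (x n))\<^sup>2 + 2 * (norm (y n))\<^sup>2)"
    using assms by (auto simp: l2H_def intro!: summable_add summable_mult)
  have "(norm (x n + y n))\<^sup>2 \<le> 2 * (norm (x n))\<^sup>2 + 2 * (norm (y n))\<^sup>2" for n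
  proof -
    have "(norm (x n + y n))\<^sup>2 + (norm (x n - y n))\<^sup>2 = 2 * (norm (x n))\<^sup>2 + 2 * (norm (y n))\<^sup>2"
      unfolding power2_norm_eq_inner by (simp add: algebra_simps inner_commute)
    then show ?thesis using zero_le_power2[of "norm (x n - y n)"] by linarith
  qed
  then show ?thesis unfolding l2H_def mem_Collect_eq
    by (intro summable_comparison_test'[OF s]) simp
qed

lemma l2H_mult:
  assumes "x \<in> l2H" "\<And>n. norm (y n) = c * norm (x n)"
  shows "y \<in> l2H"
  using assms by (simp add: l2H_def power_mult_distrib summable_mult)

lemma l2H_scaleR: "x \<in> l2H \<Longrightarrow> (\<lambda>n. t *\<^sub>R x n) \<in> l2H"
  by (rule l2H_mult[of x _ "\<bar>t\<bar>"]) auto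

lemma l2H_qmul: "x \<in> l2H \<Longrightarrow> (\<lambda>n. qmul (x n) q) \<in> l2H"
  by (rule l2H_mult[of x _ "norm q"]) (auto simp: norm_qmul)

lemma l2H_product_summable:
  assumes "x \<in> l2H" "y \<in> l2H"
  shows "summable (\<lambda>n. norm (x n) * norm (y n))"
proof (rule summable_comparison_test'[of "\<lambda>n. (norm (x n))\<^sup>2 + (norm (y n))\<^sup>2"])
  show "summable (\<lambda>n. (norm (x n))\<^sup>2 + (norm (y n))\<^sup>2)"
    using assms by (auto simp: l2H_def intro: summable_add)
  fix n :: nat
  have "0 \<le> (norm (x n) - norm (y n))\<^sup>2" "0 \<le> norm (x n) * norm (y n)" by simp_all
  then have "norm (x n) * norm (y n) \<le> (norm (x n))\<^sup>2 + (norm (y n))\<^sup>2"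
    unfolding power2_diff by linarith
  then show "norm (norm (x n) * norm (y n)) \<le> (norm (x n))\<^sup>2 + (norm (y n))\<^sup>2" by simp
qed

lemma l2H_inner_summable:
  assumes "x \<in> l2H" "y \<in> l2H"
  shows "summable (\<lambda>n. x n \<bullet> y n)"
  by (rule summable_comparison_test'[OF l2H_product_summable[OF assms]]) (simp add: Cauchy_Schwarz_ineq2)

instantiation qh :: real_inner
begin

definition "0 = Abs_qh (\<lambda>n. 0)"
definition "x + y = Abs_qh (\<lambda>n. Rep_qh x n + Rep_qh y n)"
definition "- x = Abs_qh (\<lambda>n. (- 1) *\<^sub>R Rep_qh x n)"
definition "x - y = x + (- y :: qh)"
definition "t *\<^sub>R x = Abs_qh (\<lambda>n. t *\<^sub>R Rep_qh x n)"
text \<open>The real part of the quaternionic inner product, since the real part of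
  \<open>qmul (qcnj p) q\<close> is the Euclidean product of \<open>p\<close> and
  \<open>q\<close>.\<close>

definition "x \<bullet> y = (\<Sum>n. Rep_qh x n \<bullet> Rep_qh y n)"
definition "norm (x :: qh) = sqrt (x \<bullet> x)"
definition "dist (x :: qh) y = norm (x - y)"
definition "sgn (x :: qh) = inverse (norm x) *\<^sub>R x"
definition "(uniformity :: (qh \<times> qh) filter) = (INF e\<in>{0<..}. principal {(x, y). dist x y < e})"
definition "open (U :: qh set) \<longleftrightarrow> (\<forall>x\<in>U. \<forall>\<^sub>F (x', y) in uniformity. x' = x \<longrightarrow> y \<in> U)"

lemma Rep_qh_simps:
  "Rep_qh 0 = (\<lambda>n. 0)" "Rep_qh (x + y) = (\<lambda>n. Rep_qh x n + Rep_qh y n)"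
  "Rep_qh (- x) = (\<lambda>n. - Rep_qh x n)" "Rep_qh (x - y) = (\<lambda>n. Rep_qh x n - Rep_qh y n)"
  "Rep_qh (t *\<^sub>R x) = (\<lambda>n. t *\<^sub>R Rep_qh x n)"
proof -
  show z: "Rep_qh 0 = (\<lambda>n. 0)" by (simp add: zero_qh_def Abs_qh_inverse l2H_def)
  show a: "Rep_qh (x + y) = (\<lambda>n. Rep_qh x n + Rep_qh y n)" for x y
    unfolding plus_qh_def by (rule Abs_qh_inverse[OF l2H_add[OF Rep_qh Rep_qh]])
  show s: "Rep_qh (t *\<^sub>R x) = (\<lambda>n. t *\<^sub>R Rep_qh x n)" for t x
    unfolding scaleR_qh_def by (rule Abs_qh_inverse[OF l2H_scaleR[OF Rep_qh]])
  show m: "Rep_qh (- x) = (\<lambda>n. - Rep_qh x n)" for x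
    using Abs_qh_inverse[OF l2H_scaleR[OF Rep_qh, of "- 1" x]] by (simp add: uminus_qh_def)
  show "Rep_qh (x - y) = (\<lambda>n. Rep_qh x n - Rep_qh y n)"
    by (simp add: minus_qh_def a m)
qed

instance
proof
  fix x y z :: qh and s t :: real
  note R = Rep_qh_inject[symmetric] Rep_qh_simps fun_eq_iff
  show "x + y + z = x + (y + z)" "x + y = y + x" "0 + x = x" "- x + x = 0" "x - y = x + - y"
    "t *\<^sub>R (x + y) = t *\<^sub>R x + t *\<^sub>R y" "(s + t) *\<^sub>R x = s *\<^sub>R x + t *\<^sub>R x"
    "s *\<^sub>R t *\<^sub>R x = (s * t) *\<^sub>R x" "1 *\<^sub>R x = x"
    by (simp_all add: R algebra_simps)
  show "dist x y = norm (x - y)" "sgn x = inverse (norm x) *\<^sub>R x" "norm x = sqrt (x \<bullet> x)"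
    by (simp_all add: dist_qh_def sgn_qh_def norm_qh_def)
  show "uniformity = (INF e\<in>{0<..}. principal {(x, y). dist (x::qh) y < e})" by (rule uniformity_qh_def)
  show "open U \<longleftrightarrow> (\<forall>x\<in>U. \<forall>\<^sub>F (x', y) in uniformity. x' = x \<longrightarrow> y \<in> U)" for U :: "qh set"
    by (rule open_qh_def)
  note si = l2H_inner_summable[OF Rep_qh Rep_qh]
  show "x \<bullet> y = y \<bullet> x" by (simp add: inner_qh_def inner_commute)
  show "(x + y) \<bullet> z = x \<bullet> z + y \<bullet> z"
    by (simp add: inner_qh_def Rep_qh_simps inner_add_left suminf_add[OF si si])
  show "t *\<^sub>R x \<bullet> y = t * (x \<bullet> y)"
    by (simp add: inner_qh_def Rep_qh_simps suminf_mult[OF si])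
  show "0 \<le> x \<bullet> x" unfolding inner_qh_def by (rule suminf_nonneg[OF si]) simp
  show "x \<bullet> x = 0 \<longleftrightarrow> x = 0"
    unfolding inner_qh_def by (subst suminf_eq_zero_iff[OF si]) (auto simp: R)
qed

end

lemma norm_qh: "(norm x)\<^sup>2 = (\<Sum>n. (norm (Rep_qh x n))\<^sup>2)"
  unfolding power2_norm_eq_inner inner_qh_def ..

lemma norm_qh_partial: "(\<Sum>n<k. (norm (Rep_qh x n))\<^sup>2) \<le> (norm x)\<^sup>2"
  unfolding norm_qh by (rule sum_le_suminf[OF summable_Rep]) auto

lemma norm_Rep_le: "norm (Rep_qh x n) \<le> norm x"
proof -
  have "(norm (Rep_qh x n))\<^sup>2 \<le> (\<Sum>k<Suc n. (norm (Rep_qh x k))\<^sup>2)"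
    by (rule member_le_sum) auto
  then have "(norm (Rep_qh x n))\<^sup>2 \<le> (norm x)\<^sup>2" using norm_qh_partial order_trans by blast
  then show ?thesis by (rule power2_le_imp_le) simp
qed

text \<open>Coordinates converge; bounds on finite partial sums survive the limit and give both
  membership of the limit in \<open>l2H\<close> and convergence in norm.\<close>

instance qh :: complete_space
proof
  fix X :: "nat \<Rightarrow> qh" assume X: "Cauchy X"
  have "Cauchy (\<lambda>i. Rep_qh (X i) n)" for n
  proof (rule CauchyI)
    fix e :: real assume "e > 0"
    from CauchyD[OF X this] obtain M where M: "\<And>i j. i \<ge> M \<Longrightarrow> j \<ge> M \<Longrightarrow> norm (X i - X j) < e" by blast
    have "norm (Rep_qh (X i) n - Rep_qh (X j) n) < e" if "i \<ge> M" "j \<ge> M" for i j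
      using norm_Rep_le[of "X i - X j" n] M[OF that] by (simp add: Rep_qh_simps)
    then show "\<exists>M. \<forall>i\<ge>M. \<forall>j\<ge>M. norm (Rep_qh (X i) n - Rep_qh (X j) n) < e" by blast
  qed
  then have "\<forall>n. \<exists>l. (\<lambda>i. Rep_qh (X i) n) \<longlonglongrightarrow> l" using Cauchy_convergent convergentD by blast
  then obtain l where l: "\<And>n. (\<lambda>i. Rep_qh (X i) n) \<longlonglongrightarrow> l n" by metis
  have key: "(\<Sum>n<k. (norm (Rep_qh (X i) n - l n))\<^sup>2) \<le> e\<^sup>2"
    if M: "\<And>i j. i \<ge> M \<Longrightarrow> j \<ge> M \<Longrightarrow> norm (X i - X j) < e" and i: "i \<ge> M" for M i e k
  proof (rule LIMSEQ_le_const2)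
    show "(\<lambda>j. \<Sum>n<k. (norm (Rep_qh (X i) n - Rep_qh (X j) n))\<^sup>2) \<longlonglongrightarrow> (\<Sum>n<k. (norm (Rep_qh (X i) n - l n))\<^sup>2)"
      by (intro tendsto_intros l)
    have "(\<Sum>n<k. (norm (Rep_qh (X i) n - Rep_qh (X j) n))\<^sup>2) \<le> e\<^sup>2" if "j \<ge> M" for j
    proof -
      have "(\<Sum>n<k. (norm (Rep_qh (X i) n - Rep_qh (X j) n))\<^sup>2) \<le> (norm (X i - X j))\<^sup>2"
        using norm_qh_partial[of "X i - X j" k] by (simp add: Rep_qh_simps)
      also have "\<dots> \<le> e\<^sup>2" using M[OF i that] by (intro power_mono) auto
      finally show ?thesis .
    qed
    then show "\<exists>N. \<forall>j\<ge>N. (\<Sum>n<k. (norm (Rep_qh (X i) n - Rep_qh (X j) n))\<^sup>2) \<le> e\<^sup>2" by blast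
  qed
  have diff_l2: "(\<lambda>n. Rep_qh (X i) n - l n) \<in> l2H"
    if "\<And>i j. i \<ge> M \<Longrightarrow> j \<ge> M \<Longrightarrow> norm (X i - X j) < e" "i \<ge> M" for M i e
    unfolding l2H_def mem_Collect_eq
    by (rule summableI_nonneg_bounded[where x = "e\<^sup>2"]) (use key[OF that] in auto)
  obtain M where M: "\<And>i j. i \<ge> M \<Longrightarrow> j \<ge> M \<Longrightarrow> norm (X i - X j) < 1" using CauchyD[OF X, of 1] by auto
  have "(\<lambda>n. Rep_qh (X M) n + (- 1) *\<^sub>R (Rep_qh (X M) n - l n)) \<in> l2H"
    by (intro l2H_add[OF Rep_qh l2H_scaleR[OF diff_l2[OF M order_refl]]])
  then have lH: "l \<in> l2H" by simp
  have "X \<longlonglongrightarrow> Abs_qh l"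
  proof (rule LIMSEQ_I)
    fix e :: real assume e: "e > 0"
    then have "e / 2 > 0" by simp
    from CauchyD[OF X this] obtain M where M: "\<And>i j. i \<ge> M \<Longrightarrow> j \<ge> M \<Longrightarrow> norm (X i - X j) < e / 2" by blast
    have "norm (X i - Abs_qh l) < e" if "i \<ge> M" for i
    proof -
      have r: "Rep_qh (X i - Abs_qh l) = (\<lambda>n. Rep_qh (X i) n - l n)"
        by (simp add: Rep_qh_simps Abs_qh_inverse[OF lH])
      have "(norm (X i - Abs_qh l))\<^sup>2 \<le> (e / 2)\<^sup>2"
        unfolding norm_qh r using diff_l2[OF M that] key[OF M that]
        by (intro suminf_le_const) (auto simp: l2H_def)
      then have "norm (X i - Abs_qh l) \<le> e / 2" using e by (metis power2_le_imp_le less_imp_le half_gt_zero)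
      then show ?thesis using e by simp
    qed
    then show "\<exists>M. \<forall>i\<ge>M. norm (X i - Abs_qh l) < e" by blast
  qed
  then show "convergent X" by (rule convergentI)
qed

instance qh :: banach ..

section \<open>Right scalar multiplication and quaternionic coefficients\<close>

definition rmul :: "qh \<Rightarrow> quat \<Rightarrow> qh" where
  "rmul x q = Abs_qh (vrmul (Rep_qh x) q)"

lemma Rep_rmul: "Rep_qh (rmul x q) = (\<lambda>n. qmul (Rep_qh x n) q)"
  unfolding rmul_def vrmul_def by (rule Abs_qh_inverse[OF l2H_qmul[OF Rep_qh]])

lemma Rep_links:
  "vadd (Rep_qh x) (Rep_qh y) = Rep_qh (x + y)" "vsub (Rep_qh x) (Rep_qh y) = Rep_qh (x - y)"
  "vrmul (Rep_qh x) q = Rep_qh (rmul x q)" "vzero = Rep_qh 0" "l2norm (Rep_qh x) = norm x"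
  by (simp_all add: vadd_def vsub_def vrmul_def vzero_def Rep_rmul Rep_qh_simps l2norm_def
      norm_qh_def inner_qh_def power2_norm_eq_inner)

lemma rmul_simps:
  "rmul (x + y) q = rmul x q + rmul y q" "rmul (x - y) q = rmul x q - rmul y q" "rmul (t *\<^sub>R x) q = t *\<^sub>R rmul x q"
  "rmul x (p + q) = rmul x p + rmul x q" "rmul x (t *\<^sub>R q) = t *\<^sub>R rmul x q" "rmul x qone = x"
  "rmul (rmul x p) q = rmul x (qmul p q)" "rmul x (- q) = - rmul x q" "rmul x (qof_real t) = t *\<^sub>R x"
proof -
  note R = Rep_qh_inject[symmetric] Rep_qh_simps fun_eq_iff Rep_rmul
  show a: "rmul (x + y) q = rmul x q + rmul y q" "rmul (t *\<^sub>R x) q = t *\<^sub>R rmul x q"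
    "rmul x (p + q) = rmul x p + rmul x q" and s: "rmul x (t *\<^sub>R q) = t *\<^sub>R rmul x q" and "rmul x qone = x"
    "rmul (rmul x p) q = rmul x (qmul p q)" "rmul x (qof_real t) = t *\<^sub>R x" for x y p q t
    by (simp_all add: R qmul_add qmul_scaleR qmul_one qmul_assoc qmul_of_real)
  show "rmul x (- q) = - rmul x q" using s[of x "-1" q] by simp
  show "rmul (x - y) q = rmul x q - rmul y q"
    using a(1)[of x "(-1) *\<^sub>R y" q] a(2)[of "-1" y q] by simp
qed

lemma norm_rmul: "norm (rmul x q) = norm x * norm q"
proof -
  have "(norm (rmul x q))\<^sup>2 = (norm x * norm q)\<^sup>2"
    unfolding power_mult_distrib norm_qh Rep_rmul norm_qmul
    by (rule suminf_mult2[symmetric]) (rule summable_Rep)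
  then show ?thesis by (simp add: power2_eq_iff_nonneg)
qed

lemma rmul_inner: "rmul x q \<bullet> y = x \<bullet> rmul y (qcnj q)"
  by (simp add: inner_qh_def Rep_rmul qmul_inner)

lemma rmul_inner_same: "rmul x p \<bullet> rmul x q = (norm x)\<^sup>2 * (p \<bullet> q)"
proof -
  have "qmul r p \<bullet> qmul r q = (norm r)\<^sup>2 * (p \<bullet> q)" for r
    unfolding power2_norm_eq_inner
    by (cases p; cases q; cases r) (simp add: qmul_def algebra_simps)
  then show ?thesis
    unfolding norm_qh inner_qh_def Rep_rmul by (simp add: suminf_mult2[OF summable_Rep])
qed

lemma bounded_linear_rmul: "bounded_linear (\<lambda>x. rmul x q)"
  by (rule bounded_linear_intro[where K = "norm q"]) (auto simp: rmul_simps norm_rmul)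

lemma adj_rmul: "adj (\<lambda>x. rmul x q) (\<lambda>x. rmul x (qcnj q))"
  by (simp add: adj_def bounded_linear_rmul rmul_inner)

definition coef :: "qh \<Rightarrow> qh \<Rightarrow> quat" where
  "coef x y = l2inner (Rep_qh x) (Rep_qh y)"

text \<open>Testing against all quaternions recovers the quaternionic inner product from the real
  one. Together with \<open>quat_eqI\<close> this reduces identities for \<open>coef\<close> to real
  inner products.\<close>

lemma coef_inner: "coef x y \<bullet> q = y \<bullet> rmul x q"
proof -
  have s: "summable (\<lambda>n. qmul (qcnj (Rep_qh x n)) (Rep_qh y n))"
    by (rule summable_comparison_test'[OF l2H_product_summable[OF Rep_qh[of x] Rep_qh[of y]]])
      (simp add: norm_qmul norm_qcnj)
  have "coef x y \<bullet> q = (\<Sum>n. qmul (qcnj (Rep_qh x n)) (Rep_qh y n) \<bullet> q)"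
    unfolding coef_def l2inner_def by (rule bounded_linear.suminf[OF bounded_linear_inner_left s])
  also have "\<dots> = y \<bullet> rmul x q"
    by (simp add: inner_qh_def Rep_rmul qcnj_qmul_inner)
  finally show ?thesis .
qed

lemma quat_eqI: "(\<And>q. p \<bullet> q = p' \<bullet> q) \<Longrightarrow> p = (p' :: quat)"
  using vector_eq_rdot by blast

lemma coef_simps: "coef x (y + z) = coef x y + coef x z" "coef x (y - z) = coef x y - coef x z"
  "coef x (rmul y q) = qmul (coef x y) q" "coef x 0 = 0"
proof -
  show "coef x (y + z) = coef x y + coef x z" "coef x (y - z) = coef x y - coef x z" "coef x 0 = 0"
    by (rule quat_eqI, simp add: coef_inner inner_add_left inner_diff_left)+
  show "coef x (rmul y q) = qmul (coef x y) q"
    by (rule quat_eqI) (simp only: qmul_inner coef_inner rmul_inner rmul_simps)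
qed

lemma coef_qcnj: "coef y x = qcnj (coef x y)"
proof -
  have "qcnj p \<bullet> q = p \<bullet> qcnj q" for p q by (cases p; cases q) (simp add: qcnj_def)
  moreover have "coef y x \<bullet> q = coef x y \<bullet> qcnj q" for q
    unfolding coef_inner using rmul_inner[of y q x] by (simp only: inner_commute)
  ultimately show "coef y x = qcnj (coef x y)" by (intro quat_eqI) simp
qed

lemma coef_self: "norm x = 1 \<Longrightarrow> coef x x = qone"
  using rmul_inner_same[of x qone] by (intro quat_eqI) (simp add: coef_inner rmul_simps)

text \<open>The partial expansion \<open>p\<close> has the same coefficients as \<open>x\<close>, so
  the squared norm of \<open>x - p\<close> is the difference of the two sides. If \<open>F\<close>
  is total, then \<open>x - p\<close>, having zero coefficients, vanishes.\<close>

lemma Bessel: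
  assumes F: "finite F" "\<And>v. v \<in> F \<Longrightarrow> norm v = 1" "\<And>v w. v \<in> F \<Longrightarrow> w \<in> F \<Longrightarrow> v \<noteq> w \<Longrightarrow> coef v w = 0"
  shows "(\<Sum>v\<in>F. (norm (coef v x))\<^sup>2) \<le> (norm x)\<^sup>2"
    and "(\<And>y. (\<And>v. v \<in> F \<Longrightarrow> coef v y = 0) \<Longrightarrow> y = 0) \<Longrightarrow> (\<Sum>v\<in>F. (norm (coef v x))\<^sup>2) = (norm x)\<^sup>2"
proof -
  define p where "p = (\<Sum>v\<in>F. rmul v (coef v x))"
  have cp: "coef w p = coef w x" if w: "w \<in> F" for w
  proof -
    have *: "coef w (\<Sum>v\<in>G. f v) = (\<Sum>v\<in>G. coef w (f v))" for G and f :: "qh \<Rightarrow> qh"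
      by (induction G rule: infinite_finite_induct) (auto simp: coef_simps)
    have "coef w p = (\<Sum>v\<in>F. qmul (coef w v) (coef v x))" unfolding p_def * by (simp add: coef_simps)
    also have "\<dots> = (\<Sum>v\<in>F. if v = w then coef w x else 0)"
    proof (rule sum.cong)
      fix v assume "v \<in> F"
      show "qmul (coef w v) (coef v x) = (if v = w then coef w x else 0)"
      proof (cases "v = w")
        case True
        have "qmul qone q = q" for q by (cases q) (simp add: qmul_def qone_def qof_real_def)
        then show ?thesis using True coef_self[OF F(2)[OF w]] by simp
      next
        case False
        have "qmul 0 q = 0" for q by (cases q) (simp add: qmul_def zero_prod_def)
        then show ?thesis using False F(3)[OF w \<open>v \<in> F\<close>] by simp
      qed
    qed simp
    finally show ?thesis using w F(1) by simp
  qed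
  have ip: "y \<bullet> p = (\<Sum>v\<in>F. coef v y \<bullet> coef v x)" for y
    unfolding p_def inner_sum_right by (simp add: coef_inner)
  have pp: "p \<bullet> p = (\<Sum>v\<in>F. (norm (coef v x))\<^sup>2)" and xp: "x \<bullet> p = (\<Sum>v\<in>F. (norm (coef v x))\<^sup>2)"
    unfolding ip by (simp_all add: cp power2_norm_eq_inner)
  have "(norm (x - p))\<^sup>2 = (norm x)\<^sup>2 - (\<Sum>v\<in>F. (norm (coef v x))\<^sup>2)"
    unfolding power2_norm_eq_inner using pp xp
    by (simp add: inner_diff_left inner_diff_right inner_commute[of p x] power2_norm_eq_inner)
  then show "(\<Sum>v\<in>F. (norm (coef v x))\<^sup>2) \<le> (norm x)\<^sup>2"
    using zero_le_power2[of "norm (x - p)"] by linarith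
  assume tot: "\<And>y. (\<And>v. v \<in> F \<Longrightarrow> coef v y = 0) \<Longrightarrow> y = 0"
  have "x - p = 0" by (rule tot) (simp add: coef_simps cp)
  then show "(\<Sum>v\<in>F. (norm (coef v x))\<^sup>2) = (norm x)\<^sup>2" using pp by (simp add: power2_norm_eq_inner)
qed

section \<open>Standard unit vectors and infinitude of orthonormal bases\<close>

definition unit :: "nat \<Rightarrow> qh" where
  "unit k = Abs_qh (\<lambda>n. if n = k then qone else 0)"

lemma Rep_unit: "Rep_qh (unit k) = (\<lambda>n. if n = k then qone else 0)"
proof -
  have "summable (\<lambda>n. (norm (if n = k then qone else 0))\<^sup>2)"
    by (rule summable_finite[of "{k}"]) auto
  then show ?thesis unfolding unit_def by (intro Abs_qh_inverse) (simp add: l2H_def)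
qed

lemma inner_unit: "x \<bullet> unit k = Rep_qh x k \<bullet> qone"
proof -
  have "x \<bullet> unit k = (\<Sum>n\<in>{k}. Rep_qh x n \<bullet> Rep_qh (unit k) n)"
    unfolding inner_qh_def by (rule suminf_finite) (auto simp: Rep_unit)
  then show ?thesis by (simp add: Rep_unit)
qed

lemma unit_total:
  assumes "\<And>k q. rmul x q \<bullet> unit k = 0"
  shows "x = 0"
proof -
  have "Rep_qh x k = 0" for k
  proof -
    have "qmul p (qcnj p) \<bullet> qone = (norm p)\<^sup>2" for p
      by (cases p) (simp add: qmul_def qcnj_def qone_def qof_real_def quat_norm2, simp add: power2_eq_square)
    \<comment> \<open>Multiplying by the conjugate of the coordinate turns the hypothesis into the
      vanishing of its squared modulus.\<close>
    then show ?thesis using assms[of "qcnj (Rep_qh x k)" k] by (simp add: inner_unit Rep_rmul)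
  qed
  then show ?thesis by (simp add: Rep_qh_inject[symmetric] Rep_qh_simps fun_eq_iff)
qed

lemma unit_orthonormal: "norm (unit k) = 1" "k \<noteq> l \<Longrightarrow> coef (unit k) (unit l) = 0"
proof -
  have "qone \<bullet> qone = 1" by (simp add: qone_def qof_real_def)
  then show "norm (unit k) = 1" using inner_unit[of "unit k" k] by (simp add: norm_qh_def Rep_unit)
  assume "k \<noteq> l"
  have z: "qmul 0 q = 0" for q by (cases q) (simp add: qmul_def zero_prod_def)
  show "coef (unit k) (unit l) = 0"
    by (rule quat_eqI, simp add: coef_inner inner_commute[of "unit l"] inner_unit Rep_rmul Rep_unit)
      (use \<open>k \<noteq> l\<close> z in auto)
qed

text \<open>Double counting: if \<open>B\<close> had \<open>n\<close> elements, equality in Bessel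
  for \<open>n + 1\<close> unit vectors against \<open>B\<close> would give the sum
  \<open>n + 1\<close>, while Bessel for \<open>B\<close> against these unit vectors bounds the same
  sum by \<open>n\<close>.\<close>

lemma infinite_basis:
  assumes B: "\<And>v. v \<in> B \<Longrightarrow> norm v = 1" "\<And>v w. v \<in> B \<Longrightarrow> w \<in> B \<Longrightarrow> v \<noteq> w \<Longrightarrow> coef v w = 0"
    "\<And>y. (\<And>v. v \<in> B \<Longrightarrow> coef v y = 0) \<Longrightarrow> y = 0"
  shows "infinite B"
proof
  assume fin: "finite B"
  define n where "n = card B"
  have inj: "inj_on unit {..n}"
  proof (rule inj_onI, rule ccontr)
    fix k l assume "unit k = unit l" "k \<noteq> l"
    then have "qone = 0" using unit_orthonormal(2)[of k l] coef_self[OF unit_orthonormal(1)[of k]] by simp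
    then show False by (simp add: qone_def qof_real_def zero_prod_def)
  qed
  have "real (card (unit ` {..n})) = (\<Sum>u\<in>unit ` {..n}. (norm u)\<^sup>2)"
    by (simp add: unit_orthonormal sum.reindex[OF inj] card_image[OF inj])
  also have "\<dots> = (\<Sum>u\<in>unit ` {..n}. \<Sum>v\<in>B. (norm (coef v u))\<^sup>2)"
    using Bessel(2)[OF fin B] by simp
  also have "\<dots> = (\<Sum>v\<in>B. \<Sum>u\<in>unit ` {..n}. (norm (coef u v))\<^sup>2)"
  proof -
    have "(norm (coef v u))\<^sup>2 = (norm (coef u v))\<^sup>2" for u v
      unfolding coef_qcnj[of v u] norm_qcnj ..
    then show ?thesis by (subst sum.swap) (intro sum.cong refl)
  qed
  also have "\<dots> \<le> (\<Sum>v\<in>B. (norm v)\<^sup>2)"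
    by (rule sum_mono, rule Bessel(1)) (auto simp: unit_orthonormal(1) intro!: unit_orthonormal(2))
  also have "\<dots> = real n" using B(1) by (simp add: n_def)
  finally show False using inj by (simp add: card_image)
qed

section \<open>Counting cells along a rectifiable curve\<close>

lemma card_nat_near:
  "finite {k::nat. \<bar>real k - t\<bar> \<le> real r}" "card {k::nat. \<bar>real k - t\<bar> \<le> real r} \<le> 2 * r + 1"
proof -
  have sub: "{k::nat. \<bar>real k - t\<bar> \<le> real r} \<subseteq> nat ` {\<lceil>t - real r\<rceil>..\<lfloor>t + real r\<rfloor>}"
  proof
    fix k :: nat assume "k \<in> {k::nat. \<bar>real k - t\<bar> \<le> real r}"
    then have "t - real r \<le> real_of_int (int k)" "real_of_int (int k) \<le> t + real r" by auto
    then have "int k \<in> {\<lceil>t - real r\<rceil>..\<lfloor>t + real r\<rfloor>}" by (simp only: atLeastAtMost_iff ceiling_le_iff le_floor_iff)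
    then show "k \<in> nat ` {\<lceil>t - real r\<rceil>..\<lfloor>t + real r\<rfloor>}" by (intro image_eqI[of _ _ "int k"]) auto
  qed
  then show "finite {k::nat. \<bar>real k - t\<bar> \<le> real r}" using finite_subset by blast
  have "card {k::nat. \<bar>real k - t\<bar> \<le> real r} \<le> card {\<lceil>t - real r\<rceil>..\<lfloor>t + real r\<rfloor>}"
    using card_mono[OF _ sub] card_image_le[of "{\<lceil>t - real r\<rceil>..\<lfloor>t + real r\<rfloor>}" nat] by simp
  also have "\<dots> \<le> 2 * r + 1"
  proof -
    have "\<lfloor>t + real r\<rfloor> \<le> \<lceil>t - real r\<rceil> + 2 * int r" by linarith
    then show ?thesis by simp
  qed
  finally show "card {k::nat. \<bar>real k - t\<bar> \<le> real r} \<le> 2 * r + 1" .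
qed

lemma card_dyadic_near:
  "finite {k::nat. \<bar>real k / 2 ^ n - t\<bar> \<le> real r / 2 ^ n}"
  "card {k::nat. \<bar>real k / 2 ^ n - t\<bar> \<le> real r / 2 ^ n} \<le> 2 * r + 1"
proof -
  have "\<bar>real k / 2 ^ n - t\<bar> = \<bar>real k - t * 2 ^ n\<bar> / 2 ^ n" for k
  proof -
    have "real k / 2 ^ n - t = (real k - t * 2 ^ n) / 2 ^ n" by (simp add: diff_divide_distrib)
    then show ?thesis by (simp add: abs_divide)
  qed
  then have "{k::nat. \<bar>real k / 2 ^ n - t\<bar> \<le> real r / 2 ^ n} = {k::nat. \<bar>real k - t * 2 ^ n\<bar> \<le> real r}"
    by (simp add: divide_le_cancel)
  then show "finite {k::nat. \<bar>real k / 2 ^ n - t\<bar> \<le> real r / 2 ^ n}"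
    "card {k::nat. \<bar>real k / 2 ^ n - t\<bar> \<le> real r / 2 ^ n} \<le> 2 * r + 1"
    using card_nat_near by auto
qed

context quat_normal
begin

definition approx_spec :: "(real \<times> real) set" where
  "approx_spec = {(a, b). \<forall>e>0. \<exists>x. norm x = 1 \<and> norm (L x - scal a b x) < e}"

text \<open>An approximate eigenvalue is sought inside the cell; there \<open>L\<close> is also
  close to the scalar of the cell, and two scalars that are both close to \<open>L\<close> on one
  unit vector are close to each other.\<close>

lemma cell_spectrum:
  assumes "cell n (k1, k2, k3) x \<noteq> 0"
  obtains a b where "(a, b) \<in> approx_spec" "\<bar>a - (real k1 / 2 ^ n - c)\<bar> \<le> 6 / 2 ^ n"
    "\<bar>b - (real k2 / 2 ^ n - c)\<bar> \<le> 6 / 2 ^ n" "\<bar>2 * c - (real k2 + real k3) / 2 ^ n\<bar> \<le> 6 / 2 ^ n"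
proof -
  let ?P = "cell n (k1, k2, k3)" and ?a = "real k1 / 2 ^ n - c" and ?b = "real k2 / 2 ^ n - c"
  have idem: "?P (?P x) = ?P x" by (rule orthproj_idem[OF orthproj_cell])
  from approx_eigenvalue[OF orthproj_cell commutes_cell idem assms]
  obtain a b where ab: "\<And>e. e > 0 \<Longrightarrow> \<exists>y. ?P y = y \<and> norm y = 1 \<and> norm (L y - scal a b y) < e" by blast
  have "(a, b) \<in> approx_spec" using ab by (fastforce simp: approx_spec_def)
  moreover have le: "sqrt ((a - ?a)\<^sup>2 + (b - ?b)\<^sup>2) \<le> 6 / 2 ^ n"
  proof (rule field_le_epsilon)
    fix e :: real assume "e > 0"
    from ab[OF this] obtain y where y: "?P y = y" "norm y = 1" "norm (L y - scal a b y) < e" by blast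
    have "sqrt ((a - ?a)\<^sup>2 + (b - ?b)\<^sup>2) = norm (scal a b y - scal ?a ?b y)"
      unfolding scal_rules norm_scal y(2) by simp
    also have "\<dots> = norm ((L y - scal ?a ?b y) - (L y - scal a b y))" by simp
    also have "\<dots> \<le> norm (L y - scal ?a ?b y) + norm (L y - scal a b y)" by (rule norm_triangle_ineq4)
    also have "\<dots> \<le> 6 / 2 ^ n + e" using cell_estimate(1)[OF y(1)] y(2,3) by simp
    finally show "sqrt ((a - ?a)\<^sup>2 + (b - ?b)\<^sup>2) \<le> 6 / 2 ^ n + e" .
  qed
  have "\<bar>a - ?a\<bar> \<le> 6 / 2 ^ n" using le real_sqrt_sum_squares_ge1[of "a - ?a" "b - ?b"]
      real_sqrt_sum_squares_ge1[of "- (a - ?a)" "b - ?b"] unfolding power2_minus by linarith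
  moreover have "\<bar>b - ?b\<bar> \<le> 6 / 2 ^ n" using le real_sqrt_sum_squares_ge2[of "b - ?b" "a - ?a"]
      real_sqrt_sum_squares_ge2[of "- (b - ?b)" "a - ?a"] unfolding power2_minus by linarith
  moreover have "\<bar>2 * c - (real k2 + real k3) / 2 ^ n\<bar> \<le> 6 / 2 ^ n"
    by (rule cell_estimate(2)[OF idem assms])
  ultimately show thesis by (rule that)
qed

text \<open>In units of the mesh, \<open>k1\<close> and \<open>k2\<close> lie within 6 + 1 of the
  point of the net, and \<open>k3\<close> within 6 + 7 because it is tied to \<open>k2\<close>. This
  leaves 15 * 15 * 27 = 6075 triples for each sign, hence 12150.\<close>

lemma few_cells:
  assumes X: "finite X" "real (card X) \<le> B * 2 ^ n"
    and near: "\<And>a b. (a, b) \<in> approx_spec \<Longrightarrow>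
      \<exists>p\<in>X. \<bar>a - fst p\<bar> \<le> 1 / 2 ^ n \<and> (\<exists>s\<in>{1, -1}. \<bar>b - s * snd p\<bar> \<le> 1 / 2 ^ n)"
  shows "finite {q. \<exists>x. cell n q x \<noteq> 0}" "real (card {q. \<exists>x. cell n q x \<noteq> 0}) \<le> 12150 * B * 2 ^ n"
proof -
  define A where "A t r = {k::nat. \<bar>real k / 2 ^ n - t\<bar> \<le> real r / 2 ^ n}" for t r
  define Q where "Q p s = A (c + fst p) 7 \<times> A (c + s * snd p) 7 \<times> A (c - s * snd p) 13" for p :: "real \<times> real" and s
  have fA: "finite (A t r)" and cA: "card (A t r) \<le> 2 * r + 1" for t r
    using card_dyadic_near by (auto simp: A_def)
  have cQ: "card (Q p s) \<le> 6075" for p s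
  proof -
    have "card (Q p s) = card (A (c + fst p) 7) * (card (A (c + s * snd p) 7) * card (A (c - s * snd p) 13))"
      by (simp add: Q_def card_cartesian_product)
    also have "\<dots> \<le> 15 * (15 * 27)"
      using cA[of "c + fst p" 7] cA[of "c + s * snd p" 7] cA[of "c - s * snd p" 13] by (intro mult_le_mono) simp_all
    finally show ?thesis by simp
  qed
  have sub: "{q. \<exists>x. cell n q x \<noteq> 0} \<subseteq> (\<Union>p\<in>X. \<Union>s\<in>{1, -1}. Q p s)"
  proof
    fix q assume "q \<in> {q. \<exists>x. cell n q x \<noteq> 0}"
    moreover obtain k1 k2 k3 where "q = (k1, k2, k3)" using prod_cases3 by blast
    ultimately obtain x where q: "q = (k1, k2, k3)" "cell n (k1, k2, k3) x \<noteq> 0" by blast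
    obtain a b where ab: "(a, b) \<in> approx_spec" "\<bar>a - (real k1 / 2 ^ n - c)\<bar> \<le> 6 / 2 ^ n"
      "\<bar>b - (real k2 / 2 ^ n - c)\<bar> \<le> 6 / 2 ^ n" "\<bar>2 * c - (real k2 + real k3) / 2 ^ n\<bar> \<le> 6 / 2 ^ n"
      by (rule cell_spectrum[OF q(2)])
    obtain p s where ps: "p \<in> X" "s \<in> {1, -1}" "\<bar>a - fst p\<bar> \<le> 1 / 2 ^ n" "\<bar>b - s * snd p\<bar> \<le> 1 / 2 ^ n"
      using near[OF ab(1)] by blast
    have six: "6 / 2 ^ n = 6 * (1 / 2 ^ n :: real)" "real 7 / 2 ^ n = 7 * (1 / 2 ^ n :: real)"
      "real 13 / 2 ^ n = 13 * (1 / 2 ^ n :: real)" "(real k2 + real k3) / 2 ^ n = real k2 / 2 ^ n + real k3 / 2 ^ n"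
      by (simp_all add: add_divide_distrib)
    have "k1 \<in> A (c + fst p) 7" "k2 \<in> A (c + s * snd p) 7" "k3 \<in> A (c - s * snd p) 13"
      using ab(2-4) ps(3,4) unfolding A_def mem_Collect_eq six by linarith+
    then show "q \<in> (\<Union>p\<in>X. \<Union>s\<in>{1, -1}. Q p s)" using ps(1,2) unfolding q(1) Q_def by blast
  qed
  have fin: "finite (\<Union>p\<in>X. \<Union>s\<in>{1, -1}. Q p s)" using X(1) fA by (auto simp: Q_def)
  then show "finite {q. \<exists>x. cell n q x \<noteq> 0}" using sub finite_subset by blast
  have "card {q. \<exists>x. cell n q x \<noteq> 0} \<le> card (\<Union>p\<in>X. \<Union>s\<in>{1, -1}. Q p s)" by (rule card_mono[OF fin sub])
  also have "\<dots> \<le> (\<Sum>p\<in>X. card (\<Union>s\<in>{1, -1}. Q p s))" by (rule card_UN_le[OF X(1)])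
  also have "\<dots> \<le> (\<Sum>p\<in>X. 12150)"
  proof (rule sum_mono)
    fix p
    have "card (\<Union>s\<in>{1, -1}. Q p s) \<le> (\<Sum>s\<in>{1, -1}. card (Q p s))" by (rule card_UN_le) simp
    also have "\<dots> \<le> 12150" using cQ[of p 1] cQ[of p "-1"] by simp
    finally show "card (\<Union>s\<in>{1, -1}. Q p s) \<le> 12150" .
  qed
  finally have "card {q. \<exists>x. cell n q x \<noteq> 0} \<le> 12150 * card X" by simp
  then have "real (card {q. \<exists>x. cell n q x \<noteq> 0}) \<le> 12150 * real (card X)" by linarith
  also have "\<dots> \<le> 12150 * B * 2 ^ n" using X(2) by simp
  finally show "real (card {q. \<exists>x. cell n q x \<noteq> 0}) \<le> 12150 * B * 2 ^ n" .
qed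

end

text \<open>The net is a \<open>d\<close>-separated subset of maximal cardinality: ordering it along the curve bounds
  its cardinality by the length.\<close>

lemma rectifiable_net:
  assumes "rectifiable_curve \<gamma>"
  shows "\<exists>B\<ge>0. \<forall>d>0. \<exists>Y. finite Y \<and> Y \<subseteq> \<gamma> ` {0..1} \<and> real (card Y) \<le> B / d + 1 \<and>
    (\<forall>p\<in>\<gamma> ` {0..1}. \<exists>y\<in>Y. norm (p - y) \<le> d)"
proof -
  obtain B where B: "\<And>ts. sorted ts \<Longrightarrow> set ts \<subseteq> {0..1} \<Longrightarrow>
        (\<Sum>i < length ts - 1. norm (\<gamma> (ts ! Suc i) - \<gamma> (ts ! i))) \<le> B"
    using assms by (auto simp: rectifiable_curve_def)
  have B0: "0 \<le> B" using B[of "[]"] by simp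
  have "\<exists>Y. finite Y \<and> Y \<subseteq> \<gamma> ` {0..1} \<and> real (card Y) \<le> B / d + 1 \<and>
    (\<forall>p\<in>\<gamma> ` {0..1}. \<exists>y\<in>Y. norm (p - y) \<le> d)" if d: "d > 0" for d
  proof -
    define sep where "sep Y \<longleftrightarrow> finite Y \<and> Y \<subseteq> \<gamma> ` {0..1} \<and> (\<forall>x\<in>Y. \<forall>y\<in>Y. x \<noteq> y \<longrightarrow> d \<le> norm (x - y))" for Y
    have bound: "real (card Y) \<le> B / d + 1" if Y: "sep Y" for Y
    proof -
      \<comment> \<open>One parameter is chosen for each point, so the curve moves by at least
        \<open>d\<close> between consecutive parameters; the final + 1 arises because there is one
        gap fewer than points.\<close>
      obtain T where T: "T \<subseteq> {0..1}" "Y = \<gamma> ` T" "inj_on \<gamma> T"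
        using Y subset_image_inj[of Y \<gamma> "{0..1}"] by (auto simp: sep_def)
      have fT: "finite T" using T Y by (auto simp: sep_def dest: finite_imageD)
      define ts where "ts = sorted_list_of_set T"
      have ts: "sorted ts" "set ts = T" "distinct ts" "length ts = card Y"
        using fT T card_image[OF T(3)] by (auto simp: ts_def)
      have "real (length ts - 1) * d = (\<Sum>i<length ts - 1. d)" by simp
      also have "\<dots> \<le> (\<Sum>i < length ts - 1. norm (\<gamma> (ts ! Suc i) - \<gamma> (ts ! i)))"
      proof (rule sum_mono)
        fix i assume "i \<in> {..<length ts - 1}"
        then have i: "Suc i < length ts" "i < length ts" by auto
        then have mem: "ts ! Suc i \<in> T" "ts ! i \<in> T" using ts(2) nth_mem by blast+
        have "ts ! Suc i \<noteq> ts ! i" using ts(3) i by (simp add: nth_eq_iff_index_eq)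
        then have "\<gamma> (ts ! Suc i) \<noteq> \<gamma> (ts ! i)" using inj_onD[OF T(3)] mem by blast
        then show "d \<le> norm (\<gamma> (ts ! Suc i) - \<gamma> (ts ! i))" using Y mem T(2) by (auto simp: sep_def)
      qed
      also have "\<dots> \<le> B" using B[OF ts(1)] ts(2) T(1) by simp
      finally have "real (length ts - 1) \<le> B / d" using d by (simp add: field_simps)
      then show ?thesis using ts(4) by linarith
    qed
    have ex: "sep {}" by (simp add: sep_def)
    have bd: "\<forall>Y. sep Y \<longrightarrow> card Y < nat \<lceil>B / d + 2\<rceil>"
    proof (intro allI impI)
      fix Y assume "sep Y"
      from bound[OF this] show "card Y < nat \<lceil>B / d + 2\<rceil>" by linarith
    qed
    obtain Y where Y: "sep Y" "\<And>Z. sep Z \<Longrightarrow> card Z \<le> card Y"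
      using ex_has_greatest_nat[of sep "{}" card, OF ex bd] by blast
    have "\<exists>y\<in>Y. norm (p - y) \<le> d" if p: "p \<in> \<gamma> ` {0..1}" for p
    proof (rule ccontr)
      assume far: "\<not> ?thesis"
      then have "p \<notin> Y" using d by auto
      moreover have "sep (insert p Y)" using Y(1) p far by (auto simp: sep_def norm_minus_commute)
      ultimately show False using Y(2)[of "insert p Y"] Y(1) by (simp add: sep_def)
    qed
    then show ?thesis using Y(1) bound[OF Y(1)] unfolding sep_def by blast
  qed
  then show ?thesis using B0 by blast
qed

section \<open>Operators with prescribed values on an orthonormal sequence\<close>

locale column_operator =
  fixes \<phi> w :: "nat \<Rightarrow> qh" and E :: real
  assumes norm_phi: "\<And>r. norm (\<phi> r) = 1" and orth_phi: "\<And>r s. r \<noteq> s \<Longrightarrow> coef (\<phi> r) (\<phi> s) = 0"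
    and sum_w: "\<And>n. (\<Sum>r<n. (norm (w r))\<^sup>2) \<le> E"
begin

text \<open>The operator with columns \<open>w r\<close>: it sends \<open>\<phi> r\<close> to
  \<open>w r\<close> and vanishes on the orthogonal complement of the sequence. \<open>E\<close>
  bounds its squared Hilbert-Schmidt norm.\<close>

definition op where "op x = (\<Sum>r. rmul (w r) (coef (\<phi> r) x))"

lemma E_nonneg: "0 \<le> E"
  using sum_w[of 0] by simp

lemma sum_coef: "(\<Sum>r<n. (norm (coef (\<phi> r) x))\<^sup>2) \<le> (norm x)\<^sup>2"
proof -
  have inj: "inj_on \<phi> {..<n}"
  proof (rule inj_onI, rule ccontr)
    fix r s assume "\<phi> r = \<phi> s" "r \<noteq> s"
    then have "qone = 0" using orth_phi[of r s] coef_self[OF norm_phi[of r]] by simp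
    then show False by (simp add: qone_def qof_real_def zero_prod_def)
  qed
  have "(\<Sum>v\<in>\<phi> ` {..<n}. (norm (coef v x))\<^sup>2) \<le> (norm x)\<^sup>2"
    by (rule Bessel(1)) (auto simp: norm_phi intro!: orth_phi)
  then show ?thesis by (simp add: sum.reindex[OF inj])
qed

text \<open>Cauchy-Schwarz over the index combines the bound \<open>E\<close> with Bessel. It gives
  absolute convergence and, at the same time, the operator norm bound.\<close>

lemma partial_bound: "(\<Sum>r<n. norm (rmul (w r) (coef (\<phi> r) x))) \<le> sqrt E * norm x"
proof -
  have "(\<Sum>r<n. norm (w r) * norm (coef (\<phi> r) x))\<^sup>2
      \<le> (\<Sum>r<n. (norm (w r))\<^sup>2) * (\<Sum>r<n. (norm (coef (\<phi> r) x))\<^sup>2)"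
    by (rule Cauchy_Schwarz_ineq_sum)
  also have "\<dots> \<le> E * (norm x)\<^sup>2"
    by (intro mult_mono sum_w sum_coef E_nonneg sum_nonneg) auto
  also have "\<dots> = (sqrt E * norm x)\<^sup>2" using E_nonneg by (simp add: power_mult_distrib)
  finally have "(\<Sum>r<n. norm (w r) * norm (coef (\<phi> r) x)) \<le> sqrt E * norm x"
    by (rule power2_le_imp_le) (simp add: E_nonneg)
  then show ?thesis by (simp add: norm_rmul)
qed

lemma summable_norm_op: "summable (\<lambda>r. norm (rmul (w r) (coef (\<phi> r) x)))"
  by (rule summableI_nonneg_bounded[where x = "sqrt E * norm x"]) (use partial_bound in auto)

lemma summable_op: "summable (\<lambda>r. rmul (w r) (coef (\<phi> r) x))"
  by (rule summable_norm_cancel[OF summable_norm_op])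

lemma norm_op: "norm (op x) \<le> sqrt E * norm x"
proof -
  have "norm (op x) \<le> (\<Sum>r. norm (rmul (w r) (coef (\<phi> r) x)))"
    unfolding op_def by (rule summable_norm[OF summable_norm_op])
  also have "\<dots> \<le> sqrt E * norm x" by (rule suminf_le_const[OF summable_norm_op partial_bound])
  finally show ?thesis .
qed

lemma op_add: "op (x + y) = op x + op y"
  unfolding op_def coef_simps rmul_simps by (rule suminf_add[OF summable_op summable_op, symmetric])

lemma op_rmul: "op (rmul x q) = rmul (op x) q"
  unfolding op_def coef_simps rmul_simps(7)[symmetric]
  by (rule bounded_linear.suminf[OF bounded_linear_rmul summable_op, symmetric])

lemma op_phi: "op (\<phi> s) = w s"
proof -
  have z: "rmul x 0 = 0" for x using rmul_simps(5)[of x 0 0] by simp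
  have "op (\<phi> s) = (\<Sum>r\<in>{s}. rmul (w r) (coef (\<phi> r) (\<phi> s)))"
    unfolding op_def by (rule suminf_finite) (auto simp: orth_phi z)
  then show ?thesis by (simp add: coef_self[OF norm_phi] rmul_simps)
qed

lemma bounded_linear_op: "bounded_linear op"
proof (rule bounded_linear_intro[where K = "sqrt E"])
  show "op (t *\<^sub>R x) = t *\<^sub>R op x" for t x using op_rmul[of x "qof_real t"] by (simp add: rmul_simps)
qed (simp_all add: op_add norm_op mult.commute)

end

section \<open>Normal operators on square-summable quaternion sequences\<close>

locale qh_normal =
  fixes DN :: "qseq set" and N :: "qseq \<Rightarrow> qseq" and m j :: quat and K :: "quat set" and \<gamma> :: "real \<Rightarrow> quat"
  assumes lin: "right_linear_op DN N" and dense: "dense_in_H DN" and clo: "closed_op DN N"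
    and normal: "normal_op DN N" and m: "m \<in> sphS" and j: "j \<in> sphS" and jm: "qmul j m = - qmul m j"
    and rect: "rectifiable_curve \<gamma>" and curve: "\<gamma> ` {0..1} \<subseteq> Cm_plus m" "K \<subseteq> \<gamma> ` {0..1}"
    and spectrum: "spherical_spectrum DN N = OmegaK m K"
begin

definition "D = {x. Rep_qh x \<in> DN}"
definition "A x = Abs_qh (N (Rep_qh x))"
definition "D' = {x. Rep_qh x \<in> adj_dom DN N}"
definition "A' x = Abs_qh (adj_op DN N (Rep_qh x))"
definition "I x = rmul x m"
definition "J x = rmul x j"

lemma lin_facts:
  "DN \<subseteq> l2H" "vzero \<in> DN" "x \<in> DN \<Longrightarrow> y \<in> DN \<Longrightarrow> vadd x y \<in> DN" "x \<in> DN \<Longrightarrow> vrmul x q \<in> DN"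
  "x \<in> DN \<Longrightarrow> N x \<in> l2H" "x \<in> DN \<Longrightarrow> y \<in> DN \<Longrightarrow> N (vadd x y) = vadd (N x) (N y)"
  "x \<in> DN \<Longrightarrow> N (vrmul x q) = vrmul (N x) q"
  using lin unfolding right_linear_op_def by blast+

lemma DN_Rep: "y \<in> DN \<Longrightarrow> \<exists>x\<in>D. y = Rep_qh x"
  using lin_facts(1) by (intro bexI[of _ "Abs_qh y"]) (auto simp: Abs_qh_inverse D_def)

lemma Rep_A: "x \<in> D \<Longrightarrow> Rep_qh (A x) = N (Rep_qh x)"
  using lin_facts(5) by (simp add: D_def A_def Abs_qh_inverse)

lemma D_zero: "0 \<in> D" and D_add: "x \<in> D \<Longrightarrow> y \<in> D \<Longrightarrow> x + y \<in> D" and D_rmul: "x \<in> D \<Longrightarrow> rmul x q \<in> D"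
  by (simp_all add: D_def lin_facts flip: Rep_links)

lemma A_add: "x \<in> D \<Longrightarrow> y \<in> D \<Longrightarrow> A (x + y) = A x + A y"
proof -
  assume "x \<in> D" "y \<in> D"
  then have "Rep_qh (A (x + y)) = Rep_qh (A x + A y)"
    by (simp add: Rep_A D_add flip: Rep_links) (simp add: D_def lin_facts)
  then show ?thesis by (simp add: Rep_qh_inject)
qed

lemma A_rmul: "x \<in> D \<Longrightarrow> A (rmul x q) = rmul (A x) q"
proof -
  assume "x \<in> D"
  then have "Rep_qh (A (rmul x q)) = Rep_qh (rmul (A x) q)"
    by (simp add: Rep_A D_rmul flip: Rep_links) (simp add: D_def lin_facts)
  then show ?thesis by (simp add: Rep_qh_inject)
qed

lemma D_scale: "x \<in> D \<Longrightarrow> t *\<^sub>R x \<in> D" and A_scale: "x \<in> D \<Longrightarrow> A (t *\<^sub>R x) = t *\<^sub>R A x"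
  using D_rmul[of x "qof_real t"] A_rmul[of x "qof_real t"] by (auto simp: rmul_simps)

lemma subspace_D: "subspace D"
  by (intro subspaceI D_zero D_add D_scale)

lemma closure_D: "closure D = UNIV"
proof -
  have "x \<in> closure D" for x
    unfolding closure_approachable
  proof (intro allI impI)
    fix e :: real assume "e > 0"
    then obtain y where "y \<in> DN" "l2norm (vsub (Rep_qh x) y) < e"
      using dense Rep_qh[of x] unfolding dense_in_H_def by blast
    then show "\<exists>y\<in>D. dist y x < e"
      using DN_Rep by (metis Rep_links(2,5) dist_commute dist_norm)
  qed
  then show ?thesis by auto
qed

lemma closed_graph_A: "closed ((\<lambda>x. (x, A x)) ` D)"
  unfolding closed_sequential_limits
proof (intro allI impI, elim conjE)
  fix f l assume f: "\<forall>n. f n \<in> (\<lambda>x. (x, A x)) ` D" and l: "f \<longlonglongrightarrow> l"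
  obtain x y where xy: "l = (x, y)" by force
  from f have "\<forall>n. \<exists>z. z \<in> D \<and> f n = (z, A z)" by auto
  then obtain g where g: "\<And>n. g n \<in> D" "\<And>n. f n = (g n, A (g n))" by metis
  have lim: "g \<longlonglongrightarrow> x" "(\<lambda>n. A (g n)) \<longlonglongrightarrow> y"
    using tendsto_fst[OF l] tendsto_snd[OF l] by (simp_all add: g(2) xy)
  have l2: "l2_tendsto (\<lambda>n. Rep_qh (h n)) (Rep_qh z)" if "h \<longlonglongrightarrow> z" for h z
    using tendsto_norm_zero[OF LIM_zero[OF that]] by (simp add: l2_tendsto_def Rep_links)
  have "l2_tendsto (\<lambda>n. N (Rep_qh (g n))) (Rep_qh y)"
    using l2[OF lim(2)] by (simp add: Rep_A[OF g(1)])
  then have "Rep_qh x \<in> DN \<and> N (Rep_qh x) = Rep_qh y"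
    using clo[unfolded closed_op_def, rule_format, of "\<lambda>n. Rep_qh (g n)" "Rep_qh x" "Rep_qh y"]
      l2[OF lim(1)] g(1) Rep_qh by (simp add: D_def)
  then have "x \<in> D" "A x = y" by (auto simp: D_def A_def Rep_qh_inverse)
  then show "l \<in> (\<lambda>x. (x, A x)) ` D" by (auto simp: xy)
qed

text \<open>By right linearity the quaternionic and the real inner product define the same adjoint.\<close>

lemma adjoint_iff:
  "(\<forall>x\<in>DN. l2inner (Rep_qh y) (N x) = l2inner (Rep_qh z) x) \<longleftrightarrow> (\<forall>x\<in>D. y \<bullet> A x = z \<bullet> x)"
proof
  assume l: "\<forall>x\<in>DN. l2inner (Rep_qh y) (N x) = l2inner (Rep_qh z) x"
  show "\<forall>x\<in>D. y \<bullet> A x = z \<bullet> x"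
  proof
    fix x assume x: "x \<in> D"
    then have "coef y (A x) = coef z x" using l unfolding coef_def Rep_A[OF x] by (simp add: D_def)
    then have "coef y (A x) \<bullet> qone = coef z x \<bullet> qone" by simp
    then show "y \<bullet> A x = z \<bullet> x" unfolding coef_inner rmul_simps by (simp add: inner_commute)
  qed
next
  assume r: "\<forall>x\<in>D. y \<bullet> A x = z \<bullet> x"
  show "\<forall>x\<in>DN. l2inner (Rep_qh y) (N x) = l2inner (Rep_qh z) x"
  proof
    fix x' assume "x' \<in> DN"
    then obtain x where x: "x \<in> D" "x' = Rep_qh x" using DN_Rep by blast
    have "coef y (A x) = coef z x"
    proof (rule quat_eqI)
      fix q
      have "coef y (A x) \<bullet> q = rmul y q \<bullet> A x" unfolding coef_inner by (rule inner_commute)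
      also have "\<dots> = y \<bullet> A (rmul x (qcnj q))" using A_rmul[OF x(1)] by (simp add: rmul_inner)
      also have "\<dots> = z \<bullet> rmul x (qcnj q)" using r D_rmul[OF x(1)] by blast
      also have "\<dots> = coef z x \<bullet> q" unfolding coef_inner rmul_inner[symmetric] by (rule inner_commute)
      finally show "coef y (A x) \<bullet> q = coef z x \<bullet> q" .
    qed
    then show "l2inner (Rep_qh y) (N x') = l2inner (Rep_qh z) x'" by (simp add: coef_def x Rep_A)
  qed
qed

lemma D'_iff: "y \<in> D' \<longleftrightarrow> (\<exists>z. \<forall>x\<in>D. y \<bullet> A x = z \<bullet> x)"
proof -
  have "y \<in> D' \<longleftrightarrow> (\<exists>z. \<forall>x\<in>DN. l2inner (Rep_qh y) (N x) = l2inner (Rep_qh z) x)"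
    unfolding D'_def adj_dom_def using Rep_qh by (auto simp: Bex_def) (metis Abs_qh_inverse)
  then show ?thesis unfolding adjoint_iff .
qed

text \<open>Density of the domain makes the vector in the definite description unique.\<close>

lemma adj_op_eq:
  assumes "\<forall>x\<in>D. y \<bullet> A x = z \<bullet> x"
  shows "adj_op DN N (Rep_qh y) = Rep_qh z"
  unfolding adj_op_def
proof (rule the_equality)
  show "Rep_qh z \<in> l2H \<and> (\<forall>x\<in>DN. l2inner (Rep_qh y) (N x) = l2inner (Rep_qh z) x)"
    using assms Rep_qh unfolding adjoint_iff by blast
  fix z' assume z': "z' \<in> l2H \<and> (\<forall>x\<in>DN. l2inner (Rep_qh y) (N x) = l2inner z' x)"
  then have e: "z' = Rep_qh (Abs_qh z')" by (simp add: Abs_qh_inverse)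
  then have "\<forall>x\<in>D. y \<bullet> A x = Abs_qh z' \<bullet> x" using z' adjoint_iff by metis
  then have "Abs_qh z' = z" using assms by (intro inner_eq_on_dense[OF closure_D]) metis
  then show "z' = Rep_qh z" using e by simp
qed

lemma A'_adj: "y \<in> D' \<Longrightarrow> \<forall>x\<in>D. y \<bullet> A x = A' y \<bullet> x"
  unfolding D'_iff A'_def using adj_op_eq by (metis Rep_qh_inverse)

lemma Rep_A': "y \<in> D' \<Longrightarrow> Rep_qh (A' y) = adj_op DN N (Rep_qh y)"
  using adj_op_eq[OF A'_adj] by simp

lemma normal_A:
  "{y \<in> D'. A' y \<in> D} = {x \<in> D. A x \<in> D'}" "x \<in> D \<Longrightarrow> A x \<in> D' \<Longrightarrow> A (A' x) = A' (A x)"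
proof -
  have n: "{y \<in> adj_dom DN N. adj_op DN N y \<in> DN} = {x \<in> DN. N x \<in> adj_dom DN N}"
    "\<forall>x\<in>{x \<in> DN. N x \<in> adj_dom DN N}. N (adj_op DN N x) = adj_op DN N (N x)"
    using normal unfolding normal_op_def Let_def by auto
  have 1: "y \<in> {y \<in> D'. A' y \<in> D} \<longleftrightarrow> Rep_qh y \<in> {y \<in> adj_dom DN N. adj_op DN N y \<in> DN}" for y
    using Rep_A'[of y] by (auto simp: D'_def D_def)
  have 2: "y \<in> {x \<in> D. A x \<in> D'} \<longleftrightarrow> Rep_qh y \<in> {x \<in> DN. N x \<in> adj_dom DN N}" for y
    using Rep_A[of y] by (auto simp: D'_def D_def)
  show dom: "{y \<in> D'. A' y \<in> D} = {x \<in> D. A x \<in> D'}" using 1 2 n(1) by blast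
  assume x: "x \<in> D" "A x \<in> D'"
  then have x': "x \<in> D'" "A' x \<in> D" using dom by auto
  have "N (adj_op DN N (Rep_qh x)) = adj_op DN N (N (Rep_qh x))" using n(2) 2[of x] x by blast
  then have "Rep_qh (A (A' x)) = Rep_qh (A' (A x))"
    by (simp add: Rep_A[OF x'(2)] Rep_A'[OF x'(1)] Rep_A'[OF x(2)] Rep_A[OF x(1)])
  then show "A (A' x) = A' (A x)" by (simp add: Rep_qh_inject)
qed

text \<open>For \<open>q = a + b m\<close> the sum of \<open>q\<close> and its conjugate is
  \<open>2 a\<close> and its squared modulus is \<open>a^2 + b^2\<close>, so the quadratic is
  \<open>Delta_q\<close>. Approximate null vectors contradict the bounded inverse that the resolvent
  set demands.\<close>

lemma spectrum_point:
  assumes "\<And>e. e > 0 \<Longrightarrow> \<exists>x\<in>D. A x \<in> D \<and> norm x = 1 \<and>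
        norm (A (A x) - (2 * a) *\<^sub>R A x + (a\<^sup>2 + b\<^sup>2) *\<^sub>R x) < e"
  shows "qof_real a + b *\<^sub>R m \<in> OmegaK m K"
proof -
  let ?q = "qof_real a + b *\<^sub>R m"
  have qq: "?q + qcnj ?q = qof_real (2 * a)"
  proof -
    obtain b' c d where "m = (0, b', c, d)" by (rule sphS_cases[OF m])
    then show ?thesis by (simp add: qof_real_def qcnj_def)
  qed
  have n2: "(norm ?q)\<^sup>2 = a\<^sup>2 + b\<^sup>2" by (simp add: norm_qof_real_add[OF m])
  have "?q \<notin> spherical_resolvent DN N"
  proof
    assume "?q \<in> spherical_resolvent DN N"
    then obtain C where C: "\<And>x. x \<in> dom_sq DN N \<Longrightarrow> l2norm x \<le> C * l2norm (Delta_q N ?q x)"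
      unfolding spherical_resolvent_def by blast
    \<comment> \<open>The increment by 1 keeps the denominator positive and makes the product with
      the modulus of \<open>C\<close> less than 1.\<close>
    define e where "e = 1 / (\<bar>C\<bar> + 1)"
    have e: "e > 0" by (simp add: e_def)
    from assms[OF e] obtain x where x: "x \<in> D" "A x \<in> D" "norm x = 1"
      "norm (A (A x) - (2 * a) *\<^sub>R A x + (a\<^sup>2 + b\<^sup>2) *\<^sub>R x) < e" by blast
    have "Rep_qh x \<in> dom_sq DN N" using x(1,2) Rep_A[OF x(1)] by (simp add: dom_sq_def D_def)
    moreover have "Delta_q N ?q (Rep_qh x) = Rep_qh (A (A x) - (2 * a) *\<^sub>R A x + (a\<^sup>2 + b\<^sup>2) *\<^sub>R x)"
      unfolding Delta_q_def qq n2 Rep_A[OF x(1), symmetric] Rep_A[OF x(2), symmetric] Rep_links rmul_simps ..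
    ultimately have "1 \<le> C * norm (A (A x) - (2 * a) *\<^sub>R A x + (a\<^sup>2 + b\<^sup>2) *\<^sub>R x)"
      using C[of "Rep_qh x"] x(3) by (simp add: Rep_links)
    also have "\<dots> \<le> \<bar>C\<bar> * norm (A (A x) - (2 * a) *\<^sub>R A x + (a\<^sup>2 + b\<^sup>2) *\<^sub>R x)"
      by (intro mult_right_mono) auto
    also have "\<dots> \<le> \<bar>C\<bar> * e" using x(4) by (intro mult_left_mono) auto
    also have "\<dots> < 1" by (simp add: e_def)
    finally show False by simp
  qed
  then show ?thesis using spectrum by (auto simp: spherical_spectrum_def)
qed

text \<open>The imaginary unit in the representation from \<open>OmegaK\<close> may be
  \<open>m\<close> or \<open>- m\<close>; comparing real parts and moduli determines the second
  coordinate only up to sign.\<close>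

lemma OmegaK_slice:
  assumes "qof_real a + b *\<^sub>R m \<in> OmegaK m K"
  shows "\<exists>s\<in>{1, -1}. qof_real a + (s * b) *\<^sub>R m \<in> K"
proof -
  obtain \<alpha> \<beta> i where h: "qof_real a + b *\<^sub>R m = qof_real \<alpha> + \<beta> *\<^sub>R i" "qof_real \<alpha> + \<beta> *\<^sub>R m \<in> K" "i \<in> sphS"
    using assms unfolding OmegaK_def by blast
  obtain b1 c1 d1 where m': "m = (0, b1, c1, d1)" by (rule sphS_cases[OF m])
  obtain b2 c2 d2 where i': "i = (0, b2, c2, d2)" by (rule sphS_cases[OF h(3)])
  have a: "a = \<alpha>" using h(1) by (simp add: m' i' qof_real_def)
  have "norm (qof_real a + b *\<^sub>R m) = norm (qof_real \<alpha> + \<beta> *\<^sub>R i)" using h(1) by simp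
  then have "b\<^sup>2 = \<beta>\<^sup>2" unfolding norm_qof_real_add[OF m] norm_qof_real_add[OF h(3)] by (simp add: a)
  then have "\<beta> = 1 * b \<or> \<beta> = - 1 * b" by (auto simp: power2_eq_iff)
  then show ?thesis using h(2) a by blast
qed

lemma curve_bounded:
  obtains \<rho> where "\<rho> \<ge> 0" "\<And>a b. qof_real a + b *\<^sub>R m \<in> OmegaK m K \<Longrightarrow> a\<^sup>2 + b\<^sup>2 \<le> \<rho>\<^sup>2"
proof -
  have "compact (\<gamma> ` {0..1})" using rect by (auto simp: rectifiable_curve_def intro: compact_continuous_image)
  then have "bounded (\<gamma> ` {0..1})" by (rule compact_imp_bounded)
  then obtain B where B: "\<And>p. p \<in> \<gamma> ` {0..1} \<Longrightarrow> norm p \<le> B" unfolding bounded_iff by blast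
  have "a\<^sup>2 + b\<^sup>2 \<le> \<bar>B\<bar>\<^sup>2" if ab: "qof_real a + b *\<^sub>R m \<in> OmegaK m K" for a b
  proof -
    obtain s where s: "s \<in> {1, -1::real}" "qof_real a + (s * b) *\<^sub>R m \<in> K" using OmegaK_slice[OF ab] by blast
    have "norm (qof_real a + (s * b) *\<^sub>R m) \<le> B" using B s(2) curve(2) by blast
    then have "(norm (qof_real a + (s * b) *\<^sub>R m))\<^sup>2 \<le> \<bar>B\<bar>\<^sup>2" by (intro power_mono) auto
    then show ?thesis using s(1) by (auto simp: norm_qof_real_add[OF m])
  qed
  then show thesis using that[of "\<bar>B\<bar>"] by simp
qed

lemma quaternion_units:
  "adj I (\<lambda>x. - I x)" "adj J (\<lambda>x. - J x)" "I (I x) = - x" "J (J x) = - x" "I (J x) = - J (I x)"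
  using adj_rmul[of m] adj_rmul[of j] sphS_facts[OF m] sphS_facts[OF j] jm
  by (simp_all add: I_def[abs_def] J_def[abs_def] rmul_simps)

lemma bounded_everywhere: "D = UNIV" "adj A A'" "A (A' x) = A' (A x)"
proof -
  obtain \<rho> where \<rho>: "\<rho> \<ge> 0" "\<And>a b. qof_real a + b *\<^sub>R m \<in> OmegaK m K \<Longrightarrow> a\<^sup>2 + b\<^sup>2 \<le> \<rho>\<^sup>2"
    by (rule curve_bounded) blast
  interpret n: normal_unbounded D D' A A' I J \<rho>
  proof
    show "D' = {y. \<exists>z. \<forall>x\<in>D. y \<bullet> A x = z \<bullet> x}" using D'_iff by auto
    show "y \<in> D' \<Longrightarrow> x \<in> D \<Longrightarrow> y \<bullet> A x = A' y \<bullet> x" for x y using A'_adj by blast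
    show "x \<in> D \<Longrightarrow> I x \<in> D" "x \<in> D \<Longrightarrow> A (I x) = I (A x)" "x \<in> D \<Longrightarrow> J x \<in> D" "x \<in> D \<Longrightarrow> A (J x) = J (A x)" for x
      by (auto simp: I_def J_def D_rmul A_rmul)
    show "a\<^sup>2 + b\<^sup>2 \<le> \<rho>\<^sup>2" if "\<And>e. e > 0 \<Longrightarrow> \<exists>x\<in>D. A x \<in> D \<and> norm x = 1 \<and>
        norm (A (A x) - (2 * a) *\<^sub>R A x + (a\<^sup>2 + b\<^sup>2) *\<^sub>R x) < e" for a b
      by (rule \<rho>(2)[OF spectrum_point[OF that]])
  qed (fact subspace_D closure_D A_add A_scale closed_graph_A normal_A quaternion_units \<rho>(1))+
  show "D = UNIV" "adj A A'" "A (A' x) = A' (A x)" by (fact n.everywhere_bounded)+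
qed

sublocale q: quat_normal A A' I J
  using bounded_everywhere quaternion_units A_rmul by unfold_locales (auto simp: I_def J_def)

lemma scal_rmul: "q.scal a b x = rmul x (qof_real a + b *\<^sub>R m)"
  by (simp add: q.scal_def I_def rmul_simps)

lemma qorth_coef: "y \<in> q.qorth x \<longleftrightarrow> coef x y = 0"
proof
  assume "y \<in> q.qorth x"
  then have y: "y \<bullet> x = 0" "y \<bullet> rmul x m = 0" "y \<bullet> rmul x j = 0" "y \<bullet> rmul x (qmul j m) = 0"
    by (auto simp: q.qorth_def ortho_def q.mults_def I_def J_def rmul_simps)
  show "coef x y = 0"
    by (rule quat_basis[OF m j jm]) (use y in \<open>simp_all add: coef_inner rmul_simps\<close>)
next
  assume "coef x y = 0"
  then have y: "y \<bullet> rmul x p = 0" for p using coef_inner[of x y p] by simp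
  have "y \<bullet> x = 0" using y[of qone] by (simp add: rmul_simps)
  then show "y \<in> q.qorth x"
    by (simp add: q.qorth_def ortho_def q.mults_def I_def J_def rmul_simps(7) y)
qed

lemma approx_spec_OmegaK: "(a, b) \<in> q.approx_spec \<Longrightarrow> qof_real a + b *\<^sub>R m \<in> OmegaK m K"
proof (rule spectrum_point)
  fix e :: real assume ab: "(a, b) \<in> q.approx_spec" and e: "e > 0"
  define k where "k = onorm A + sqrt (a\<^sup>2 + b\<^sup>2) + 1"
  have "0 \<le> onorm A" "0 \<le> sqrt (a\<^sup>2 + b\<^sup>2)" using onorm_pos_le[OF q.blL] by auto
  then have k: "k > 0" unfolding k_def by linarith
  then have "e / k > 0" using e by simp
  then obtain x where x: "norm x = 1" "norm (A x - q.scal a b x) < e / k"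
    using ab unfolding q.approx_spec_def by blast
  have "norm (A (A x) - (2 * a) *\<^sub>R A x + (a\<^sup>2 + b\<^sup>2) *\<^sub>R x) \<le> k * norm (A x - q.scal a b x)"
    using q.quadratic_bound[of x a b] norm_ge_zero[of "A x - q.scal a b x"]
    unfolding k_def distrib_right[of _ 1] mult_1 by linarith
  also have "\<dots> < e" using x(2) k by (simp add: field_simps)
  finally show "\<exists>x\<in>D. A x \<in> D \<and> norm x = 1 \<and>
      norm (A (A x) - (2 * a) *\<^sub>R A x + (a\<^sup>2 + b\<^sup>2) *\<^sub>R x) < e"
    using x(1) bounded_everywhere(1) by auto
qed

text \<open>A net of the curve at distance \<open>2^-n\<close> has at most \<open>B 2^n + 1\<close>
  points, which is at most \<open>(B + 1) 2^n\<close>; each of them is charged with boundedly many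
  cells.\<close>

lemma few_cells_bound:
  "\<exists>C. \<forall>n. finite {q. \<exists>x. q.cell n q x \<noteq> 0} \<and> real (card {q. \<exists>x. q.cell n q x \<noteq> 0}) \<le> C * 2 ^ n"
proof -
  obtain B where B0: "B \<ge> 0" and B: "\<And>d. d > 0 \<Longrightarrow> \<exists>Y. finite Y \<and> Y \<subseteq> \<gamma> ` {0..1} \<and> real (card Y) \<le> B / d + 1 \<and>
    (\<forall>p\<in>\<gamma> ` {0..1}. \<exists>y\<in>Y. norm (p - y) \<le> d)" using rectifiable_net[OF rect] by blast
  \<comment> \<open>Coordinates along the orthonormal vectors \<open>qone\<close> and
    \<open>m\<close>; by Cauchy-Schwarz, passing to them does not increase distances.\<close>
  define co where "co p = (p \<bullet> qone, p \<bullet> m)" for p :: quat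
  note sm = sphS_facts[OF m]
  have one: "qone \<bullet> qone = 1" by (simp add: qone_def qof_real_def)
  have mm: "m \<bullet> m = 1" using sm(2) by (simp add: norm_eq_sqrt_inner)
  have co: "co (qof_real a + b *\<^sub>R m) = (a, b)" for a b
  proof -
    have "qof_real a = a *\<^sub>R qone" by (simp add: qof_real_def qone_def)
    then show ?thesis using one mm sm(4) by (simp add: co_def inner_add_left inner_commute[of m qone])
  qed
  have "finite {q. \<exists>x. q.cell n q x \<noteq> 0} \<and> real (card {q. \<exists>x. q.cell n q x \<noteq> 0}) \<le> 12150 * (B + 1) * 2 ^ n" for n
  proof -
    have "(1::real) / 2 ^ n > 0" by simp
    from B[OF this] obtain Y where Y: "finite Y" "real (card Y) \<le> B / (1 / 2 ^ n) + 1"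
      "\<And>p. p \<in> \<gamma> ` {0..1} \<Longrightarrow> \<exists>y\<in>Y. norm (p - y) \<le> 1 / 2 ^ n" by blast
    have fin: "finite (co ` Y)" using Y(1) by simp
    have "real (card (co ` Y)) \<le> real (card Y)" using card_image_le[OF Y(1)] by simp
    also have "\<dots> \<le> (B + 1) * 2 ^ n"
    proof -
      have "B / (1 / 2 ^ n) + 1 = B * 2 ^ n + 1" "(B + 1) * 2 ^ n = B * 2 ^ n + 2 ^ n" by (simp_all add: distrib_right)
      then show ?thesis using Y(2) one_le_power[of "2::real" n] by linarith
    qed
    finally have cd: "real (card (co ` Y)) \<le> (B + 1) * 2 ^ n" .
    have near: "\<exists>p\<in>co ` Y. \<bar>a - fst p\<bar> \<le> 1 / 2 ^ n \<and> (\<exists>s\<in>{1, -1}. \<bar>b - s * snd p\<bar> \<le> 1 / 2 ^ n)"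
      if ab: "(a, b) \<in> q.approx_spec" for a b
    proof -
      obtain s where s: "s \<in> {1, -1::real}" "qof_real a + (s * b) *\<^sub>R m \<in> K"
        using OmegaK_slice[OF approx_spec_OmegaK[OF ab]] by blast
      then obtain y where y: "y \<in> Y" "norm (qof_real a + (s * b) *\<^sub>R m - y) \<le> 1 / 2 ^ n"
        using Y(3) curve(2) by blast
      let ?p = "qof_real a + (s * b) *\<^sub>R m"
      have "\<bar>(?p - y) \<bullet> qone\<bar> \<le> 1 / 2 ^ n" "\<bar>(?p - y) \<bullet> m\<bar> \<le> 1 / 2 ^ n"
        using Cauchy_Schwarz_ineq2[of "?p - y" qone] Cauchy_Schwarz_ineq2[of "?p - y" m] y(2) one mm
        by (simp_all only: norm_eq_sqrt_inner[of qone] norm_eq_sqrt_inner[of m] real_sqrt_one mult_1_right)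
      moreover have "(?p - y) \<bullet> qone = a - fst (co y)" "(?p - y) \<bullet> m = s * b - snd (co y)"
        using co[of a "s * b"] by (simp_all only: inner_diff_left co_def fst_conv snd_conv prod.inject)
      ultimately have l: "\<bar>a - fst (co y)\<bar> \<le> 1 / 2 ^ n" "\<bar>s * b - snd (co y)\<bar> \<le> 1 / 2 ^ n" by simp_all
      have "\<bar>b - s * snd (co y)\<bar> = \<bar>s * b - snd (co y)\<bar>" using s(1) by (auto simp: abs_minus_commute)
      then show ?thesis using l s(1) y(1) by (metis image_eqI)
    qed
    from q.few_cells[OF fin cd near] show ?thesis by blast
  qed
  then show ?thesis by blast
qed

text \<open>The starting scale \<open>M\<close> absorbs the constant \<open>288 C\<close>. Since an
  orthonormal basis of this space is infinite, the countable set of basis vectors can be enumerated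
  bijectively by the naturals, as \<open>onb\<close> requires.\<close>

lemma quasi_diagonal_basis:
  assumes "\<delta> > 0"
  obtains \<phi> :: "nat \<Rightarrow> qh" and a b :: "nat \<Rightarrow> real" where "\<And>r. norm (\<phi> r) = 1" "\<And>r s. r \<noteq> s \<Longrightarrow> coef (\<phi> r) (\<phi> s) = 0"
    "\<And>y. (\<And>r. coef (\<phi> r) y = 0) \<Longrightarrow> y = 0"
    "\<And>n. (\<Sum>r<n. (norm (A (\<phi> r) - rmul (\<phi> r) (qof_real (a r) + b r *\<^sub>R m)))\<^sup>2) \<le> \<delta>"
proof -
  obtain C where C: "\<And>n. finite {q. \<exists>x. q.cell n q x \<noteq> 0}" "\<And>n. real (card {q. \<exists>x. q.cell n q x \<noteq> 0}) \<le> C * 2 ^ n"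
    using few_cells_bound by blast
  obtain M where "288 * C / \<delta> < 2 ^ M" using real_arch_pow[of 2 "288 * C / \<delta>"] by auto
  then have M: "288 * C / 2 ^ M \<le> \<delta>" using assms by (simp add: field_simps)
  interpret qc: quat_normal_cells A A' I J C unit M
  proof
    show "finite {q. \<exists>x. q.cell n q x \<noteq> 0} \<and> real (card {q. \<exists>x. q.cell n q x \<noteq> 0}) \<le> C * 2 ^ n" for n
      using C by blast
    fix x assume "\<And>k. unit k \<in> q.qorth x"
    then have "coef x (unit k) = 0" for k using qorth_coef by blast
    then have "rmul x p \<bullet> unit k = 0" for k p using coef_inner[of x "unit k" p] by (simp add: inner_commute)
    then show "x = 0" by (rule unit_total)
  qed
  obtain B a b where B: "countable B" "\<And>x. x \<in> B \<Longrightarrow> norm x = 1"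
    "\<And>x y. x \<in> B \<Longrightarrow> y \<in> B \<Longrightarrow> x \<noteq> y \<Longrightarrow> x \<in> q.qorth y"
    "\<And>z. (\<And>x. x \<in> B \<Longrightarrow> x \<in> q.qorth z) \<Longrightarrow> z = 0"
    "\<And>F. finite F \<Longrightarrow> F \<subseteq> B \<Longrightarrow> (\<Sum>x\<in>F. (norm (A x - q.scal (a x) (b x) x))\<^sup>2) \<le> 288 * C / 2 ^ M"
    apply (rule qc.quasi_diagonal)
    subgoal premises prems for B a b by (rule that[OF prems(2-)])
    done
  have orth: "coef v w = 0" if "v \<in> B" "w \<in> B" "v \<noteq> w" for v w
    using B(3)[OF that(2,1)] that(3) qorth_coef by metis
  have total: "y = 0" if y: "\<And>v. v \<in> B \<Longrightarrow> coef v y = 0" for y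
  proof (rule B(4))
    fix x assume "x \<in> B"
    then have "y \<in> q.qorth x" using y qorth_coef by blast
    then show "x \<in> q.qorth y" by (rule q.qorth_sym)
  qed
  have "infinite B" by (rule infinite_basis[OF B(2) orth total])
  then have bij: "bij_betw (from_nat_into B) UNIV B" using B(1) by (rule bij_betw_from_nat_into[rotated])
  define \<phi> where "\<phi> = from_nat_into B"
  have \<phi>: "inj \<phi>" "range \<phi> = B" using bij by (auto simp: bij_betw_def \<phi>_def)
  show thesis
  proof (rule that[of \<phi> "\<lambda>r. a (\<phi> r)" "\<lambda>r. b (\<phi> r)"])
    show "norm (\<phi> r) = 1" for r using B(2) \<phi>(2) by blast
    show "coef (\<phi> r) (\<phi> s) = 0" if "r \<noteq> s" for r s using orth \<phi> that by (metis injD rangeI)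
    show "y = 0" if "\<And>r. coef (\<phi> r) y = 0" for y using total \<phi>(2) that by (metis imageE)
    fix n
    have "(\<Sum>r<n. (norm (A (\<phi> r) - rmul (\<phi> r) (qof_real (a (\<phi> r)) + b (\<phi> r) *\<^sub>R m)))\<^sup>2)
        = (\<Sum>x\<in>\<phi> ` {..<n}. (norm (A x - q.scal (a x) (b x) x))\<^sup>2)"
      using \<phi>(1) by (subst sum.reindex) (auto simp: scal_rmul inj_on_def inj_def)
    also have "\<dots> \<le> \<delta>" using B(5)[of "\<phi> ` {..<n}"] \<phi>(2) M by fastforce
    finally show "(\<Sum>r<n. (norm (A (\<phi> r) - rmul (\<phi> r) (qof_real (a (\<phi> r)) + b (\<phi> r) *\<^sub>R m)))\<^sup>2) \<le> \<delta>" .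
  qed
qed

lemma DN_l2H: "DN = l2H"
proof
  show "DN \<subseteq> l2H" using lin by (simp add: right_linear_op_def)
  show "l2H \<subseteq> DN"
  proof
    fix y assume "y \<in> l2H"
    then have "Rep_qh (Abs_qh y) = y" by (rule Abs_qh_inverse)
    moreover have "Abs_qh y \<in> D" using bounded_everywhere(1) by simp
    ultimately show "y \<in> DN" by (simp add: D_def)
  qed
qed

text \<open>The operator \<open>c.op\<close> carries exactly the errors \<open>w r\<close> on the
  basis, so subtracting it from \<open>A\<close> leaves a bounded operator that is diagonal there.
  It is closed because it is bounded and everywhere defined.\<close>

lemma perturbation:
  assumes "\<epsilon> > 0"
  shows "\<exists>DD Dop Kp. diagonal_op DD Dop \<and> DD = DN \<and> hilbert_schmidt Kp \<and> op_norm Kp < \<epsilon> \<and>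
            (\<forall>x\<in>DN. N x = vadd (Dop x) (Kp x))"
proof -
  \<comment> \<open>The operator norm is bounded by the root of \<open>\<delta>\<close>; halving
    \<open>\<epsilon>\<close> makes the final inequality strict.\<close>
  define \<delta> where "\<delta> = (\<epsilon> / 2)\<^sup>2"
  have d0: "\<delta> > 0" using assms by (simp add: \<delta>_def)
  obtain \<phi> :: "nat \<Rightarrow> qh" and a b :: "nat \<Rightarrow> real" where \<phi>: "\<And>r. norm (\<phi> r) = 1" "\<And>r s. r \<noteq> s \<Longrightarrow> coef (\<phi> r) (\<phi> s) = 0"
    "\<And>y. (\<And>r. coef (\<phi> r) y = 0) \<Longrightarrow> y = 0"
    "\<And>n. (\<Sum>r<n. (norm (A (\<phi> r) - rmul (\<phi> r) (qof_real (a r) + b r *\<^sub>R m)))\<^sup>2) \<le> \<delta>"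
    apply (rule quasi_diagonal_basis[OF d0])
    subgoal premises prems for \<phi> a b by (rule that[OF prems(2-)])
    done
  define w where "w r = A (\<phi> r) - rmul (\<phi> r) (qof_real (a r) + b r *\<^sub>R m)" for r
  interpret c: column_operator \<phi> w \<delta>
    by unfold_locales (rule \<phi>(1), erule \<phi>(2), unfold w_def, rule \<phi>(4))
  define T where "T x = A x - c.op x" for x
  define Kp where "Kp x = Rep_qh (c.op (Abs_qh x))" for x
  define Dop where "Dop x = Rep_qh (T (Abs_qh x))" for x
  have l2: "\<exists>z. x = Rep_qh z" if "x \<in> l2H" for x using Abs_qh_inverse[OF that] by metis
  have KR: "Kp (Rep_qh x) = Rep_qh (c.op x)" and DR: "Dop (Rep_qh x) = Rep_qh (T x)" for x
    by (simp_all add: Kp_def Dop_def Rep_qh_inverse)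
  have Ain: "x \<in> D" for x using bounded_everywhere(1) by simp
  have rl: "right_linear_op l2H (\<lambda>x. Rep_qh (f (Abs_qh x)))"
    if "\<And>x y. f (x + y) = f x + f y" "\<And>x q. f (rmul x q) = rmul (f x) q" for f
    unfolding right_linear_op_def
  proof (intro conjI ballI allI)
    show "vzero \<in> l2H" using Rep_qh[of 0] by (simp add: Rep_links)
    fix x y q assume "x \<in> l2H" "y \<in> l2H"
    then obtain x' y' where [simp]: "x = Rep_qh x'" "y = Rep_qh y'" using l2 by blast
    show "vadd x y \<in> l2H" "Rep_qh (f (Abs_qh (vadd x y))) = vadd (Rep_qh (f (Abs_qh x))) (Rep_qh (f (Abs_qh y)))"
      using Rep_qh by (simp_all add: Rep_links Rep_qh_inverse that)
  next
    fix x q assume "x \<in> l2H"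
    then obtain x' where [simp]: "x = Rep_qh x'" using l2 by blast
    show "vrmul x q \<in> l2H" "Rep_qh (f (Abs_qh (vrmul x q))) = vrmul (Rep_qh (f (Abs_qh x))) q"
      using Rep_qh by (simp_all add: Rep_links Rep_qh_inverse that)
  qed (use Rep_qh in auto)
  have T: "T (x + y) = T x + T y" "T (rmul x q) = rmul (T x) q" for x y q
    by (simp_all add: T_def c.op_add c.op_rmul A_add[OF Ain Ain] A_rmul[OF Ain] rmul_simps)
  have Tphi: "T (\<phi> r) = rmul (\<phi> r) (qof_real (a r) + b r *\<^sub>R m)" for r
    by (simp add: T_def c.op_phi w_def)
  have blT: "bounded_linear T" unfolding T_def by (intro bounded_linear_sub q.blL c.bounded_linear_op)
  have onb: "onb (\<lambda>r. Rep_qh (\<phi> r))"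
    unfolding onb_def
  proof (intro conjI allI ballI impI)
    show "l2inner (Rep_qh (\<phi> r)) (Rep_qh (\<phi> s)) = (if r = s then qone else 0)" for r s
      using \<phi>(1,2) coef_self by (simp add: coef_def[symmetric])
    fix x assume "x \<in> l2H" and x: "\<forall>r. l2inner (Rep_qh (\<phi> r)) x = 0"
    then obtain x' where x': "x = Rep_qh x'" using l2 by blast
    have "x' = 0" by (rule \<phi>(3)) (use x in \<open>simp add: coef_def x'\<close>)
    then show "x = vzero" by (simp add: x' Rep_links)
  qed (rule Rep_qh)
  have "closed_op l2H Dop"
    unfolding closed_op_def
  proof (intro allI impI, elim conjE)
    fix xs x y assume h: "\<forall>k. xs k \<in> l2H" "x \<in> l2H" "y \<in> l2H" "l2_tendsto xs x" "l2_tendsto (\<lambda>k. Dop (xs k)) y"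
    from h(1) l2 have "\<forall>k. \<exists>z. xs k = Rep_qh z" by blast
    then obtain z where z: "\<And>k. xs k = Rep_qh (z k)" by metis
    obtain x' y' where xy: "x = Rep_qh x'" "y = Rep_qh y'" using l2 h(2,3) by blast
    have n: "(\<lambda>k. norm (z k - x')) \<longlonglongrightarrow> 0" "(\<lambda>k. norm (T (z k) - y')) \<longlonglongrightarrow> 0"
      using h(4,5) by (simp_all add: l2_tendsto_def z xy DR Rep_links)
    have zx: "z \<longlonglongrightarrow> x'" by (rule LIM_zero_cancel[OF tendsto_norm_zero_cancel[OF n(1)]])
    have Ty: "(\<lambda>k. T (z k)) \<longlonglongrightarrow> y'" by (rule LIM_zero_cancel[OF tendsto_norm_zero_cancel[OF n(2)]])
    have "T x' = y'" by (rule LIMSEQ_unique[OF bounded_linear.tendsto[OF blT zx] Ty])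
    then show "x \<in> l2H \<and> Dop x = y" using h(2) by (simp add: xy DR)
  qed
  moreover have "right_linear_op l2H Dop" unfolding Dop_def[abs_def] by (rule rl[OF T])
  moreover have "Dop (Rep_qh (\<phi> r)) = vrmul (Rep_qh (\<phi> r)) (qof_real (a r) + b r *\<^sub>R m)" for r
    by (simp add: DR Tphi Rep_links)
  ultimately have diag: "diagonal_op DN Dop"
    unfolding diagonal_op_def using onb dense Rep_qh unfolding DN_l2H
    by (intro conjI exI[of _ "\<lambda>r. Rep_qh (\<phi> r)"] exI[of _ "\<lambda>r. qof_real (a r) + b r *\<^sub>R m"]) auto
  have nK: "l2norm (Kp x) \<le> \<epsilon> / 2 * l2norm x" if xl: "x \<in> l2H" for x
  proof -
    obtain x' where x': "x = Rep_qh x'" using l2[OF xl] by blast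
    have "sqrt \<delta> = \<epsilon> / 2" using assms by (simp add: \<delta>_def)
    with c.norm_op[of x'] have "norm (c.op x') \<le> \<epsilon> / 2 * norm x'" by (simp only:)
    then show ?thesis unfolding x' KR Rep_links .
  qed
  have "right_linear_op l2H Kp" unfolding Kp_def[abs_def] by (rule rl[OF c.op_add c.op_rmul])
  then have "bounded_op Kp" unfolding bounded_op_def using nK by blast
  moreover have "summable (\<lambda>r. (l2norm (Kp (Rep_qh (\<phi> r))))\<^sup>2)"
    unfolding KR Rep_links c.op_phi
    by (rule summableI_nonneg_bounded[where x = \<delta>]) (use c.sum_w in auto)
  ultimately have HS: "hilbert_schmidt Kp" unfolding hilbert_schmidt_def using onb by blast
  have "op_norm Kp \<le> \<epsilon> / 2"
    unfolding op_norm_def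
  proof (rule cSUP_least)
    show "{x \<in> l2H. l2norm x \<le> 1} \<noteq> {}" using Rep_qh[of 0] Rep_links(5)[of 0] by auto
    fix x assume "x \<in> {x \<in> l2H. l2norm x \<le> 1}"
    then have "l2norm (Kp x) \<le> \<epsilon> / 2 * l2norm x" "l2norm x \<le> 1" using nK by auto
    moreover have "\<epsilon> / 2 * l2norm x \<le> \<epsilon> / 2 * 1" using calculation(2) assms by (intro mult_left_mono) auto
    ultimately show "l2norm (Kp x) \<le> \<epsilon> / 2" by linarith
  qed
  then have "op_norm Kp < \<epsilon>" using assms by linarith
  moreover have "N x = vadd (Dop x) (Kp x)" if xD: "x \<in> DN" for x
  proof -
    obtain x' where x': "x = Rep_qh x'" using l2 xD DN_l2H by blast
    then show ?thesis using Rep_A[OF Ain[of x']] by (simp add: DR KR Rep_links T_def)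
  qed
  ultimately show ?thesis using diag HS by blast
qed

end

theorem theorem3p6:
  fixes DN :: "qseq set" and N :: "qseq \<Rightarrow> qseq" and m :: quat and K :: "quat set"
  assumes "right_linear_op DN N"
    and "dense_in_H DN"
    and "closed_op DN N"
    and "normal_op DN N"
    and "m \<in> sphS"
    and "\<exists>\<gamma>. rectifiable_curve \<gamma> \<and> \<gamma> ` {0..1} \<subseteq> Cm_plus m \<and> K \<subseteq> \<gamma> ` {0..1}"
    and "spherical_spectrum DN N = OmegaK m K"
  shows "\<forall>\<epsilon>>0. \<exists>DD Dop Kp. diagonal_op DD Dop \<and> DD = DN \<and>
            hilbert_schmidt Kp \<and> op_norm Kp < \<epsilon> \<and>
            (\<forall>x\<in>DN. N x = vadd (Dop x) (Kp x))"
proof -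
  obtain \<gamma> where \<gamma>: "rectifiable_curve \<gamma>" "\<gamma> ` {0..1} \<subseteq> Cm_plus m" "K \<subseteq> \<gamma> ` {0..1}"
    using assms(6) by blast
  obtain j where j: "j \<in> sphS" "qmul j m = - qmul m j" using sphS_anticommuting[OF assms(5)] .
  interpret qh_normal DN N m j K \<gamma>
    by unfold_locales (fact assms j \<gamma>)+
  show ?thesis using perturbation by blast
qed

end
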